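(* Let $n\ge 3$ be an integer and let $P$ be a convex integer $N$-gon of one of the types I$_n$, II$_n$, III$_n$, IV$_n$, V$_n$, VI$_n$. Then: (i) $N\le 2n+2$; (ii) if the vertices of $P$ belong to a lattice with invariant factors $(1,n/2)$ (with $n$ even), then $N\le 2n$; (iii) if the vertices of $P$ belong to a lattice with invariant factors $(1,n)$, then $N\le 2n-2$.
   Context: A convex polygon is the convex hull of a finite set of points of $\mathbb{R}^2$ that has nonempty interior; it is an $N$-gon if it has $N$ vertices, and an integer polygon if all its vertices lie in $\mathbb{Z}^2$. Write $n\mathbb{Z}^2=(n\mathbb{Z})\times(n\mathbb{Z})$, $\mathbf 0=(0,0)$, and $[\mathbf a,\mathbf b]$ for the segment with endpoints $\mathbf a,\mathbf b$. A line or a segment splits a polygon if it divides the polygon into two parts with nonempty interior. If a sublattice of $\mathbb{Z}^2$ is spanned by the columns of a nonsingular integer $2\times2$ matrix $A=(a_{ij})$, its invariant factors are $(\delta,m)$ with $\delta=\gcd(a_{ij})$, $m=|\det A|/\delta$ (independent of $A$). A lattice with given invariant factors means a sublattice of $\mathbb{Z}^2$. Let $P$ be an integer polygon free of points of $n\mathbb{Z}^2$, $n\ge2$. Then $P$ is a - type I$_n$ polygon if it lies in a slab of the form $jn\le x_1\le (j+1)n$ or $jn\le x_2\le (j+1)n$ with $j\in\mathbb{Z}$; - type II$_n$ polygon if each of the segments $[\mathbf 0,(n,0)]$, $[(n,0),(n,n)]$, $[(0,n),(n,n)]$, $[\mathbf 0,(0,n)]$ splits $P$; - type III$_n$ polygon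 if each of the segments $[\mathbf 0,(n,0)]$, $[(n,0),(n,n)]$, $[(n,n),(0,n)]$ splits $P$, and the line $x_1=0$ does not split $P$; - type IV$_n$ polygon if each of the segments $[\mathbf 0,(0,n)]$, $[\mathbf 0,(n,0)]$, $[(n,0),(n,n)]$, $[(n,n),(2n,n)]$ splits $P$, and $P$ has no common points with the lines $x_1=-n$ and $x_1=2n$; - type V$_n$ polygon if each of the segments $[\mathbf 0,(-n,0)]$, $[\mathbf 0,(0,n)]$ splits $P$, and the lines $x_1=-n$ and $x_2=n$ do not split $P$; - type VI$_n$ polygon if each of the segments $[\mathbf 0,(-n,0)]$, $[\mathbf 0,(0,n)]$, $[(0,n),(n,n)]$ splits $P$, and the lines $x_1=n$ and $x_1=-n$ do not split $P$. *)

theory Defs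
  imports "HOL-Analysis.Analysis"
begin

definition vertices :: "(real^2) set \<Rightarrow> (real^2) set" where
  "vertices P = {v. v extreme_point_of P}"

definition convex_polygon :: "(real^2) set \<Rightarrow> bool" where
  "convex_polygon P \<longleftrightarrow> (\<exists>V. finite V \<and> P = convex hull V) \<and> interior P \<noteq> {}"

definition ngon :: "nat \<Rightarrow> (real^2) set \<Rightarrow> bool" where
  "ngon N P \<longleftrightarrow> convex_polygon P \<and> card (vertices P) = N"

text \<open>\<open>scaled_lattice n\<close> is the lattice $n\mathbb{Z}^2$, as a set of real points.\<close>

definition scaled_lattice :: "nat \<Rightarrow> (real^2) set" where
  "scaled_lattice n = {x. \<forall>i. \<exists>k::int. x $ i = real n * of_int k}"

definition integer_polygon :: "(real^2) set \<Rightarrow> bool" where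
  "integer_polygon P \<longleftrightarrow> convex_polygon P \<and> vertices P \<subseteq> scaled_lattice 1"

text \<open>Polygons are closed sets, so boundary points count: a free polygon has no point of
  $n\mathbb{Z}^2$ in its interior or on its boundary.\<close>

definition free_integer_polygon :: "nat \<Rightarrow> (real^2) set \<Rightarrow> bool" where
  "free_integer_polygon n P \<longleftrightarrow> integer_polygon P \<and> P \<inter> scaled_lattice n = {}"

text \<open>A line or segment \<open>S\<close> divides \<open>P\<close> into parts, namely the connected components of
  \<open>P - S\<close>; there have to be two of them, each with nonempty interior. In particular, a
  segment that enters \<open>P\<close> without cutting through it, or a line that only supports \<open>P\<close>,
  does not split \<open>P\<close>.\<close>

definition splits_polygon :: "(real^2) set \<Rightarrow> (real^2) set \<Rightarrow> bool" where
  "splits_polygon S P \<longleftrightarrow>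
     (\<exists>A B. components (P - S) = {A, B} \<and> A \<noteq> B \<and> interior A \<noteq> {} \<and> interior B \<noteq> {})"

definition has_invariant_factors :: "(real^2) set \<Rightarrow> int \<Rightarrow> int \<Rightarrow> bool" where
  "has_invariant_factors L d m \<longleftrightarrow>
     (\<exists>A::int^2^2. det A \<noteq> 0 \<and>
        L = range (\<lambda>z::int^2. \<chi> i. real_of_int ((A *v z) $ i)) \<and>
        d = Gcd (range (\<lambda>(i, j). A $ i $ j)) \<and>
        m = \<bar>det A\<bar> div d)"

text \<open>\<open>seg n a b c d\<close> is the segment with endpoints $(an,bn)$ and $(cn,dn)$;
  \<open>vline a\<close> and \<open>hline a\<close> are the lines $x_1=a$ and $x_2=a$.\<close>

definition seg :: "nat \<Rightarrow> int \<Rightarrow> int \<Rightarrow> int \<Rightarrow> int \<Rightarrow> (real^2) set" where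
  "seg n a b c d =
     closed_segment (vector [of_int a * real n, of_int b * real n])
                    (vector [of_int c * real n, of_int d * real n])"

definition vline :: "real \<Rightarrow> (real^2) set" where
  "vline a = {x. x $ 1 = a}"

definition hline :: "real \<Rightarrow> (real^2) set" where
  "hline a = {x. x $ 2 = a}"

definition type_I :: "nat \<Rightarrow> (real^2) set \<Rightarrow> bool" where
  "type_I n P \<longleftrightarrow> free_integer_polygon n P \<and>
     (\<exists>j::int. P \<subseteq> {x. of_int j * real n \<le> x $ 1 \<and> x $ 1 \<le> (of_int j + 1) * real n} \<or>
               P \<subseteq> {x. of_int j * real n \<le> x $ 2 \<and> x $ 2 \<le> (of_int j + 1) * real n})"

definition type_II :: "nat \<Rightarrow> (real^2) set \<Rightarrow> bool" where
  "type_II n P \<longleftrightarrow> free_integer_polygon n P \<and>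
     splits_polygon (seg n 0 0 1 0) P \<and>
     splits_polygon (seg n 1 0 1 1) P \<and>
     splits_polygon (seg n 0 1 1 1) P \<and>
     splits_polygon (seg n 0 0 0 1) P"

definition type_III :: "nat \<Rightarrow> (real^2) set \<Rightarrow> bool" where
  "type_III n P \<longleftrightarrow> free_integer_polygon n P \<and>
     splits_polygon (seg n 0 0 1 0) P \<and>
     splits_polygon (seg n 1 0 1 1) P \<and>
     splits_polygon (seg n 1 1 0 1) P \<and>
     \<not> splits_polygon (vline 0) P"

definition type_IV :: "nat \<Rightarrow> (real^2) set \<Rightarrow> bool" where
  "type_IV n P \<longleftrightarrow> free_integer_polygon n P \<and>
     splits_polygon (seg n 0 0 0 1) P \<and>
     splits_polygon (seg n 0 0 1 0) P \<and>
     splits_polygon (seg n 1 0 1 1) P \<and>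
     splits_polygon (seg n 1 1 2 1) P \<and>
     P \<inter> vline (- real n) = {} \<and>
     P \<inter> vline (2 * real n) = {}"

definition type_V :: "nat \<Rightarrow> (real^2) set \<Rightarrow> bool" where
  "type_V n P \<longleftrightarrow> free_integer_polygon n P \<and>
     splits_polygon (seg n 0 0 (-1) 0) P \<and>
     splits_polygon (seg n 0 0 0 1) P \<and>
     \<not> splits_polygon (vline (- real n)) P \<and>
     \<not> splits_polygon (hline (real n)) P"

definition type_VI :: "nat \<Rightarrow> (real^2) set \<Rightarrow> bool" where
  "type_VI n P \<longleftrightarrow> free_integer_polygon n P \<and>
     splits_polygon (seg n 0 0 (-1) 0) P \<and>
     splits_polygon (seg n 0 0 0 1) P \<and>
     splits_polygon (seg n 0 1 1 1) P \<and>
     \<not> splits_polygon (vline (real n)) P \<and>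
     \<not> splits_polygon (vline (- real n)) P"

end

theory Submission
  imports Defs
begin

text \<open>Everything happens in the set \<open>V\<close> of the vertices, as integer points. The lower and the upper
  boundary of the polygon are chains of edges of increasing slope, and \<open>N\<close> is the number of these
  edges, plus one for every vertical side.

  The key fact is the corner lemma. Let a chain of edges of negative slope start at height \<open>y\<close> to the
  left of the vertical axis, end at abscissa \<open>x\<close> below the horizontal axis, and pass above the origin.
  Then it has at most \<open>(x + y) / 2\<close> edges, and at most \<open>(x + y - 1) / 2\<close> if no two of them form a
  basis of \<open>\<int>\<^sup>2\<close>. A polygon that passes around the four corners of a square of side \<open>n\<close>, as in
  type II, consists of four such chains and of horizontal and vertical edges, and the values \<open>x + y\<close> of
  the four corners add up to \<open>4 n\<close> minus the lengths of these edges. The same summation works for a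
  polygon that passes around the three corners of a triangle and, with an additional estimate next to
  the wall, for type III. In slabs and in the triangle \<open>x, y \<ge> 0\<close>, \<open>x + y \<le> 2 n\<close> one counts by columns
  or bounds the number of edges by weights.

  The remaining types are brought to these by unimodular shears that fix a point of \<open>n\<int>\<^sup>2\<close>: either
  the sheared polygon is of a simpler type, or it is again of the same type, but smaller. In a
  lattice with invariant factors \<open>(1, m)\<close> all determinants are divisible by \<open>m\<close>, so that no two edges
  form a basis.\<close>

text \<open>All geometry is reduced to linear functionals: a point of \<open>n\<int>\<^sup>2\<close>
  outside the polygon is separated from it, and a splitting segment that ends there fixes the sign
  of one coefficient. Functionals transform easily under shears, whereas splitting would have to be
  proved anew after each of them. The three bounds come from one count. Four corners give at most 2n
  edges. A horizontal or vertical side of length l uses up l units of the sum 4n but counts as an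
  edge, worth two units, so it adds at most half an edge: 2n + 2. If no two edges form a basis, each
  corner saves half an edge: 2n. If moreover flat sides of length one are impossible, the four
  halves disappear: 2n - 2. The obstacle is a wall in place of a corner, as in type III: there edges
  of width one do not pay for themselves. They are counted separately, and the spacing of their
  slopes makes this count quadratic.\<close>

declare [[smt_timeout = 200]]

section \<open>Chains of edges around a corner\<close>

definition wd :: "(int \<times> int) list \<Rightarrow> int" where "wd es = sum_list (map fst es)"
definition ht :: "(int \<times> int) list \<Rightarrow> int" where "ht es = sum_list (map snd es)"

lemma wd_simps [simp]: "wd [] = 0" "wd (e # es) = fst e + wd es" "wd (es @ fs) = wd es + wd fs"
  "wd (rev es) = wd es"
  by (simp_all add: wd_def rev_map[symmetric])

lemma ht_simps [simp]: "ht [] = 0" "ht (e # es) = snd e + ht es" "ht (es @ fs) = ht es + ht fs"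
  "ht (rev es) = ht es"
  by (simp_all add: ht_def rev_map[symmetric])

definition det2 :: "int \<times> int \<Rightarrow> int \<times> int \<Rightarrow> int" where
  "det2 e f = fst e * snd f - snd e * fst f"

text \<open>Positivity is asked of all pairs, not only of neighbours, so that filtered lists are
  turning again. For edges of positive width it says that the slopes increase strictly.\<close>

definition turning :: "(int \<times> int) list \<Rightarrow> bool" where
  "turning es \<longleftrightarrow> sorted_wrt (\<lambda>e f. 0 < det2 e f) es"

definition no_basis :: "(int \<times> int) list \<Rightarrow> bool" where
  "no_basis es \<longleftrightarrow> (\<forall>e\<in>set es. \<forall>f\<in>set es. \<bar>det2 e f\<bar> \<noteq> 1)"

lemma turning_Nil [simp]: "turning []" by (simp add: turning_def)

lemma turning_Cons: "turning (e # es) \<longleftrightarrow> (\<forall>f\<in>set es. 0 < det2 e f) \<and> turning es"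
  by (simp add: turning_def)

lemma turning_append:
  "turning (es @ fs) \<longleftrightarrow> turning es \<and> turning fs \<and> (\<forall>e\<in>set es. \<forall>f\<in>set fs. 0 < det2 e f)"
  by (simp add: turning_def sorted_wrt_append)

lemma turning_distinct: "turning es \<Longrightarrow> distinct es"
  by (induction es) (auto simp: turning_Cons det2_def)

lemma turning_filter: "turning es \<Longrightarrow> turning (filter P es)"
  by (simp add: turning_def sorted_wrt_filter)

lemma turning_map:
  assumes "turning es" "\<And>e f. e \<in> set es \<Longrightarrow> f \<in> set es \<Longrightarrow> 0 < det2 e f \<Longrightarrow> 0 < det2 (g e) (g f)"
  shows "turning (map g es)"
  using assms by (induction es) (auto simp: turning_Cons)

lemma turning_rev_map:
  assumes "turning es" "\<And>e f. e \<in> set es \<Longrightarrow> f \<in> set es \<Longrightarrow> 0 < det2 e f \<Longrightarrow> 0 < det2 (g f) (g e)"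
  shows "turning (rev (map g es))"
  using assms by (induction es) (auto simp: turning_Cons turning_append)

lemma no_basis_subset: "no_basis es \<Longrightarrow> set fs \<subseteq> set es \<Longrightarrow> no_basis fs"
  unfolding no_basis_def by blast

text \<open>A turning list has no repetitions, so the deficit \<open>c e\<close> of an exceptional
  edge is incurred at most once, however long the list is.\<close>

lemma sum_list_exceptions:
  fixes f :: "'a \<Rightarrow> int"
  assumes "distinct es" "finite E" "\<And>e. e \<in> E \<Longrightarrow> 0 \<le> c e" "\<And>e. e \<in> set es \<Longrightarrow> e \<in> E \<Longrightarrow> - c e \<le> f e"
    "\<And>e. e \<in> set es \<Longrightarrow> e \<notin> E \<Longrightarrow> 0 \<le> f e"
  shows "- sum c E \<le> sum_list (map f es)"
proof -
  have "sum_list (map f es) = sum f (set es)"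
    by (simp add: assms(1) sum_list_distinct_conv_sum_set)
  also have "\<dots> = sum f (set es \<inter> E) + sum f (set es - E)"
    by (metis List.finite_set sum.Int_Diff)
  also have "\<dots> \<ge> sum (\<lambda>e. - c e) (set es \<inter> E) + 0"
    using assms by (intro add_mono sum_mono sum_nonneg) auto
  moreover have "sum c (set es \<inter> E) \<le> sum c E"
    using assms by (intro sum_mono2) auto
  ultimately show ?thesis by (simp add: sum_negf)
qed

lemma sum_list_lin:
  "sum_list (map (\<lambda>e. a * fst e + b * snd e + c) es) = a * wd es + b * ht es + c * int (length es)"
  by (induction es) (auto simp: algebra_simps)

lemma wd_map_lin: "wd (map (\<lambda>e. (a * fst e + b * snd e, c * fst e + d * snd e)) es) = a * wd es + b * ht es"
  by (induction es) (auto simp: algebra_simps)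

lemma ht_map_lin: "ht (map (\<lambda>e. (a * fst e + b * snd e, c * fst e + d * snd e)) es) = c * wd es + d * ht es"
  by (induction es) (auto simp: algebra_simps)

lemma wd_ge_length: "(\<And>e. e \<in> set es \<Longrightarrow> 0 < fst e) \<Longrightarrow> int (length es) \<le> wd es"
  by (induction es) force+

lemma shallow_wide:
  fixes e :: "int \<times> int"
  assumes "snd e < 0" "- snd e \<le> fst e" "e \<noteq> (1,-1)"
  shows "2 \<le> fst e"
proof (rule ccontr)
  assume "\<not> 2 \<le> fst e"
  then have "fst e = 1" "snd e = -1" using assms(1,2) by linarith+
  then show False using assms(3) by (simp add: prod_eq_iff)
qed

text \<open>The only shallow edge of width one is (1,-1), and it occurs at most once; every other
  one pays two units by its width.\<close>

lemma shallow_count: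
  assumes "turning es" "\<And>e. e \<in> set es \<Longrightarrow> snd e < 0 \<and> - snd e \<le> fst e"
  shows "2 * int (length es) \<le> wd es + 1"
proof -
  have "- sum (\<lambda>e. 1) {(1,-1)::int \<times> int} \<le> sum_list (map (\<lambda>e. 1 * fst e + 0 * snd e + (-2)) es)"
  proof (rule sum_list_exceptions)
    fix e assume "e \<in> set es" "e \<notin> {(1, - 1)}"
    then show "0 \<le> 1 * fst e + 0 * snd e + (-2)" using assms(2)[of e] shallow_wide[of e] by auto
  next
    fix e assume "e \<in> set es" "e \<in> {(1, - 1)}"
    then show "- 1 \<le> 1 * fst e + 0 * snd e + (-2)" by auto
  qed (use assms turning_distinct in auto)
  then show ?thesis unfolding sum_list_lin by simp
qed

text \<open>The core of the corner lemma: edges above the diagonal direction pay for their height, the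
  others for their width, so that only \<open>(1,-1)\<close> is paid too little.\<close>

lemma corner_direct:
  fixes d :: int
  assumes tu: "turning (bs @ cs)"
    and bs: "\<And>e. e \<in> set bs \<Longrightarrow> 0 < fst e \<and> fst e < - snd e"
    and cs: "\<And>e. e \<in> set cs \<Longrightarrow> snd e < 0 \<and> - snd e \<le> fst e"
    and d: "d = 0 \<or> d = 1 \<and> no_basis (bs @ cs)"
    and ac: "0 \<le> a + c" "a + c = 0 \<Longrightarrow> 2 \<le> wd bs"
    and tot: "2 \<le> wd bs + wd cs"
  shows "2 * int (length (bs @ cs)) + d \<le> wd cs - ht bs + (a + c)"
proof -
  \<comment> \<open>\<open>B\<close> and \<open>C\<close> are the surpluses over two units per edge,
    so that the claim becomes \<open>d \<le> B + C + (a + c)\<close>. Only (1,-1) has a negative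
    surplus, namely -1.\<close>
  define B where "B = sum_list (map (\<lambda>e. 0 * fst e + (-1) * snd e + (-2)) bs)"
  define C where "C = sum_list (map (\<lambda>e. 1 * fst e + 0 * snd e + (-2)) cs)"
  have dist: "distinct (bs @ cs)" using tu turning_distinct by blast
  have Beq: "B = - ht bs - 2 * int (length bs)" unfolding B_def sum_list_lin by simp
  have Ceq: "C = wd cs - 2 * int (length cs)" unfolding C_def sum_list_lin by simp
  have B0: "0 \<le> B" unfolding B_def by (rule sum_list_nonneg) (use bs in force)
  have C1: "- 1 \<le> C"
    using shallow_count[of cs] tu cs unfolding Ceq by (auto simp: turning_append)
  have C0: "0 \<le> C" if "(1,-1) \<notin> set cs"
    unfolding C_def
  proof (rule sum_list_nonneg)
    fix z assume "z \<in> set (map (\<lambda>e. 1 * fst e + 0 * snd e + (-2)) cs)"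
    then obtain e where e: "e \<in> set cs" "z = fst e - 2" by auto
    moreover have "e \<noteq> (1,-1)" using that e by auto
    ultimately show "0 \<le> z" using cs[OF e(1)] shallow_wide[of e] by auto
  qed
  \<comment> \<open>A steep edge without surplus is (1,-2), which occurs at most once and has width
    one only.\<close>
  have B1: "1 \<le> B" if "2 \<le> wd bs"
  proof (rule ccontr)
    assume "\<not> 1 \<le> B"
    then have z: "B = 0" using B0 by simp
    have "\<forall>e\<in>set bs. 0 * fst e + (-1) * snd e + (-2) = 0"
      using z bs unfolding B_def by (subst (asm) sum_list_nonneg_eq_0_iff) force+
    then have "\<forall>e\<in>set bs. e = (1,-2)" using bs by (force simp: prod_eq_iff)
    then have "set bs \<subseteq> {(1,-2)}" by auto
    moreover have "distinct bs" using dist by simp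
    ultimately have "length bs \<le> 1"
      by (metis card.empty card.insert card_mono distinct_card empty_iff finite.emptyI finite.insertI One_nat_def)
    then show False using that \<open>\<forall>e\<in>set bs. e = (1,-2)\<close> by (cases bs) auto
  qed
  \<comment> \<open>Beside (1,-1), the depth of a steep edge must exceed its width by at least two,
    because this difference is the determinant of the two edges. Its surplus is then at least its
    width.\<close>
  have Bw: "wd bs \<le> B" if "(1,-1) \<in> set cs" "no_basis (bs @ cs)"
  proof -
    have "0 \<le> sum_list (map (\<lambda>e. (-1) * fst e + (-1) * snd e + (-2)) bs)"
    proof (rule sum_list_nonneg)
      fix z assume "z \<in> set (map (\<lambda>e. (-1) * fst e + (-1) * snd e + (-2)) bs)"
      then obtain e where e: "e \<in> set bs" "z = - fst e - snd e - 2" by auto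
      have "\<bar>det2 e (1,-1)\<bar> \<noteq> 1" using that e unfolding no_basis_def by auto
      then show "0 \<le> z" using bs[OF e(1)] e(2) by (auto simp: det2_def)
    qed
    then show ?thesis unfolding sum_list_lin Beq by simp
  qed
  \<comment> \<open>Without steep edges the total width calls for a second shallow edge. Its
    determinant with (1,-1) is none of 0, 1, -1, which forces width at least 3, and this surplus
    makes up for (1,-1).\<close>
  have Cb: "0 \<le> C" if mem: "(1,-1) \<in> set cs" and nb: "no_basis (bs @ cs)" and emp: "bs = []"
  proof -
    have tc: "turning cs" using tu emp by simp
    have ex: "\<exists>e\<in>set cs. e \<noteq> (1,-1)"
    proof (rule ccontr)
      assume "\<not> ?thesis"
      then have all: "set cs \<subseteq> {(1,-1)}" by auto
      then have "length cs \<le> 1" using dist emp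
        by (metis append_Nil card.empty card.insert card_mono distinct_card empty_iff finite.emptyI finite.insertI One_nat_def)
      then show False using tot emp mem all by (cases cs) auto
    qed
    have big: "3 \<le> fst e" if e: "e \<in> set cs" "e \<noteq> (1,-1)" for e
    proof -
      have "\<bar>det2 e (1,-1)\<bar> \<noteq> 1" using mem nb e unfolding no_basis_def by auto
      moreover have "det2 e (1,-1) \<noteq> 0"
      proof -
        obtain xs ys where sp: "cs = xs @ e # ys" using e(1) by (meson split_list)
        then have "(1,-1) \<in> set xs \<or> (1,-1) \<in> set ys" using mem e by auto
        then have "0 < det2 (1,-1) e \<or> 0 < det2 e (1,-1)"
          using tc unfolding sp by (auto simp: turning_append turning_Cons)
        then show ?thesis by (auto simp: det2_def)
      qed
      ultimately show ?thesis using cs[OF e(1)] by (auto simp: det2_def)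
    qed
    have "C = (\<Sum>e\<in>set cs. fst e - 2)"
      using dist unfolding C_def by (simp add: sum_list_distinct_conv_sum_set)
    also have "\<dots> = (\<Sum>e\<in>set cs - {(1,-1)}. fst e - 2) + (fst (1::int,-1::int) - 2)"
      using mem by (simp add: sum.remove)
    also have "(\<Sum>e\<in>set cs - {(1,-1)}. fst e - 2) \<ge> (\<Sum>e\<in>set cs - {(1,-1)}. (1::int))"
      by (rule sum_mono) (use big in force)
    moreover have "(\<Sum>e\<in>set cs - {(1,-1)}. (1::int)) \<ge> 1"
    proof -
      have "0 < card (set cs - {(1,-1)})" using ex by (subst card_gt_0_iff) auto
      then show ?thesis by simp
    qed
    ultimately show ?thesis by simp
  qed
  have "d \<le> B + C + (a + c)"
  proof (cases "d = 0")
    case True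
    then show ?thesis using B0 C1 B1 C0 ac by (cases "a + c = 0") linarith+
  next
    case False
    then have nb: "no_basis (bs @ cs)" and d1: "d = 1" using d by auto
    consider "2 \<le> a + c" | "a + c = 1" | "a + c = 0" using ac by linarith
    then show ?thesis
    proof cases
      case 1 then show ?thesis using B0 C1 d1 by linarith
    next
      case 2
      show ?thesis
      proof (cases "(1,-1) \<in> set cs")
        case True
        show ?thesis
        proof (cases "bs = []")
          case e: True
          then show ?thesis using Cb[OF True nb e] B0 2 d1 by linarith
        next
          case False
          then have "int (length bs) \<le> wd bs" "1 \<le> length bs"
            using bs by (auto intro!: wd_ge_length simp: Suc_le_eq)
          then have "1 \<le> B" using Bw[OF True nb] by linarith
          then show ?thesis using C1 2 d1 by linarith
        qed
      next
        case False then show ?thesis using C0 B0 2 d1 by linarith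
      qed
    next
      case 3
      then show ?thesis using Bw[OF _ nb] ac(2) C0 C1 B1 d1 by (cases "(1,-1) \<in> set cs") linarith+
    qed
  qed
  then show ?thesis unfolding Beq Ceq by simp
qed

lemma split_filter:
  assumes "sorted_wrt R es" "\<And>e f. e \<in> set es \<Longrightarrow> f \<in> set es \<Longrightarrow> R e f \<Longrightarrow> P f \<Longrightarrow> P e"
  shows "es = filter P es @ filter (\<lambda>e. \<not> P e) es"
  using assms
proof (induction es)
  case (Cons e es)
  show ?case
  proof (cases "P e")
    case True
    have "es = filter P es @ filter (\<lambda>e. \<not> P e) es"
      by (rule Cons.IH) (use Cons.prems in auto)
    then show ?thesis using True by simp
  next
    case False
    then have "\<forall>f\<in>set es. \<not> P f" using Cons.prems by auto
    then have "filter P es = []" "filter (\<lambda>e. \<not> P e) es = es"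
      by (auto simp: filter_empty_conv filter_id_conv)
    then show ?thesis using False by simp
  qed
qed simp

lemma slope_mono:
  assumes "0 < det2 e f" "0 < fst e" "0 < fst f" "snd f \<le> s * fst f"
  shows "snd e < s * fst e"
proof -
  have "snd e * fst f < fst e * snd f" using assms(1) by (simp add: det2_def)
  also have "\<dots> \<le> fst e * (s * fst f)" using assms by (intro mult_left_mono) auto
  finally have "snd e * fst f < (s * fst e) * fst f" by (simp add: mult_ac)
  then show ?thesis using assms(3) by (simp add: mult_less_cancel_right)
qed

lemma slope_split_le:
  assumes "turning es" "\<And>e. e \<in> set es \<Longrightarrow> 0 < fst e"
  shows "es = filter (\<lambda>e. snd e \<le> s * fst e) es @ filter (\<lambda>e. s * fst e < snd e) es"
  using split_filter[of _ es "\<lambda>e. snd e \<le> s * fst e"] assms slope_mono[of _ _ s]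
  unfolding turning_def by (simp add: not_le less_imp_le)

lemma slope_split_less:
  assumes "turning es" "\<And>e. e \<in> set es \<Longrightarrow> 0 < fst e"
  shows "es = filter (\<lambda>e. snd e < s * fst e) es @ filter (\<lambda>e. s * fst e \<le> snd e) es"
  using split_filter[of _ es "\<lambda>e. snd e < s * fst e"] assms slope_mono[of _ _ s]
  unfolding turning_def by (simp add: not_less less_imp_le)

text \<open>The hypotheses of the corner lemma for a chain that starts at \<open>(X, Y)\<close>; the choice
  \<open>ps = []\<close> and \<open>ps = es\<close> gives \<open>0 < Y\<close> and \<open>0 < X + wd es\<close>.\<close>

definition rounds_origin :: "real \<Rightarrow> real \<Rightarrow> int \<Rightarrow> int \<Rightarrow> (int \<times> int) list \<Rightarrow> bool" where
  "rounds_origin \<alpha> \<beta> X Y es \<longleftrightarrow> turning es \<and> (\<forall>e\<in>set es. 0 < fst e \<and> snd e < 0) \<and>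
     0 < \<alpha> \<and> 0 < \<beta> \<and> X < 0 \<and> Y + ht es < 0 \<and>
     (\<forall>ps ss. es = ps @ ss \<longrightarrow> 0 < \<alpha> * of_int (X + wd ps) + \<beta> * of_int (Y + ht ps))"

text \<open>Reflection of the chain in the diagonal, followed by a reversal of the direction of
  travel: slopes stay negative, while width and depth change places.\<close>

definition flip :: "(int \<times> int) list \<Rightarrow> (int \<times> int) list" where
  "flip es = rev (map (\<lambda>e. (- snd e, - fst e)) es)"

lemma flip_simps [simp]: "length (flip es) = length es" "wd (flip es) = - ht es" "ht (flip es) = - wd es"
  "flip (flip es) = es" "flip (es @ fs) = flip fs @ flip es"
proof -
  have "wd (map (\<lambda>e. (- snd e, - fst e)) es) = - ht es" "ht (map (\<lambda>e. (- snd e, - fst e)) es) = - wd es"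
    by (induction es) auto
  then show "wd (flip es) = - ht es" "ht (flip es) = - wd es" by (simp_all add: flip_def)
qed (simp_all add: flip_def rev_map o_def)

lemma set_flip: "set (flip es) = (\<lambda>e. (- snd e, - fst e)) ` set es"
  by (simp add: flip_def)

lemma rounds_origin_flip:
  assumes "rounds_origin \<alpha> \<beta> X Y es"
  shows "rounds_origin \<beta> \<alpha> (Y + ht es) (X + wd es) (flip es)"
proof -
  have "turning (flip es)"
    using assms unfolding rounds_origin_def flip_def
    by (intro turning_rev_map) (auto simp: det2_def mult.commute)
  moreover have "0 < \<beta> * of_int (Y + ht es + wd ps) + \<alpha> * of_int (X + wd es + ht ps)"
    if "flip es = ps @ ss" for ps ss
  proof -
    have es: "es = flip ss @ flip ps" using that by (metis flip_simps(4,5))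
    then have "0 < \<alpha> * of_int (X + wd (flip ss)) + \<beta> * of_int (Y + ht (flip ss))"
      using assms unfolding rounds_origin_def by blast
    moreover have "X + wd es + ht ps = X + wd (flip ss)" "Y + ht es + wd ps = Y + ht (flip ss)"
      using es by simp_all
    ultimately show ?thesis by (simp only: add.commute)
  qed
  ultimately show ?thesis using assms unfolding rounds_origin_def by (auto simp: set_flip)
qed

text \<open>If the chain dips below the line of slope \<open>-1\<close> through the origin, its steep part is sheared by
  one unit and treated by induction; the rest is shallow.\<close>

lemma corner_steep:
  fixes d :: int
  assumes R: "rounds_origin \<alpha> \<beta> X Y es" and ab: "\<beta> \<le> \<alpha>"
    and d: "d = 0 \<or> d = 1 \<and> no_basis es"
    and IH: "\<And>\<alpha> \<beta> X' Y' fs. rounds_origin \<alpha> \<beta> X' Y' fs \<Longrightarrow> d = 0 \<or> d = 1 \<and> no_basis fs \<Longrightarrow>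
      X' + wd fs + Y' < X + wd es + Y \<Longrightarrow> 2 * int (length fs) + d \<le> X' + wd fs + Y'"
  shows "2 * int (length es) + d \<le> X + wd es + Y"
proof -
  define bs where "bs = filter (\<lambda>e. snd e < (-1) * fst e) es"
  define cs where "cs = filter (\<lambda>e. (-1) * fst e \<le> snd e) es"
  have tu: "turning es" and sg: "\<And>e. e \<in> set es \<Longrightarrow> 0 < fst e \<and> snd e < 0" and pos: "0 < \<alpha>" "0 < \<beta>"
    and X: "X < 0" and Y: "Y + ht es < 0"
    and pre: "\<And>ps ss. es = ps @ ss \<Longrightarrow> 0 < \<alpha> * of_int (X + wd ps) + \<beta> * of_int (Y + ht ps)"
    using R unfolding rounds_origin_def by auto
  have es: "es = bs @ cs" unfolding bs_def cs_def by (rule slope_split_less[OF tu]) (use sg in auto)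
  have bs: "0 < fst e \<and> fst e < - snd e" if "e \<in> set bs" for e using that sg[of e] unfolding bs_def by auto
  have cs: "snd e < 0 \<and> - snd e \<le> fst e" if "e \<in> set cs" for e using that sg[of e] unfolding cs_def by auto
  define a where "a = X + wd bs"
  define c where "c = Y + ht bs"
  have wcs: "0 \<le> wd cs" using wd_ge_length[of cs] cs by force
  have ac: "0 < \<alpha> * of_int a + \<beta> * of_int c" using pre[OF es] unfolding a_def c_def .
  \<comment> \<open>Since \<beta> \<le> \<alpha>, a point where the functional is positive although
    the coordinate sum is not must lie to the right of the axis.\<close>
  have a1: "1 \<le> a" if "a + c \<le> 0"
  proof -
    have "\<alpha> * of_int a + \<beta> * of_int c = (\<alpha> - \<beta>) * of_int a + \<beta> * of_int (a + c)"
      by (simp add: algebra_simps)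
    moreover have "\<beta> * of_int (a + c) \<le> 0" using that pos by (simp add: mult_nonneg_nonpos)
    ultimately have "0 < (\<alpha> - \<beta>) * of_int a" using ac by linarith
    then have "0 < real_of_int a" using ab by (metis diff_ge_0_iff_ge zero_less_mult_pos
          mult_eq_0_iff order.strict_iff_order)
    then show ?thesis by simp
  qed
  show ?thesis
  proof (cases "0 \<le> a + c")
    case True
    have endp: "0 < X + wd es"
    proof -
      have "0 < \<alpha> * of_int (X + wd es) + \<beta> * of_int (Y + ht es)" using pre[of es "[]"] by simp
      moreover have "\<beta> * of_int (Y + ht es) < 0" using pos Y by (simp add: mult_pos_neg)
      ultimately have "0 < \<alpha> * of_int (X + wd es)" by linarith
      then show ?thesis using pos by (simp add: zero_less_mult_iff)
    qed
    have "2 * int (length (bs @ cs)) + d \<le> wd cs - ht bs + (a + c)"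
    proof (rule corner_direct)
      show "turning (bs @ cs)" using tu es by simp
      show "d = 0 \<or> d = 1 \<and> no_basis (bs @ cs)" using d es by simp
      show "2 \<le> wd bs" if "a + c = 0" using a1 that X unfolding a_def by linarith
      show "2 \<le> wd bs + wd cs" using endp X es by simp
    qed (use bs cs True in auto)
    then show ?thesis using es unfolding a_def c_def by simp
  next
    case False
    then have a: "1 \<le> a" using a1 by linarith
    \<comment> \<open>The shear (x, y) to (x, x + y) subtracts \<beta> from the first coefficient, a
      step of the Euclidean algorithm; \<open>albe\<close> keeps this coefficient positive.\<close>
    define fs where "fs = map (\<lambda>e. (fst e, fst e + snd e)) bs"
    have wfs: "wd fs = wd bs" "ht fs = wd bs + ht bs"
      using wd_map_lin[of 1 0 1 1 bs] ht_map_lin[of 1 0 1 1 bs] unfolding fs_def by simp_all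
    have albe: "\<beta> < \<alpha>"
    proof (rule ccontr)
      assume "\<not> \<beta> < \<alpha>"
      then have "\<alpha> = \<beta>" using ab by simp
      then have "0 < \<alpha> * of_int (a + c)" using ac by (simp add: algebra_simps)
      then show False using pos False by (simp add: zero_less_mult_iff)
    qed
    have "rounds_origin (\<alpha> - \<beta>) \<beta> X (X + Y) fs"
      unfolding rounds_origin_def
    proof (intro conjI allI impI ballI)
      show "turning fs" unfolding fs_def
        by (rule turning_map) (use tu es in \<open>auto simp: turning_append det2_def algebra_simps\<close>)
      fix e assume "e \<in> set fs"
      then show "0 < fst e" "snd e < 0" using bs unfolding fs_def by fastforce+
    next
      show "0 < \<alpha> - \<beta>" "0 < \<beta>" "X < 0" using albe pos X by auto
      show "X + Y + ht fs < 0" using False wfs unfolding a_def c_def by simp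
    next
      fix ps ss assume "fs = ps @ ss"
      then obtain ps' ss' where b: "bs = ps' @ ss'" "ps = map (\<lambda>e. (fst e, fst e + snd e)) ps'"
        unfolding fs_def by (auto simp: map_eq_append_conv)
      have "wd ps = wd ps'" "ht ps = wd ps' + ht ps'"
        using wd_map_lin[of 1 0 1 1 ps'] ht_map_lin[of 1 0 1 1 ps'] unfolding b(2) by simp_all
      moreover have "0 < \<alpha> * of_int (X + wd ps') + \<beta> * of_int (Y + ht ps')"
        using pre[of ps' "ss' @ cs"] es b by simp
      ultimately show "0 < (\<alpha> - \<beta>) * real_of_int (X + wd ps) + \<beta> * real_of_int (X + Y + ht ps)"
        by (simp add: algebra_simps)
    qed
    moreover have "d = 0 \<or> d = 1 \<and> no_basis fs"
    proof -
      have "no_basis fs" if "no_basis es"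
        using that es unfolding no_basis_def fs_def by (auto simp: det2_def algebra_simps)
      then show ?thesis using d by blast
    qed
    moreover have "X + wd fs + (X + Y) < X + wd es + Y" using es wfs wcs X by simp
    ultimately have "2 * int (length fs) + d \<le> X + wd fs + (X + Y)" by (rule IH)
    \<comment> \<open>The extra 1 is absorbed by \<open>X \<le> -1\<close>, since the sheared chain
      starts at height X + Y instead of Y.\<close>
    moreover have "2 * int (length cs) \<le> wd cs + 1"
      by (rule shallow_count) (use tu es cs in \<open>auto simp: turning_append\<close>)
    ultimately show ?thesis using es wfs X by (simp add: fs_def)
  qed
qed

text \<open>Induction on the bound itself, which \<open>flip\<close> leaves unchanged while it
  exchanges \<alpha> and \<beta>; so one may assume \<beta> \<le> \<alpha>. The parameter d carries
  the chains without bases through the same induction.\<close>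

lemma corner:
  fixes d :: int
  assumes "rounds_origin \<alpha> \<beta> X Y es" "d = 0 \<or> d = 1 \<and> no_basis es"
  shows "2 * int (length es) + d \<le> X + wd es + Y"
  using assms
proof (induction "nat (X + wd es + Y)" arbitrary: X Y es \<alpha> \<beta> rule: less_induct)
  case less
  have pos: "0 \<le> X' + wd fs + Y'" if "rounds_origin \<alpha> \<beta> X' Y' fs" for \<alpha> \<beta> X' Y' fs
  proof -
    have "0 < \<alpha>" "0 < \<beta>" "X' < 0" "Y' + ht fs < 0"
      "0 < \<alpha> * of_int (X' + wd fs) + \<beta> * of_int (Y' + ht fs)" "0 < \<alpha> * of_int X' + \<beta> * of_int Y'"
      using that unfolding rounds_origin_def by (force dest: spec[of _ "[]"])+
    moreover from this have "\<beta> * of_int (Y' + ht fs) < 0" "\<alpha> * of_int X' < 0" by (simp_all add: mult_pos_neg)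
    ultimately have "0 < \<alpha> * of_int (X' + wd fs)" "0 < \<beta> * of_int Y'" by linarith+
    then show ?thesis using \<open>0 < \<alpha>\<close> \<open>0 < \<beta>\<close> by (simp add: zero_less_mult_iff)
  qed
  have IH: "2 * int (length fs) + d \<le> X' + wd fs + Y'"
    if "rounds_origin \<alpha> \<beta> X' Y' fs" "d = 0 \<or> d = 1 \<and> no_basis fs" "X' + wd fs + Y' < X + wd es + Y"
    for \<alpha> \<beta> X' Y' fs
    by (rule less.hyps[OF _ that(1,2)]) (use that pos[OF that(1)] in simp)
  show ?case
  proof (cases "\<beta> \<le> \<alpha>")
    case True
    show ?thesis by (rule corner_steep[OF less.prems(1) True less.prems(2)]) (rule IH)
  next
    case False
    have "no_basis (flip es)" if "no_basis es"
      using that unfolding no_basis_def set_flip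
      by (auto simp: det2_def algebra_simps abs_minus_commute)
    then have dd: "d = 0 \<or> d = 1 \<and> no_basis (flip es)" using less.prems(2) by blast
    have "2 * int (length (flip es)) + d \<le> (Y + ht es) + wd (flip es) + (X + wd es)"
      by (rule corner_steep[OF rounds_origin_flip[OF less.prems(1)] _ dd])
        (use False in simp, rule IH, simp_all)
    then show ?thesis by simp
  qed
qed

section \<open>The boundary chains of a convex configuration\<close>

lemma det2_trans:
  assumes "0 < det2 e f" "0 < det2 f g" "0 < fst e" "0 < fst f" "0 < fst g"
  shows "0 < det2 e g"
proof -
  have "fst f * det2 e g = fst g * det2 e f + fst e * det2 f g"
    by (simp add: det2_def algebra_simps)
  then have "0 < fst f * det2 e g" using assms by (simp add: add_pos_pos)
  then show ?thesis using assms(4) by (simp add: zero_less_mult_iff)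
qed

text \<open>Convexity is compared directly only at the first two edges; \<open>det2_trans\<close>
  passes the turn on to the later ones. Prefixes of the edge list stand for the vertices of the
  chain, which avoids indices.\<close>

lemma graph_chain:
  fixes h :: "int \<Rightarrow> int"
  assumes "sorted_wrt (<) xs" "xs \<noteq> []"
    "\<And>a b c. a \<in> set xs \<Longrightarrow> b \<in> set xs \<Longrightarrow> c \<in> set xs \<Longrightarrow> a < b \<Longrightarrow> b < c \<Longrightarrow>
      0 < det2 (b - a, h b - h a) (c - b, h c - h b)"
  shows "\<exists>es. turning es \<and> (\<forall>e\<in>set es. 0 < fst e) \<and> length es + 1 = length xs \<and>
    (\<forall>ps ss. es = ps @ ss \<longrightarrow> hd xs + wd ps \<in> set xs \<and> h (hd xs) + ht ps = h (hd xs + wd ps)) \<and>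
    (\<forall>x\<in>set xs. \<exists>ps ss. es = ps @ ss \<and> hd xs + wd ps = x)"
  using assms
proof (induction xs)
  case (Cons x xs)
  show ?case
  proof (cases xs)
    case Nil
    then show ?thesis by (intro exI[of _ "[]"]) auto
  next
    case (Cons x' xs')
    have xx: "x < x'" using Cons.prems(1) Cons by simp
    have "\<exists>es. turning es \<and> (\<forall>e\<in>set es. 0 < fst e) \<and> length es + 1 = length xs \<and>
      (\<forall>ps ss. es = ps @ ss \<longrightarrow> hd xs + wd ps \<in> set xs \<and> h (hd xs) + ht ps = h (hd xs + wd ps)) \<and>
      (\<forall>x\<in>set xs. \<exists>ps ss. es = ps @ ss \<and> hd xs + wd ps = x)"
      by (rule Cons.IH) (use Cons.prems Cons in auto)
    then obtain es where es: "turning es" "\<forall>e\<in>set es. 0 < fst e" "length es + 1 = length xs"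
      and pre: "\<And>ps ss. es = ps @ ss \<Longrightarrow> x' + wd ps \<in> set xs \<and> h x' + ht ps = h (x' + wd ps)"
      and sur: "\<forall>z\<in>set xs. \<exists>ps ss. es = ps @ ss \<and> x' + wd ps = z"
      using Cons by auto
    define e0 where "e0 = (x' - x, h x' - h x)"
    have tu: "0 < det2 e0 f" if f: "f \<in> set es" for f
    proof -
      obtain e1 es' where e1: "es = e1 # es'" using f by (cases es) auto
      have "x' + fst e1 \<in> set xs" "h x' + snd e1 = h (x' + fst e1)"
        using pre[of "[e1]" es'] e1 by simp_all
      moreover have "0 < fst e1" using es(2) e1 by simp
      ultimately have d01: "0 < det2 e0 e1"
        using Cons.prems(3)[of x x' "x' + fst e1"] xx Cons
        unfolding e0_def by (auto simp: det2_def simp flip: \<open>h x' + snd e1 = h (x' + fst e1)\<close>)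
      show ?thesis
      proof (cases "f = e1")
        case False
        then have "0 < det2 e1 f" using es(1) f e1 by (auto simp: turning_Cons)
        then show ?thesis using d01 es(2) f e1 xx by (intro det2_trans[of e0 e1 f]) (auto simp: e0_def)
      qed (use d01 in simp)
    qed
    show ?thesis
    proof (rule exI[of _ "e0 # es"], intro conjI allI impI ballI)
      show "turning (e0 # es)" using tu es(1) by (simp add: turning_Cons)
      show "length (e0 # es) + 1 = length (x # xs)" using es(3) by simp
    next
      fix e assume "e \<in> set (e0 # es)"
      then show "0 < fst e" using es(2) xx by (auto simp: e0_def)
    next
      fix ps ss assume "e0 # es = ps @ ss"
      then have "ps = [] \<or> (\<exists>ps'. ps = e0 # ps' \<and> es = ps' @ ss)" by (auto simp: Cons_eq_append_conv)
      then show "hd (x # xs) + wd ps \<in> set (x # xs)" "h (hd (x # xs)) + ht ps = h (hd (x # xs) + wd ps)"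
        using pre by (auto simp: e0_def)
    next
      fix z assume z: "z \<in> set (x # xs)"
      show "\<exists>ps ss. e0 # es = ps @ ss \<and> hd (x # xs) + wd ps = z"
      proof (cases "z = x")
        case True then show ?thesis by (intro exI[of _ "[]"] exI[of _ "e0 # es"]) simp
      next
        case False
        then obtain ps ss where "es = ps @ ss" "x' + wd ps = z" using sur z by auto
        then show ?thesis by (intro exI[of _ "e0 # ps"] exI[of _ ss]) (auto simp: e0_def)
      qed
    qed
  qed
qed simp

text \<open>Every point is strictly exposed by a functional. For finite sets this means that no
  point lies in the hull of the others, in a form that unimodular maps carry over directly.\<close>

definition convex_position :: "(int \<times> int) set \<Rightarrow> bool" where
  "convex_position V \<longleftrightarrow> (\<forall>v\<in>V. \<exists>\<alpha> \<beta>::real. \<forall>w\<in>V - {v}.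
     0 < \<alpha> * of_int (fst w - fst v) + \<beta> * of_int (snd w - snd v))"

text \<open>The determinant condition puts v strictly below the segment from p to r, so this is the
  vertex set of the lower boundary, described without the hull.\<close>

definition low :: "(int \<times> int) set \<Rightarrow> (int \<times> int) set" where
  "low V = {v \<in> V. (\<forall>w\<in>V. fst w = fst v \<longrightarrow> snd v \<le> snd w) \<and>
     (\<forall>p\<in>V. \<forall>r\<in>V. fst p < fst v \<longrightarrow> fst v < fst r \<longrightarrow> 0 < det2 (v - p) (r - v))}"

text \<open>Turns upper boundaries into lower ones. It is applied with c = n and c = 2n, so that
  multiples of n stay multiples of n.\<close>

definition refl_y :: "int \<Rightarrow> int \<times> int \<Rightarrow> int \<times> int" where
  "refl_y c v = (fst v, c - snd v)"

lemma refl_y_simps [simp]: "fst (refl_y c v) = fst v" "snd (refl_y c v) = c - snd v"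
  "refl_y c (refl_y c v) = v" "refl_y c (x, y) = (x, c - y)"
  by (simp_all add: refl_y_def)

lemma inj_refl_y: "inj_on (refl_y c) A"
  by (rule inj_onI) (simp add: refl_y_def prod_eq_iff)

text \<open>The last conjunct says that no vertex lies below the chain; it tests lines of integer slope only.\<close>

definition lower_chain :: "(int \<times> int) set \<Rightarrow> int \<Rightarrow> int \<Rightarrow> (int \<times> int) list \<Rightarrow> bool" where
  "lower_chain V X Y es \<longleftrightarrow> turning es \<and> (\<forall>e\<in>set es. 0 < fst e) \<and> length es + 1 = card (low V) \<and>
     (\<forall>ps ss. es = ps @ ss \<longrightarrow> (X + wd ps, Y + ht ps) \<in> V) \<and>
     (\<forall>v\<in>V. X \<le> fst v \<and> fst v \<le> X + wd es) \<and>
     (\<forall>v\<in>V. fst v = X \<longrightarrow> Y \<le> snd v) \<and>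
     (\<forall>v\<in>V. fst v = X + wd es \<longrightarrow> Y + ht es \<le> snd v) \<and>
     (\<forall>s. \<forall>v\<in>V. \<exists>ps ss. es = ps @ ss \<and> Y + ht ps - s * (X + wd ps) \<le> snd v - s * fst v)"

lemma lower_chainD:
  assumes "lower_chain V X Y es"
  shows "turning es" "\<And>e. e \<in> set es \<Longrightarrow> 0 < fst e" "length es + 1 = card (low V)"
    "\<And>ps ss. es = ps @ ss \<Longrightarrow> (X + wd ps, Y + ht ps) \<in> V" "(X, Y) \<in> V" "(X + wd es, Y + ht es) \<in> V"
    "\<And>v. v \<in> V \<Longrightarrow> X \<le> fst v" "\<And>v. v \<in> V \<Longrightarrow> fst v \<le> X + wd es"
    "\<And>v. v \<in> V \<Longrightarrow> fst v = X \<Longrightarrow> Y \<le> snd v"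
    "\<And>v. v \<in> V \<Longrightarrow> fst v = X + wd es \<Longrightarrow> Y + ht es \<le> snd v"
    "\<And>s v. v \<in> V \<Longrightarrow> \<exists>ps ss. es = ps @ ss \<and> Y + ht ps - s * (X + wd ps) \<le> snd v - s * fst v"
proof -
  show pre: "\<And>ps ss. es = ps @ ss \<Longrightarrow> (X + wd ps, Y + ht ps) \<in> V"
    using assms unfolding lower_chain_def by blast
  show "(X, Y) \<in> V" "(X + wd es, Y + ht es) \<in> V" using pre[of "[]" es] pre[of es "[]"] by simp_all
qed (use assms in \<open>unfold lower_chain_def, blast+\<close>)

text \<open>Ties between minimisers are broken to the left. The determinant at w is a sum of two
  nonnegative terms, and the one that belongs to the point further left is then positive.\<close>

lemma low_minimizer:
  assumes "finite V" "v \<in> V"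
  obtains w where "w \<in> low V" "snd w - s * fst w \<le> snd v - s * fst v"
proof -
  define f where "f w = snd w - s * fst w" for w :: "int \<times> int"
  define M where "M = {w \<in> V. \<forall>u\<in>V. f w \<le> f u}"
  have "M \<noteq> {}"
  proof -
    have "Min (f ` V) \<in> f ` V" using assms by (intro Min_in) auto
    then obtain w where "w \<in> V" "f w = Min (f ` V)" by auto
    then have "w \<in> M" using assms(1) by (simp add: M_def)
    then show ?thesis by blast
  qed
  moreover have "finite M" using assms unfolding M_def by simp
  ultimately have "Min (fst ` M) \<in> fst ` M" by (intro Min_in) auto
  then obtain w where w: "w \<in> M" "fst w = Min (fst ` M)" by auto
  have left: "fst w \<le> fst u" if "u \<in> M" for u using w that \<open>finite M\<close> by auto
  have mw: "w \<in> V" "\<And>u. u \<in> V \<Longrightarrow> f w \<le> f u" using w unfolding M_def by auto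
  have "w \<in> low V" unfolding low_def
  proof (safe intro!: mw(1))
    fix x y assume "(x, y) \<in> V" "fst (x, y) = fst w"
    then show "snd w \<le> snd (x, y)" using mw(2)[of "(x,y)"] by (simp add: f_def)
  next
    fix a b c d assume pr: "(a, b) \<in> V" "(c, d) \<in> V" "fst (a, b) < fst w" "fst w < fst (c, d)"
    have "f w < f (a, b)"
    proof (rule ccontr)
      assume "\<not> f w < f (a, b)"
      then have "(a, b) \<in> M" using mw pr unfolding M_def by force
      then show False using left pr by force
    qed
    moreover have "f w \<le> f (c, d)" using mw pr by auto
    moreover have "det2 (w - (a, b)) ((c, d) - w) =
      (fst w - a) * (f (c, d) - f w) + (c - fst w) * (f (a, b) - f w)"
      by (simp add: det2_def f_def algebra_simps)
    ultimately show "0 < det2 (w - (a, b)) ((c, d) - w)"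
      using pr by (simp add: add_nonneg_pos)
  qed
  moreover have "snd w - s * fst w \<le> snd v - s * fst v" using mw(2)[OF assms(2)] by (simp add: f_def)
  ultimately show thesis by (rule that)
qed

lemma lower_chain_exists:
  assumes fin: "finite V" and ne: "V \<noteq> {}"
  shows "\<exists>X Y es. lower_chain V X Y es"
proof -
  define h where "h x = snd (SOME v. v \<in> low V \<and> fst v = x)" for x
  have uniq: "v = w" if "v \<in> low V" "w \<in> low V" "fst v = fst w" for v w
    using that unfolding low_def by (simp add: prod_eq_iff order_antisym)
  have h: "h (fst v) = snd v" if "v \<in> low V" for v
  proof -
    have "(SOME w. w \<in> low V \<and> fst w = fst v) = v" using that uniq by (intro some_equality) auto
    then show ?thesis by (simp add: h_def)
  qed
  have lowV: "low V \<subseteq> V" unfolding low_def by auto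
  have finl: "finite (low V)" using fin lowV finite_subset by blast
  define A where "A = fst ` low V"
  have finA: "finite A" using finl by (simp add: A_def)
  obtain v0 where "v0 \<in> V" using ne by auto
  then obtain w0 where "w0 \<in> low V" using low_minimizer[OF fin, of v0 0] by blast
  then have Ane: "A \<noteq> {}" unfolding A_def by auto
  have Ah: "x \<in> A \<Longrightarrow> (x, h x) \<in> low V" for x unfolding A_def using h by (metis imageE prod.collapse)
  have cardA: "card A = card (low V)" unfolding A_def by (intro card_image inj_onI) (use uniq in auto)
  define xs where "xs = sorted_list_of_set A"
  have xs: "sorted_wrt (<) xs" "set xs = A" "length xs = card A" "xs \<noteq> []"
    using finA Ane unfolding xs_def by (auto simp: sorted_list_of_set.strict_sorted_key_list_of_set)
  have trip: "0 < det2 (b - a, h b - h a) (c - b, h c - h b)"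
    if "a \<in> set xs" "b \<in> set xs" "c \<in> set xs" "a < b" "b < c" for a b c
  proof -
    have "(a, h a) \<in> V" "(c, h c) \<in> V" "(b, h b) \<in> low V" using that Ah xs(2) lowV by auto
    then show ?thesis using that unfolding low_def by force
  qed
  have "\<exists>es. turning es \<and> (\<forall>e\<in>set es. 0 < fst e) \<and> length es + 1 = length xs \<and>
    (\<forall>ps ss. es = ps @ ss \<longrightarrow> hd xs + wd ps \<in> set xs \<and> h (hd xs) + ht ps = h (hd xs + wd ps)) \<and>
    (\<forall>x\<in>set xs. \<exists>ps ss. es = ps @ ss \<and> hd xs + wd ps = x)"
    by (rule graph_chain[OF xs(1,4) trip])
  then obtain es where es: "turning es" "\<forall>e\<in>set es. 0 < fst e" "length es + 1 = length xs"
    and pre: "\<forall>ps ss. es = ps @ ss \<longrightarrow> hd xs + wd ps \<in> set xs \<and> h (hd xs) + ht ps = h (hd xs + wd ps)"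
    and sur: "\<forall>z\<in>set xs. \<exists>ps ss. es = ps @ ss \<and> hd xs + wd ps = z"
    by (elim exE conjE)
  define X where "X = hd xs"
  define Y where "Y = h X"
  have inl: "(X + wd ps, Y + ht ps) \<in> low V" if "es = ps @ ss" for ps ss
  proof -
    have "X + wd ps \<in> A" "Y + ht ps = h (X + wd ps)"
      using pre that xs(2) unfolding X_def Y_def by blast+
    then show ?thesis using Ah by simp
  qed
  have surl: "\<exists>ps ss. es = ps @ ss \<and> w = (X + wd ps, Y + ht ps)" if w: "w \<in> low V" for w
  proof -
    have "fst w \<in> set xs" using w xs(2) A_def by simp
    then obtain ps ss where ps: "es = ps @ ss" "X + wd ps = fst w" using sur unfolding X_def by blast
    then have "w = (X + wd ps, Y + ht ps)" using uniq[OF w inl[OF ps(1)]] by simp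
    then show ?thesis using ps by blast
  qed
  have mono: "0 \<le> wd ps \<and> wd ps \<le> wd es" if "es = ps @ ss" for ps ss
  proof -
    have "int (length ps) \<le> wd ps" "int (length ss) \<le> wd ss"
      using es(2) that by (auto intro!: wd_ge_length)
    then show ?thesis using that by simp
  qed
  have attain: "\<exists>w\<in>low V. fst w \<le> fst v" "\<exists>w\<in>low V. fst v \<le> fst w" if v: "v \<in> V" for v
  proof -
    have mn: "Min (fst ` V) \<in> fst ` V" "Max (fst ` V) \<in> fst ` V" using fin ne by (auto intro!: Min_in Max_in)
    \<comment> \<open>In an extreme column no point has vertices on both sides, so for its lowest
      point the determinant condition of \<open>low\<close> is vacuous.\<close>
    have mem: "\<exists>w\<in>low V. fst w = fst u" if u: "u \<in> V" "(\<forall>p\<in>V. fst u \<le> fst p) \<or> (\<forall>p\<in>V. fst p \<le> fst u)" for u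
    proof -
      define C where "C = {w \<in> V. fst w = fst u}"
      have "finite C" "u \<in> C" using fin u unfolding C_def by auto
      then have "C \<noteq> {}" by blast
      with \<open>finite C\<close> have "Min (snd ` C) \<in> snd ` C" by (intro Min_in) auto
      then obtain w where w: "w \<in> C" "snd w = Min (snd ` C)" by auto
      have "snd w \<le> snd p" if "p \<in> V" "fst p = fst w" for p
      proof -
        have "p \<in> C" using that w(1) unfolding C_def by simp
        then show ?thesis using \<open>finite C\<close> w(2) by simp
      qed
      moreover have "False" if "p \<in> V" "r \<in> V" "fst p < fst w" "fst w < fst r" for p r
        using u(2) that w(1) unfolding C_def by force
      ultimately have "w \<in> low V" using w(1) unfolding low_def C_def by blast
      then show ?thesis using w(1) unfolding C_def by auto
    qed
    obtain u where "u \<in> V" "fst u = Min (fst ` V)" using mn(1) by auto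
    then have "u \<in> V" "\<forall>p\<in>V. fst u \<le> fst p" using fin by auto
    then obtain w where "w \<in> low V" "fst w = fst u" using mem by blast
    then show "\<exists>w\<in>low V. fst w \<le> fst v" using \<open>\<forall>p\<in>V. fst u \<le> fst p\<close> v by (intro bexI[of _ w]) auto
    obtain u where "u \<in> V" "fst u = Max (fst ` V)" using mn(2) by auto
    then have "u \<in> V" "\<forall>p\<in>V. fst p \<le> fst u" using fin by auto
    then obtain w where "w \<in> low V" "fst w = fst u" using mem by blast
    then show "\<exists>w\<in>low V. fst v \<le> fst w" using \<open>\<forall>p\<in>V. fst p \<le> fst u\<close> v by (intro bexI[of _ w]) auto
  qed
  have "lower_chain V X Y es" unfolding lower_chain_def
  proof (intro conjI ballI allI impI)
    show "turning es" "length es + 1 = card (low V)" using es xs cardA by simp_all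
    show "0 < fst e" if "e \<in> set es" for e using es that by simp
    show "(X + wd ps, Y + ht ps) \<in> V" if "es = ps @ ss" for ps ss using inl[OF that] lowV by blast
    show "X \<le> fst v" if v: "v \<in> V" for v
    proof -
      obtain w where w: "w \<in> low V" "fst w \<le> fst v" using attain(1)[OF v] by blast
      then obtain ps ss where "es = ps @ ss" "w = (X + wd ps, Y + ht ps)" using surl by blast
      then show ?thesis using w mono[of ps ss] by simp
    qed
    show "fst v \<le> X + wd es" if v: "v \<in> V" for v
    proof -
      obtain w where w: "w \<in> low V" "fst v \<le> fst w" using attain(2)[OF v] by blast
      then obtain ps ss where ps: "es = ps @ ss" "w = (X + wd ps, Y + ht ps)" using surl by blast
      then have "fst w \<le> X + wd es" using mono[OF ps(1)] by simp
      then show ?thesis using w by linarith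
    qed
    show "Y \<le> snd v" if "v \<in> V" "fst v = X" for v
      using inl[of "[]" es] that unfolding low_def by simp
    show "Y + ht es \<le> snd v" if "v \<in> V" "fst v = X + wd es" for v
      using inl[of es "[]"] that unfolding low_def by simp
    fix s v assume v: "v \<in> V"
    obtain w where w: "w \<in> low V" "snd w - s * fst w \<le> snd v - s * fst v" using low_minimizer[OF fin v] .
    then show "\<exists>ps ss. es = ps @ ss \<and> Y + ht ps - s * (X + wd ps) \<le> snd v - s * fst v"
    proof -
      obtain ps ss where "es = ps @ ss" "w = (X + wd ps, Y + ht ps)" using surl[OF w(1)] by blast
      then show ?thesis using w(2) by (intro exI[of _ ps] exI[of _ ss]) simp
    qed
  qed
  then show ?thesis by blast
qed

lemma refl_y_in_low:
  "refl_y c v \<in> low (refl_y c ` V) \<longleftrightarrow> v \<in> V \<and> (\<forall>w\<in>V. fst w = fst v \<longrightarrow> snd w \<le> snd v) \<and>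
     (\<forall>p\<in>V. \<forall>r\<in>V. fst p < fst v \<longrightarrow> fst v < fst r \<longrightarrow> det2 (v - p) (r - v) < 0)"
proof -
  have "refl_y c v \<in> refl_y c ` V \<longleftrightarrow> v \<in> V" by (metis image_iff refl_y_simps(3))
  moreover have "det2 (refl_y c v - refl_y c p) (refl_y c r - refl_y c v) = - det2 (v - p) (r - v)" for p r
    by (simp add: det2_def algebra_simps)
  ultimately show ?thesis unfolding low_def by simp
qed

text \<open>The coefficient \<beta> of the functional that exposes v has a positive product with
  every determinant at v, so its sign tells on which boundary v lies. If \<beta> = 0, then v is
  alone in an extreme column.\<close>

lemma low_or_high:
  assumes "convex_position V" "v \<in> V"
  shows "v \<in> low V \<or> refl_y c v \<in> low (refl_y c ` V)"
proof -
  obtain \<alpha> \<beta> :: real where ab: "\<And>w. w \<in> V \<Longrightarrow> w \<noteq> v \<Longrightarrow>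
      0 < \<alpha> * of_int (fst w - fst v) + \<beta> * of_int (snd w - snd v)"
    using assms unfolding convex_position_def by (metis Diff_iff singletonD)
  have key: "0 < \<gamma> * real_of_int (det2 (v - p) (r - v))"
    if "p \<in> V" "r \<in> V" "fst p < fst v" "fst v < fst r" "\<gamma> = \<beta>" for p r \<gamma>
  proof -
    have "p \<noteq> v" "r \<noteq> v" using that by auto
    note p = ab[OF that(1) this(1)] and r = ab[OF that(2) this(2)]
    have "0 < of_int (fst v - fst p) * (\<alpha> * of_int (fst r - fst v) + \<beta> * of_int (snd r - snd v)) +
       of_int (fst r - fst v) * (\<alpha> * of_int (fst p - fst v) + \<beta> * of_int (snd p - snd v))"
      by (rule add_pos_pos[OF mult_pos_pos[OF _ r] mult_pos_pos[OF _ p]]) (use that in simp_all)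
    also have "\<dots> = \<gamma> * real_of_int (det2 (v - p) (r - v))"
      by (simp add: that det2_def algebra_simps)
    finally show ?thesis .
  qed
  show ?thesis
  proof (cases "0 < \<beta> \<or> \<beta> = 0")
    case True
    have "\<forall>w\<in>V. fst w = fst v \<longrightarrow> snd v \<le> snd w"
    proof (intro ballI impI)
      fix w assume "w \<in> V" "fst w = fst v"
      then show "snd v \<le> snd w"
        using ab[of w] True by (cases "w = v") (auto simp: zero_less_mult_iff)
    qed
    moreover have "\<forall>p\<in>V. \<forall>r\<in>V. fst p < fst v \<longrightarrow> fst v < fst r \<longrightarrow> 0 < det2 (v - p) (r - v)"
    proof (intro ballI impI)
      fix p r assume "p \<in> V" "r \<in> V" "fst p < fst v" "fst v < fst r"
      from key[OF this refl] show "0 < det2 (v - p) (r - v)"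
        using True by (auto simp: zero_less_mult_iff)
    qed
    ultimately have "v \<in> low V" using assms(2) unfolding low_def by blast
    then show ?thesis ..
  next
    case False
    have "refl_y c v \<in> low (refl_y c ` V)" unfolding refl_y_in_low
    proof (intro conjI ballI impI assms(2))
      fix w assume "w \<in> V" "fst w = fst v"
      then show "snd w \<le> snd v"
        using ab[of w] False by (cases "w = v") (auto simp: zero_less_mult_iff)
    next
      fix p r assume "p \<in> V" "r \<in> V" "fst p < fst v" "fst v < fst r"
      from key[OF this refl] show "det2 (v - p) (r - v) < 0"
        using False by (auto simp: zero_less_mult_iff)
    qed
    then show ?thesis ..
  qed
qed

text \<open>The two chains cover V, and each has one vertex more than edges. Where a vertical side
  is missing they share an end point, so that edges plus vertical sides remain.\<close>

lemma card_le_chains: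
  assumes fin: "finite V" and conv: "convex_position V"
    and lo: "lower_chain V X Y es" and up: "lower_chain (refl_y c ` V) X' Z fs" and ne: "es \<noteq> []"
  shows "X' = X" "wd fs = wd es" "Y \<le> c - Z" "Y + ht es \<le> c - (Z + ht fs)"
    "int (card V) \<le> int (length es) + int (length fs) +
       (if Y = c - Z then 0 else 1) + (if Y + ht es = c - (Z + ht fs) then 0 else 1)"
proof -
  note L = lower_chainD[OF lo] and U = lower_chainD[OF up]
  have loV: "\<And>v. v \<in> V \<Longrightarrow> X \<le> fst v \<and> fst v \<le> X + wd es" "(X, Y) \<in> V" "(X + wd es, Y + ht es) \<in> V"
    "\<And>v. v \<in> V \<Longrightarrow> fst v = X \<Longrightarrow> Y \<le> snd v" "\<And>v. v \<in> V \<Longrightarrow> fst v = X + wd es \<Longrightarrow> Y + ht es \<le> snd v"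
    using L by blast+
  have mem: "u \<in> refl_y c ` V \<longleftrightarrow> refl_y c u \<in> V" for u
    by (metis image_iff refl_y_simps(3))
  have upV: "X' \<le> fst v \<and> fst v \<le> X' + wd fs" "fst v = X' \<Longrightarrow> snd v \<le> c - Z"
    "fst v = X' + wd fs \<Longrightarrow> snd v \<le> c - (Z + ht fs)" if "v \<in> V" for v
  proof -
    have "refl_y c v \<in> refl_y c ` V" using that by blast
    from U(7-10)[OF this] show "X' \<le> fst v \<and> fst v \<le> X' + wd fs" "fst v = X' \<Longrightarrow> snd v \<le> c - Z"
      "fst v = X' + wd fs \<Longrightarrow> snd v \<le> c - (Z + ht fs)" by simp_all
  qed
  have upm: "(X', c - Z) \<in> V" "(X' + wd fs, c - (Z + ht fs)) \<in> V" using U(5,6) unfolding mem by simp_all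
  show XX: "X' = X" using loV(1)[OF upm(1)] upV(1)[OF loV(2)] by simp
  show WW: "wd fs = wd es" using loV(1)[OF upm(2)] upV(1)[OF loV(3)] XX by simp
  show "Y \<le> c - Z" using loV(4)[OF upm(1)] XX by simp
  show "Y + ht es \<le> c - (Z + ht fs)" using loV(5)[OF upm(2)] XX WW by simp
  define H where "H = {v \<in> V. refl_y c v \<in> low (refl_y c ` V)}"
  have lowV: "low V \<subseteq> V" unfolding low_def by auto
  have finH: "finite H" "finite (low V)" using fin lowV finite_subset unfolding H_def by auto
  have "low (refl_y c ` V) \<subseteq> refl_y c ` V" unfolding low_def by blast
  then have "refl_y c ` H = low (refl_y c ` V)"
    unfolding H_def by blast
  then have cH: "card H = card (low (refl_y c ` V))"
    by (metis card_image inj_refl_y)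
  have "V = low V \<union> H" using low_or_high[OF conv] lowV unfolding H_def by auto
  then have "card V + card (low V \<inter> H) = card (low V) + card H"
    using card_Un_Int[of "low V" H] finH by simp
  also have "\<dots> = length es + 1 + (length fs + 1)"
    using lo up cH unfolding lower_chain_def by simp
  finally have total: "card V + card (low V \<inter> H) = length es + length fs + 2" by simp
  have wpos: "0 < wd es"
  proof -
    have "0 < int (length es)" using ne by simp
    also have "\<dots> \<le> wd es" using L(2) by (rule wd_ge_length)
    finally show ?thesis .
  qed
  have edge: "\<not> (fst p < x \<and> x < fst r)" if "p \<in> V" "r \<in> V" "x = X \<or> x = X + wd es" for p r x
    using loV(1)[OF that(1)] loV(1)[OF that(2)] that(3) by auto
  have ends: "(x, y) \<in> low V" if "(x, y) \<in> V" "x = X \<or> x = X + wd es" "\<And>w. w \<in> V \<Longrightarrow> fst w = x \<Longrightarrow> y \<le> snd w" for x y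
    using that edge unfolding low_def by auto
  have ends': "(x, y) \<in> H" if "(x, y) \<in> V" "x = X \<or> x = X + wd es" "\<And>w. w \<in> V \<Longrightarrow> fst w = x \<Longrightarrow> snd w \<le> y" for x y
    using that edge unfolding H_def refl_y_in_low by auto
  have l: "(X, Y) \<in> low V \<inter> H" if "Y = c - Z"
    using ends[of X Y] ends'[of X Y] loV(2,4) upV(2) that XX by auto
  have r: "(X + wd es, Y + ht es) \<in> low V \<inter> H" if "Y + ht es = c - (Z + ht fs)"
    using ends[of "X + wd es" "Y + ht es"] ends'[of "X + wd es" "Y + ht es"] loV(3,5) upV(3) that XX WW
    by auto
  define T where "T = {v. v = (X, Y) \<and> Y = c - Z} \<union> {v. v = (X + wd es, Y + ht es) \<and> Y + ht es = c - (Z + ht fs)}"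
  have "T \<subseteq> low V \<inter> H" using l r unfolding T_def by blast
  then have "card T \<le> card (low V \<inter> H)" using finH by (intro card_mono) auto
  moreover have "int (card T) = (if Y = c - Z then 1 else 0) + (if Y + ht es = c - (Z + ht fs) then 1 else 0)"
    using wpos unfolding T_def by (auto simp: card_insert_if)
  ultimately show "int (card V) \<le> int (length es) + int (length fs) +
       (if Y = c - Z then 0 else 1) + (if Y + ht es = c - (Z + ht fs) then 0 else 1)"
    using total by (auto split: if_splits)
qed

lemma hull_chains:
  assumes "finite V" "convex_position V" "u \<in> V" "v \<in> V" "fst u < fst v"
  obtains X Y es Z fs where "lower_chain V X Y es" "lower_chain (refl_y c ` V) X Z fs" "wd fs = wd es"
    "0 < wd es" "Y + Z \<le> c" "Y + ht es + (Z + ht fs) \<le> c"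
    "int (card V) \<le> int (length es) + int (length fs) +
       (if Y + Z = c then 0 else 1) + (if Y + ht es + (Z + ht fs) = c then 0 else 1)"
proof -
  obtain X Y es where lo: "lower_chain V X Y es" using lower_chain_exists[of V] assms by blast
  obtain X' Z fs where up: "lower_chain (refl_y c ` V) X' Z fs"
    using lower_chain_exists[of "refl_y c ` V"] assms by blast
  have w: "0 < wd es" using lower_chainD(7,8)[OF lo assms(3)] lower_chainD(7,8)[OF lo assms(4)] assms(5) by linarith
  then have "es \<noteq> []" by auto
  note C = card_le_chains[OF assms(1,2) lo up this]
  show thesis
    by (rule that[OF lo up[unfolded C(1)] C(2) w]) (use C(3,4,5) in \<open>auto simp: algebra_simps split: if_splits\<close>)
qed

text \<open>Relative to lines of slope s, a convex chain is lowest where its own slope passes s,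
  that is at the vertex between \<open>as\<close> and \<open>bs\<close>.\<close>

lemma split_minimizes:
  assumes "es = as @ bs" "es = ps @ ss" "\<And>e. e \<in> set as \<Longrightarrow> snd e \<le> s * fst e" "\<And>e. e \<in> set bs \<Longrightarrow> s * fst e \<le> snd e"
  shows "ht as - s * wd as \<le> ht ps - s * wd ps"
proof -
  have A: "ht xs \<le> s * wd xs" if "set xs \<subseteq> set as" for xs
    using that by (induction xs) (use assms(3) in \<open>auto simp: algebra_simps intro: add_mono\<close>)
  have B: "s * wd xs \<le> ht xs" if "set xs \<subseteq> set bs" for xs
    using that by (induction xs) (use assms(4) in \<open>auto simp: algebra_simps intro: add_mono\<close>)
  obtain us where "as = ps @ us \<and> us @ bs = ss \<or> as @ us = ps \<and> bs = us @ ss"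
    using assms(1,2) by (metis append_eq_append_conv2)
  then show ?thesis
  proof
    assume "as = ps @ us \<and> us @ bs = ss"
    then show ?thesis using A[of us] by (auto simp: algebra_simps)
  next
    assume "as @ us = ps \<and> bs = us @ ss"
    then show ?thesis using B[of us] by (auto simp: algebra_simps)
  qed
qed

text \<open>The mirror image of \<open>corner\<close> in a vertical line, after the shear that makes
  lines of slope s horizontal. The corner is at the origin, and the chain is read backwards.\<close>

lemma corner_right:
  fixes d :: int and \<alpha> \<beta> :: real
  assumes tu: "turning es" and sg: "\<And>e. e \<in> set es \<Longrightarrow> 0 < fst e \<and> s * fst e < snd e"
    and ab: "0 < \<alpha>" "0 < \<beta>"
    and pre: "\<And>ps ss. es = ps @ ss \<Longrightarrow>
      0 < - \<alpha> * of_int (X + wd ps) + \<beta> * of_int (Y + ht ps - s * (X + wd ps))"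
    and st: "Y < s * X" and en: "0 < X + wd es" and d: "d = 0 \<or> d = 1 \<and> no_basis es"
  shows "2 * int (length es) + d \<le> - X + (Y + ht es - s * (X + wd es))"
proof -
  define g where "g e = (fst e, s * fst e - snd e)" for e :: "int \<times> int"
  have wg: "wd (map g xs) = wd xs" "ht (map g xs) = s * wd xs - ht xs" for xs
    by (induction xs) (auto simp: g_def algebra_simps)
  have "rounds_origin \<alpha> \<beta> (- (X + wd es)) (Y + ht es - s * (X + wd es)) (rev (map g es))"
    unfolding rounds_origin_def
  proof (intro conjI allI impI ballI)
    show "turning (rev (map g es))"
      by (rule turning_rev_map[OF tu]) (simp add: det2_def g_def algebra_simps)
    fix e assume "e \<in> set (rev (map g es))"
    then show "0 < fst e" "snd e < 0" using sg by (auto simp: g_def)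
  next
    fix ps ss assume "rev (map g es) = ps @ ss"
    then have "map g es = rev ss @ rev ps" by (metis rev_append rev_rev_ident)
    then obtain xs ys where x: "es = xs @ ys" "rev ps = map g ys" by (auto simp: map_eq_append_conv)
    have ps: "ps = rev (map g ys)" using x(2) by (metis rev_rev_ident)
    have eq: "- (X + wd es) + wd ps = - (X + wd xs)"
      "Y + ht es - s * (X + wd es) + ht ps = Y + ht xs - s * (X + wd xs)"
      unfolding ps x(1) by (simp_all add: wg algebra_simps)
    then show "0 < \<alpha> * real_of_int (- (X + wd es) + wd ps) +
           \<beta> * real_of_int (Y + ht es - s * (X + wd es) + ht ps)"
      using pre[OF x(1)] by (simp only: eq of_int_minus mult_minus_left mult_minus_right)
  qed (use ab st en in \<open>simp_all add: wg algebra_simps\<close>)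
  moreover have "d = 0 \<or> d = 1 \<and> no_basis (rev (map g es))"
  proof -
    have "no_basis (rev (map g es))" if "no_basis es"
      unfolding no_basis_def
    proof (intro ballI)
      fix e f assume "e \<in> set (rev (map g es))" "f \<in> set (rev (map g es))"
      then obtain e' f' where ef: "e = g e'" "f = g f'" "e' \<in> set es" "f' \<in> set es" by auto
      have "det2 e f = - det2 e' f'" unfolding ef g_def by (simp add: det2_def algebra_simps)
      then show "\<bar>det2 e f\<bar> \<noteq> 1" using that ef unfolding no_basis_def by simp
    qed
    then show ?thesis using d by blast
  qed
  ultimately have "2 * int (length (rev (map g es))) + d
      \<le> - (X + wd es) + wd (rev (map g es)) + (Y + ht es - s * (X + wd es))"
    by (rule corner)
  then show ?thesis by (simp add: wg)
qed

lemma flat_le_1: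
  assumes "turning es" "\<And>e f. e \<in> set es \<Longrightarrow> f \<in> set es \<Longrightarrow> det2 e f = 0"
  shows "length es \<le> 1"
  using assms by (cases es; cases "tl es") (auto simp: turning_Cons)

text \<open>The falling edges form a chain around (0,0), the rising ones a chain around (n,0). The
  single horizontal edge between them pays only its width for two units, and z bounds what is
  missing.\<close>

lemma half_two_corners:
  fixes d n z :: int and \<alpha> \<beta> \<gamma> \<delta> :: real
  assumes ch: "lower_chain V X Y es" and X: "X < 0" "n < X + wd es" and v: "v \<in> V" "snd v < 0"
    and ab: "0 < \<alpha>" "0 < \<beta>" "\<And>v. v \<in> V \<Longrightarrow> 0 < \<alpha> * of_int (fst v) + \<beta> * of_int (snd v)"
    and gd: "0 < \<gamma>" "0 < \<delta>" "\<And>v. v \<in> V \<Longrightarrow> 0 < \<gamma> * of_int (n - fst v) + \<delta> * of_int (snd v)"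
    and d: "d = 0 \<or> d = 1 \<and> no_basis es"
    and z: "0 \<le> z" "\<And>e. e \<in> set es \<Longrightarrow> snd e = 0 \<Longrightarrow> 2 - fst e \<le> z"
  shows "2 * int (length es) + 2 * d \<le> n + Y + (Y + ht es) + z"
proof -
  note L = lower_chainD[OF ch]
  define as where "as = filter (\<lambda>e. snd e < 0 * fst e) es"
  define rs where "rs = filter (\<lambda>e. 0 * fst e \<le> snd e) es"
  define zs where "zs = filter (\<lambda>e. snd e \<le> 0 * fst e) rs"
  define bs where "bs = filter (\<lambda>e. 0 * fst e < snd e) rs"
  have es: "es = as @ rs" unfolding as_def rs_def by (rule slope_split_less[OF L(1,2)])
  have "turning rs" using L(1) es by (metis turning_append)
  then have rs: "rs = zs @ bs" unfolding zs_def bs_def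
    by (rule slope_split_le) (use L(2) es in auto)
  have pre: "(X + wd ps, Y + ht ps) \<in> V" if "es = ps @ ss" for ps ss using L(4)[OF that] .
  have tu: "turning as" "turning zs" "turning bs" using L(1) es rs by (auto simp: turning_append)
  have zs0: "snd e = 0" if "e \<in> set zs" for e using that unfolding zs_def rs_def by auto
  have low: "Y + ht as < 0"
  proof -
    obtain ps ss where "es = ps @ ss" "Y + ht ps - 0 * (X + wd ps) \<le> snd v - 0 * fst v"
      using L(11)[OF v(1), of 0] by blast
    moreover from this have "ht as - 0 * wd as \<le> ht ps - 0 * wd ps"
      by (intro split_minimizes[OF es]) (auto simp: as_def rs_def)
    ultimately show ?thesis using v by simp
  qed
  have dd: "d = 0 \<or> d = 1 \<and> no_basis as" "d = 0 \<or> d = 1 \<and> no_basis bs"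
    using d no_basis_subset[of es as] no_basis_subset[of es bs] es rs by auto
  have "rounds_origin \<alpha> \<beta> X Y as" unfolding rounds_origin_def
  proof (intro conjI allI impI ballI)
    fix ps ss assume "as = ps @ ss"
    then have "(X + wd ps, Y + ht ps) \<in> V" using pre[of ps "ss @ rs"] es by simp
    from ab(3)[OF this] show "0 < \<alpha> * real_of_int (X + wd ps) + \<beta> * real_of_int (Y + ht ps)" by simp
  qed (use tu ab(1,2) X low L(2) in \<open>auto simp: as_def\<close>)
  from corner[OF this dd(1)] have A: "2 * int (length as) + d \<le> X + wd as + Y" .
  have hz: "ht zs = 0" using zs0 by (induction zs) auto
  have B: "2 * int (length bs) + d \<le> - (X + wd as + wd zs - n) + (Y + ht es)"
  proof -
    have "2 * int (length bs) + d \<le> - (X + wd as + wd zs - n) +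
      ((Y + ht as + ht zs) + ht bs - 0 * (X + wd as + wd zs - n + wd bs))"
    proof (rule corner_right[OF tu(3) _ gd(1,2)])
      show "0 < fst e \<and> 0 * fst e < snd e" if e: "e \<in> set bs" for e
      proof -
        have "e \<in> set es" using e es rs by simp
        then show ?thesis using L(2) e unfolding bs_def by simp
      qed
      fix ps ss assume "bs = ps @ ss"
      then have "(X + wd (as @ zs @ ps), Y + ht (as @ zs @ ps)) \<in> V"
        using pre[of "as @ zs @ ps" ss] es rs by simp
      from gd(3)[OF this]
      show "0 < - \<gamma> * real_of_int (X + wd as + wd zs - n + wd ps) + \<delta> *
           real_of_int (Y + ht as + ht zs + ht ps - 0 * (X + wd as + wd zs - n + wd ps))"
        by (simp add: algebra_simps)
    next
      show "Y + ht as + ht zs < 0 * (X + wd as + wd zs - n)" using low hz by simp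
      show "0 < X + wd as + wd zs - n + wd bs" using X(2) es rs by simp
      show "d = 0 \<or> d = 1 \<and> no_basis bs" by (rule dd(2))
    qed
    then show ?thesis using es rs by simp
  qed
  have "length zs \<le> 1" by (rule flat_le_1[OF tu(2)]) (use zs0 in \<open>simp add: det2_def\<close>)
  then have Z: "2 * int (length zs) \<le> wd zs + z"
  proof (cases zs)
    case (Cons e es')
    then have "es' = []" using \<open>length zs \<le> 1\<close> by simp
    then show ?thesis using Cons z(2)[of e] zs0[of e] es rs by simp
  qed (use z in simp)
  show ?thesis using A B Z es rs by simp
qed

text \<open>The extreme case consists of s, s - M, s - 2M and so on.\<close>

lemma spaced_sum_le:
  fixes T :: "int set" and M :: int
  assumes "finite T" "\<And>t. t \<in> T \<Longrightarrow> t \<le> s" "\<And>t u. t \<in> T \<Longrightarrow> u \<in> T \<Longrightarrow> M dvd t - u" "0 < M"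
  shows "2 * \<Sum>T \<le> 2 * s * int (card T) - M * int (card T) * (int (card T) - 1)"
  using assms
proof (induction "card T" arbitrary: T s)
  case (Suc k)
  define m where "m = Max T"
  have T: "m \<in> T" "\<And>t. t \<in> T \<Longrightarrow> t \<le> m" using Suc.hyps(2) Suc.prems(1) unfolding m_def by (auto intro!: Max_in)
  have c: "card (T - {m}) = k" using Suc.hyps(2) T Suc.prems(1) by simp
  have "2 * \<Sum>(T - {m}) \<le> 2 * (s - M) * int (card (T - {m})) - M * int (card (T - {m})) * (int (card (T - {m})) - 1)"
  proof (rule Suc.hyps(1))
    fix t assume t: "t \<in> T - {m}"
    then have "t < m" using T by force
    moreover have "M dvd m - t" using Suc.prems(3) T t by auto
    ultimately have "M \<le> m - t" by (intro zdvd_imp_le) auto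
    then show "t \<le> s - M" using Suc.prems(2)[OF T(1)] by linarith
  qed (use c Suc.prems in auto)
  moreover have "\<Sum>T = m + \<Sum>(T - {m})" using T Suc.prems(1) by (simp add: sum.remove)
  moreover have "m \<le> s" using T Suc.prems by blast
  moreover have "int (card T) = int k + 1" using Suc.hyps(2) by simp
  ultimately show ?case unfolding c by (simp add: algebra_simps)
qed simp

text \<open>An edge of width at least two pays for itself; the q edges of width one do not. Their
  heights are distinct and congruent modulo M, so the chain ends lower by about
  \<open>M * q * (q - 1) / 2\<close> than slope s would allow.\<close>

lemma unit_edges:
  fixes M s :: int
  assumes tu: "turning es" and sg: "\<And>e. e \<in> set es \<Longrightarrow> 0 < fst e \<and> snd e \<le> s * fst e" and M: "0 < M"
    and sp: "\<And>e f. e \<in> set es \<Longrightarrow> f \<in> set es \<Longrightarrow> fst e = 1 \<Longrightarrow> fst f = 1 \<Longrightarrow> M dvd snd e - snd f"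
  obtains q :: int where "0 \<le> q" "q \<le> wd es" "2 * int (length es) \<le> wd es + q"
    "2 * ht es \<le> 2 * s * wd es - M * q * (q - 1)" "0 < q \<Longrightarrow> \<exists>e\<in>set es. fst e = 1"
proof -
  define us where "us = filter (\<lambda>e. fst e = 1) es"
  define vs where "vs = filter (\<lambda>e. fst e \<noteq> 1) es"
  define T where "T = snd ` set us"
  define q where "q = int (length us)"
  have sums: "wd es = wd us + wd vs" "ht es = ht us + ht vs" "length es = length us + length vs"
    unfolding us_def vs_def by (induction es) auto
  have wu: "wd us = q" unfolding us_def q_def by (induction es) auto
  have ge2: "2 \<le> fst e" if "e \<in> set vs" for e
  proof -
    have "e \<in> set es" "fst e \<noteq> 1" using that unfolding vs_def by auto
    then show ?thesis using sg[of e] by linarith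
  qed
  have wv: "2 * int (length vs) \<le> wd vs" using ge2 by (induction vs) force+
  have hv: "ht vs \<le> s * wd vs"
  proof -
    have "snd e \<le> s * fst e" if "e \<in> set vs" for e using that sg unfolding vs_def by auto
    then show ?thesis by (induction vs) (auto simp: algebra_simps intro: add_mono)
  qed
  have dist: "distinct (map snd us)"
  proof -
    have "inj_on snd (set us)" unfolding us_def by (intro inj_onI) (auto simp: prod_eq_iff)
    moreover have "distinct us" using turning_distinct[OF tu] unfolding us_def by simp
    ultimately show ?thesis by (simp add: distinct_map)
  qed
  have "ht us = \<Sum>T" unfolding T_def ht_def using dist by (metis distinct_sum_list_conv_Sum set_map)
  moreover have "card T = length us" unfolding T_def using dist by (metis distinct_card length_map set_map)
  moreover have "2 * \<Sum>T \<le> 2 * s * int (card T) - M * int (card T) * (int (card T) - 1)"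
  proof (rule spaced_sum_le)
    show "t \<le> s" if "t \<in> T" for t using that sg unfolding T_def us_def by force
    show "M dvd t - u" if "t \<in> T" "u \<in> T" for t u using that sp unfolding T_def us_def by auto
  qed (use M T_def in auto)
  ultimately have hu: "2 * ht us \<le> 2 * s * q - M * q * (q - 1)" unfolding q_def by simp
  show thesis
  proof (rule that[of q])
    show "q \<le> wd es" using sums wu wv by linarith
    show "2 * int (length es) \<le> wd es + q" using sums wu wv q_def by linarith
    show "2 * ht es \<le> 2 * s * wd es - M * q * (q - 1)" using hu hv sums wu by (simp add: algebra_simps)
    show "\<exists>e\<in>set es. fst e = 1" if "0 < q"
      using that unfolding q_def us_def by (metis (mono_tags, lifting) filter_False length_0_conv of_nat_0 less_irrefl)
  qed (simp add: q_def)
qed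

text \<open>A chain that starts at the wall has only one corner. \<open>s\<close> is the largest integer slope for which
  the chain dips below the line of slope \<open>s\<close> through the corner, and \<open>q\<close> is the number of
  edges of width one and slope at most \<open>s\<close>; as these slopes differ by multiples of \<open>M\<close>, a large \<open>q\<close>
  forces the starting point far up, which pays for it.\<close>

lemma half_one_corner:
  fixes d n M :: int and \<alpha> \<beta> :: real
  assumes fin: "finite V" and ch: "lower_chain V X Y es" and X: "n < X + wd es" and v: "v \<in> V" "snd v < 0"
    and ab: "0 < \<alpha>" "0 < \<beta>" "\<And>v. v \<in> V \<Longrightarrow> 0 < \<alpha> * of_int (n - fst v) + \<beta> * of_int (snd v)"
    and d: "d = 0 \<or> d = 1 \<and> no_basis es" and M: "0 < M"
    and sp: "\<And>e f. e \<in> set es \<Longrightarrow> f \<in> set es \<Longrightarrow> fst e = 1 \<Longrightarrow> fst f = 1 \<Longrightarrow> M dvd snd e - snd f"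
  obtains s q :: int where "0 \<le> s" "0 \<le> q" "0 < q \<Longrightarrow> \<exists>e\<in>set es. fst e = 1"
    "2 * int (length es) + d \<le> (n - X) + q + (Y + ht es) - s * (X + wd es - n)"
    "M * q * (q - 1) + 2 * q - 2 * (s + 1) * (n - X) \<le> 2 * Y"
proof -
  note L = lower_chainD[OF ch]
  define dips where "dips s \<longleftrightarrow> (\<exists>v\<in>V. fst v < n \<and> snd v < s * (fst v - n))" for s :: int
  have left: "fst v < n" if "v \<in> V" "snd v \<le> 0" for v
  proof -
    have "\<beta> * of_int (snd v) \<le> 0" using that ab by (simp add: mult_nonneg_nonpos)
    then have "0 < \<alpha> * of_int (n - fst v)" using ab(3)[OF that(1)] by linarith
    then show ?thesis using ab by (simp add: zero_less_mult_iff)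
  qed
  \<comment> \<open>A slope that dips is at most the depth of some vertex, so a largest one
    exists.\<close>
  define b where "b = Max (insert 0 ((\<lambda>v. nat (- snd v)) ` V))"
  have bnd: "s \<le> b" if s: "dips (int s)" for s
  proof -
    obtain v where v: "v \<in> V" "fst v < n" "snd v < int s * (fst v - n)" using s unfolding dips_def by blast
    have "int s * (fst v - n) \<le> int s * (- 1)" using v by (intro mult_left_mono) auto
    then have "s \<le> nat (- snd v)" using v by linarith
    also have "\<dots> \<le> b" unfolding b_def using fin v by (intro Max_ge) auto
    finally show ?thesis .
  qed
  have "dips (int 0)" unfolding dips_def using v left[of v] by auto
  then have "\<exists>k. dips (int k) \<and> (\<forall>j. dips (int j) \<longrightarrow> j \<le> k)"
    using ex_has_greatest_nat[of "\<lambda>k. dips (int k)" 0 "\<lambda>k. k" "Suc b"] bnd le_imp_less_Suc by auto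
  then obtain k where k: "dips (int k)" "\<And>j. dips (int j) \<Longrightarrow> j \<le> k" by blast
  define s where "s = int k"
  have ns: "\<not> dips (s + 1)" using k(2)[of "k + 1"] unfolding s_def by (auto simp: add.commute)
  obtain v0 where v0: "v0 \<in> V" "fst v0 < n" "snd v0 < s * (fst v0 - n)" using k(1) unfolding dips_def s_def by blast
  \<comment> \<open>In coordinates sheared by s the first coefficient becomes \<alpha> - \<beta> s;
    the dipping vertex shows that it is still positive.\<close>
  have slope: "0 < \<alpha> - \<beta> * of_int s"
  proof -
    have "\<beta> * of_int (snd v0) < \<beta> * of_int (s * (fst v0 - n))" using v0(3) ab(2) by (simp only: mult_less_cancel_left_pos of_int_less_iff)
    then have "0 < \<alpha> * of_int (n - fst v0) + \<beta> * of_int (s * (fst v0 - n))" using ab(3)[OF v0(1)] by linarith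
    also have "\<dots> = (\<alpha> - \<beta> * of_int s) * of_int (n - fst v0)" by (simp add: algebra_simps)
    finally show ?thesis using v0 by (simp add: zero_less_mult_iff)
  qed
  define as where "as = filter (\<lambda>e. snd e \<le> s * fst e) es"
  define bs where "bs = filter (\<lambda>e. s * fst e < snd e) es"
  have es: "es = as @ bs" unfolding as_def bs_def by (rule slope_split_le[OF L(1,2)])
  have tu: "turning as" "turning bs" using L(1) es by (auto simp: turning_append)
  define x where "x = X + wd as - n"
  define y where "y = Y + ht as"
  have xyV: "(x + n, y) \<in> V" using L(4)[OF es] unfolding x_def y_def by simp
  have low: "y < s * x"
  proof -
    obtain ps ss where "es = ps @ ss" "Y + ht ps - s * (X + wd ps) \<le> snd v0 - s * fst v0"
      using L(11)[OF v0(1), of s] by blast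
    moreover from this have "ht as - s * wd as \<le> ht ps - s * wd ps"
      by (intro split_minimizes[OF es]) (auto simp: as_def bs_def)
    ultimately show ?thesis using v0 unfolding x_def y_def by (simp add: algebra_simps)
  qed
  have key: "(\<alpha> - \<beta> * of_int s) * of_int a < \<beta> * of_int (c - s * a)" if "(a + n, c) \<in> V" for a c
    using ab(3)[OF that] by (simp add: algebra_simps)
  have xneg: "x < 0"
  proof -
    have "real_of_int (y - s * x) < 0" using low by linarith
    then have "\<beta> * of_int (y - s * x) < 0" using ab(2) by (rule mult_pos_neg[rotated])
    then have "(\<alpha> - \<beta> * of_int s) * of_int x < 0" using key[OF xyV] by linarith
    then show ?thesis using slope by (simp add: mult_less_0_iff)
  qed
  \<comment> \<open>Here the maximality of s enters: slope s + 1 does not dip. This bounds the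
    vertex at the cut from below and, through \<open>unit_edges\<close>, the starting height
    Y.\<close>
  have yge: "(s + 1) * x \<le> y" using ns xyV xneg unfolding dips_def by force
  have "2 * int (length bs) + d \<le> - x + (y + ht bs - s * (x + wd bs))"
  proof (rule corner_right[OF tu(2) _ slope ab(2)])
    show "0 < fst e \<and> s * fst e < snd e" if "e \<in> set bs" for e using that L(2) unfolding bs_def by auto
    fix ps ss assume "bs = ps @ ss"
    then have "(X + wd (as @ ps), Y + ht (as @ ps)) \<in> V" using L(4)[of "as @ ps" ss] es by simp
    then have "(x + wd ps + n, y + ht ps) \<in> V" unfolding x_def y_def by (simp add: algebra_simps)
    from key[OF this] show "0 < - (\<alpha> - \<beta> * real_of_int s) * real_of_int (x + wd ps) +
           \<beta> * real_of_int (y + ht ps - s * (x + wd ps))" by (simp only: mult_minus_left)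
  qed (use low X es d no_basis_subset[of es bs] in \<open>auto simp: x_def\<close>)
  then have B: "2 * int (length bs) + d \<le> - x + (Y + ht es - s * (X + wd es - n))"
    unfolding es x_def y_def by (simp add: algebra_simps)
  have H: "0 < fst e \<and> snd e \<le> s * fst e" if "e \<in> set as" for e using that L(2) unfolding as_def by auto
  have spa: "M dvd snd e - snd f" if "e \<in> set as" "f \<in> set as" "fst e = 1" "fst f = 1" for e f
    using that sp unfolding as_def by auto
  obtain q where q: "0 \<le> q" "q \<le> wd as" "2 * int (length as) \<le> wd as + q"
    "2 * ht as \<le> 2 * s * wd as - M * q * (q - 1)" "0 < q \<Longrightarrow> \<exists>e\<in>set as. fst e = 1"
    using unit_edges[OF tu(1) H M spa] by blast
  show thesis
  proof (rule that[of s q])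
    show "0 \<le> s" by (simp add: s_def)
    show "2 * int (length es) + d \<le> (n - X) + q + (Y + ht es) - s * (X + wd es - n)"
      using B q(3) es unfolding x_def by simp
    have "2 * y - 2 * s * wd as + M * q * (q - 1) \<le> 2 * Y" using q(4) unfolding y_def by (simp add: algebra_simps)
    moreover have "2 * (s + 1) * x = 2 * s * wd as + 2 * wd as - 2 * (s + 1) * (n - X)"
      unfolding x_def by (simp add: algebra_simps)
    ultimately show "M * q * (q - 1) + 2 * q - 2 * (s + 1) * (n - X) \<le> 2 * Y"
      using yge q(2) by linarith
    show "\<exists>e\<in>set es. fst e = 1" if "0 < q" using q(5)[OF that] es by auto
  qed (rule q)
qed

section \<open>Squares, half-strips and strips\<close>

text \<open>All that is needed of a lattice with invariant factors \<open>(1, m)\<close>.\<close>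

definition sublattice :: "int \<Rightarrow> (int \<times> int) set \<Rightarrow> bool" where
  "sublattice m \<Lambda> \<longleftrightarrow> (\<forall>e\<in>\<Lambda>. \<forall>f\<in>\<Lambda>. e - f \<in> \<Lambda> \<and> m dvd det2 e f) \<and> (\<forall>p q. (m * p, m * q) \<in> \<Lambda>)"

text \<open>Quantified over all lattices, so that the statement can be transported by unimodular
  maps.\<close>

definition vertex_bounds :: "int \<Rightarrow> (int \<times> int) set \<Rightarrow> bool" where
  "vertex_bounds n V \<longleftrightarrow> int (card V) \<le> 2 * n + 2 \<and>
     (\<forall>m \<Lambda>. sublattice m \<Lambda> \<longrightarrow> V \<subseteq> \<Lambda> \<longrightarrow>
        (n = 2 * m \<longrightarrow> int (card V) \<le> 2 * n) \<and> (n = m \<longrightarrow> int (card V) \<le> 2 * n - 2))"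

text \<open>Freeness is stored as a separating functional at every point of
  \<open>n\<int>\<^sup>2\<close>, which speaks of the vertices alone and not of their hull.\<close>

definition free_config :: "int \<Rightarrow> (int \<times> int) set \<Rightarrow> bool" where
  "free_config n V \<longleftrightarrow> finite V \<and> convex_position V \<and>
     (\<forall>p q. \<exists>\<alpha> \<beta>::real. \<forall>v\<in>V. 0 < \<alpha> * of_int (fst v - n * p) + \<beta> * of_int (snd v - n * q))"

lemma sublatticeD:
  assumes "sublattice m \<Lambda>"
  shows "e \<in> \<Lambda> \<Longrightarrow> f \<in> \<Lambda> \<Longrightarrow> e - f \<in> \<Lambda>" "e \<in> \<Lambda> \<Longrightarrow> f \<in> \<Lambda> \<Longrightarrow> m dvd det2 e f"
    "(m * p, m * q) \<in> \<Lambda>" "e \<in> \<Lambda> \<Longrightarrow> - e \<in> \<Lambda>"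
proof -
  have z: "0 \<in> \<Lambda>" using assms unfolding sublattice_def by (metis mult_zero_right zero_prod_def)
  show "e \<in> \<Lambda> \<Longrightarrow> - e \<in> \<Lambda>" using z assms unfolding sublattice_def by (metis diff_0)
qed (use assms in \<open>auto simp: sublattice_def\<close>)

lemma chain_edges_lattice:
  assumes "lower_chain V X Y es" "sublattice m \<Lambda>" "V \<subseteq> \<Lambda>" "e \<in> set es"
  shows "e \<in> \<Lambda>"
proof -
  obtain ps ss where es: "es = ps @ e # ss" using assms(4) by (meson split_list)
  have "(X + wd ps, Y + ht ps) \<in> \<Lambda>" "(X + wd (ps @ [e]), Y + ht (ps @ [e])) \<in> \<Lambda>"
    using lower_chainD(4)[OF assms(1), of ps "e # ss"] lower_chainD(4)[OF assms(1), of "ps @ [e]" ss] es assms(3)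
    by auto
  from sublatticeD(1)[OF assms(2) this(2) this(1)] show ?thesis by (cases e) simp
qed

lemma mirror_sublattice:
  assumes "sublattice m \<Lambda>" "m dvd c"
  shows "sublattice m (refl_y c ` \<Lambda>)"
  unfolding sublattice_def
proof (intro conjI ballI allI)
  obtain c' where c: "c = m * c'" using assms(2) by blast
  have cL: "(0, c) \<in> \<Lambda>" using sublatticeD(3)[OF assms(1), of 0 c'] c by simp
  fix e f assume "e \<in> refl_y c ` \<Lambda>" "f \<in> refl_y c ` \<Lambda>"
  then obtain e' f' where ef: "e = refl_y c e'" "f = refl_y c f'" "e' \<in> \<Lambda>" "f' \<in> \<Lambda>" by auto
  have "e - f = refl_y c ((e' - f') - - (0, c))" unfolding ef by (simp add: prod_eq_iff)
  moreover have "(e' - f') - - (0, c) \<in> \<Lambda>"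
    using ef cL sublatticeD(1,4)[OF assms(1)] by blast
  ultimately show "e - f \<in> refl_y c ` \<Lambda>" by blast
  have "det2 e f = c * (fst e' - fst f') - det2 e' f'" unfolding ef by (simp add: det2_def algebra_simps)
  then show "m dvd det2 e f" using sublatticeD(2)[OF assms(1) ef(3,4)] c by (simp add: dvd_diff)
next
  fix p q
  obtain c' where c: "c = m * c'" using assms(2) by blast
  have "(m * p, m * q) = refl_y c (m * p, m * (c' - q))" by (simp add: c algebra_simps)
  then show "(m * p, m * q) \<in> refl_y c ` \<Lambda>" using sublatticeD(3)[OF assms(1)] by blast
qed

lemma lattice_no_basis:
  assumes "sublattice m \<Lambda>" "set es \<subseteq> \<Lambda>" "1 < m"
  shows "no_basis es"
  unfolding no_basis_def
proof (intro ballI)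
  fix e f assume "e \<in> set es" "f \<in> set es"
  then have "m dvd det2 e f" using sublatticeD(2)[OF assms(1)] assms(2) by blast
  then show "\<bar>det2 e f\<bar> \<noteq> 1" using assms(3) using zdvd_imp_le[of m 1] by (auto simp: abs_if dvd_minus_iff split: if_splits)
qed

lemma pos_combination:
  fixes \<alpha> \<beta> :: real
  assumes "0 < \<alpha>" "0 < \<beta>" "0 < \<alpha> * of_int a + \<beta> * of_int b"
  shows "b \<le> 0 \<Longrightarrow> 0 < a" "a \<le> 0 \<Longrightarrow> 0 < b"
proof -
  show "0 < a" if "b \<le> 0"
  proof -
    have "\<beta> * of_int b \<le> 0" using that assms by (simp add: mult_nonneg_nonpos)
    then have "0 < \<alpha> * of_int a" using assms by linarith
    then show ?thesis using assms by (simp add: zero_less_mult_iff)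
  qed
  show "0 < b" if "a \<le> 0"
  proof -
    have "\<alpha> * of_int a \<le> 0" using that assms by (simp add: mult_nonneg_nonpos)
    then have "0 < \<beta> * of_int b" using assms by linarith
    then show ?thesis using assms by (simp add: zero_less_mult_iff)
  qed
qed

lemma type_II_bounds:
  fixes n :: int
  assumes n: "3 \<le> n" and V: "free_config n V"
    and c1: "\<exists>\<alpha> \<beta>::real. 0 < \<alpha> \<and> 0 < \<beta> \<and> (\<forall>v\<in>V. 0 < \<alpha> * of_int (fst v) + \<beta> * of_int (snd v))"
    and c2: "\<exists>\<alpha> \<beta>::real. 0 < \<alpha> \<and> 0 < \<beta> \<and> (\<forall>v\<in>V. 0 < \<alpha> * of_int (n - fst v) + \<beta> * of_int (snd v))"
    and c3: "\<exists>\<alpha> \<beta>::real. 0 < \<alpha> \<and> 0 < \<beta> \<and> (\<forall>v\<in>V. 0 < \<alpha> * of_int (fst v) + \<beta> * of_int (n - snd v))"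
    and c4: "\<exists>\<alpha> \<beta>::real. 0 < \<alpha> \<and> 0 < \<beta> \<and> (\<forall>v\<in>V. 0 < \<alpha> * of_int (n - fst v) + \<beta> * of_int (n - snd v))"
    and le: "\<exists>v\<in>V. fst v < 0" and ri: "\<exists>v\<in>V. n < fst v" and dn: "\<exists>v\<in>V. snd v < 0" and up: "\<exists>v\<in>V. n < snd v"
  shows "vertex_bounds n V"
proof -
  have fin: "finite V" and conv: "convex_position V" using V unfolding free_config_def by auto
  obtain v0 v1 where v01: "v0 \<in> V" "fst v0 < 0" "v1 \<in> V" "n < fst v1" using le ri by blast
  then have "fst v0 < fst v1" using n by simp
  then obtain X Y es Z fs where ch: "lower_chain V X Y es" "lower_chain (refl_y n ` V) X Z fs"
    and wdf: "wd fs = wd es" and YZ: "Y + Z \<le> n" "Y + ht es + (Z + ht fs) \<le> n"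
    and card: "int (card V) \<le> int (length es) + int (length fs) +
       (if Y + Z = n then 0 else 1) + (if Y + ht es + (Z + ht fs) = n then 0 else 1)"
    using hull_chains[OF fin conv v01(1,3), of n] by metis
  note L = lower_chainD[OF ch(1)] and U = lower_chainD[OF ch(2)]
  have X: "X < 0" "n < X + wd es" using L(7)[OF v01(1)] L(8)[OF v01(3)] v01 by linarith+
  obtain vd vu where vd: "vd \<in> V" "snd vd < 0" and vu: "vu \<in> V" "n < snd vu" using dn up by blast
  have E: "2 * int (length es) + 2 * d \<le> n + Y + (Y + ht es) + z"
    if "d = 0 \<or> d = 1 \<and> no_basis es" "0 \<le> z" "\<And>e. e \<in> set es \<Longrightarrow> snd e = 0 \<Longrightarrow> 2 - fst e \<le> z" for d z
  proof -
    obtain \<alpha> \<beta> \<gamma> \<delta> :: real where ab: "0 < \<alpha>" "0 < \<beta>" "0 < \<gamma>" "0 < \<delta>"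
      "\<And>v. v \<in> V \<Longrightarrow> 0 < \<alpha> * of_int (fst v) + \<beta> * of_int (snd v)"
      "\<And>v. v \<in> V \<Longrightarrow> 0 < \<gamma> * of_int (n - fst v) + \<delta> * of_int (snd v)"
      using c1 c2 by blast
    show ?thesis by (rule half_two_corners[OF ch(1) X vd ab(1,2,5) ab(3,4,6) that])
  qed
  have F: "2 * int (length fs) + 2 * d \<le> n + Z + (Z + ht fs) + z"
    if h: "d = 0 \<or> d = 1 \<and> no_basis fs" "0 \<le> z" "\<And>e. e \<in> set fs \<Longrightarrow> snd e = 0 \<Longrightarrow> 2 - fst e \<le> z" for d z
  proof -
    obtain \<alpha> \<beta> \<gamma> \<delta> :: real where ab: "0 < \<alpha>" "0 < \<beta>" "0 < \<gamma>" "0 < \<delta>"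
      "\<And>v. v \<in> refl_y n ` V \<Longrightarrow> 0 < \<alpha> * of_int (fst v) + \<beta> * of_int (snd v)"
      "\<And>v. v \<in> refl_y n ` V \<Longrightarrow> 0 < \<gamma> * of_int (n - fst v) + \<delta> * of_int (snd v)"
    proof -
      obtain \<alpha> \<beta> \<gamma> \<delta> :: real where "0 < \<alpha>" "0 < \<beta>" "0 < \<gamma>" "0 < \<delta>"
        "\<forall>v\<in>V. 0 < \<alpha> * of_int (fst v) + \<beta> * of_int (n - snd v)"
        "\<forall>v\<in>V. 0 < \<gamma> * of_int (n - fst v) + \<delta> * of_int (n - snd v)"
        using c3 c4 by blast
      then show thesis by (intro that[of \<alpha> \<beta> \<gamma> \<delta>]) auto
    qed
    have r: "refl_y n vu \<in> refl_y n ` V" "snd (refl_y n vu) < 0" "n < X + wd fs" using vu X wdf by auto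
    show ?thesis by (rule half_two_corners[OF ch(2) X(1) r(3,1,2) ab(1,2,5) ab(3,4,6) h])
  qed
  have one: "2 - fst e \<le> 1" if "e \<in> set es \<or> e \<in> set fs" for e using that L(2)[of e] U(2)[of e] by auto
  show ?thesis unfolding vertex_bounds_def
  proof (intro conjI allI impI)
    show "int (card V) \<le> 2 * n + 2"
      using E[of 0 1] F[of 0 1] one card YZ by (auto split: if_splits)
  next
    fix m \<Lambda> assume lat: "sublattice m \<Lambda>" "V \<subseteq> \<Lambda>"
    have mirr: "sublattice m (refl_y n ` \<Lambda>)" if "m dvd n" by (rule mirror_sublattice[OF lat(1) that])
    have nb: "no_basis es \<and> no_basis fs" if "1 < m" "m dvd n"
    proof
      show "no_basis es" by (rule lattice_no_basis[OF lat(1) _ that(1)]) (use chain_edges_lattice[OF ch(1) lat] in blast)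
      show "no_basis fs"
        by (rule lattice_no_basis[OF mirr[OF that(2)] _ that(1)])
          (use chain_edges_lattice[OF ch(2) mirr[OF that(2)]] lat(2) in blast)
    qed
    show "int (card V) \<le> 2 * n" if "n = 2 * m"
    proof -
      have "no_basis es \<and> no_basis fs" by (rule nb) (use that n in auto)
      then show ?thesis using E[of 1 1] F[of 1 1] one card YZ by (auto split: if_splits)
    qed
    show "int (card V) \<le> 2 * n - 2" if nm: "n = m"
    proof -
      have m: "1 < m" "m dvd n" using nm n by auto
      \<comment> \<open>A vertex to the left of the square has height strictly between 0 and n.
        Hence (1,0) is not in the lattice, and (0,1) is excluded by \<open>vd\<close> in the same
        way: no flat side has length one.\<close>
      have noh: "\<not> n dvd snd v0"
      proof -
        have "0 < snd v0" using c1 v01(1,2) pos_combination(2) by (metis less_imp_le)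
        moreover have "0 < n - snd v0" using c3 v01(1,2) pos_combination(2) by (metis less_imp_le)
        ultimately show ?thesis using zdvd_not_zless by simp
      qed
      have nov: "\<not> n dvd fst vd"
      proof -
        have "0 < fst vd" using c1 vd pos_combination(1) by (metis less_imp_le)
        moreover have "0 < n - fst vd" using c2 vd pos_combination(1) by (metis less_imp_le)
        ultimately show ?thesis using zdvd_not_zless by simp
      qed
      have zh: "2 - fst e \<le> 0" if "e \<in> set es \<and> snd e = 0 \<or> e \<in> set fs \<and> snd e = 0" for e
      proof (rule ccontr)
        assume "\<not> 2 - fst e \<le> 0"
        then have e1: "fst e = 1" "snd e = 0" using that L(2)[of e] U(2)[of e] by auto
        show False
        proof (cases "e \<in> set es")
          case True
          then have "e \<in> \<Lambda>" using chain_edges_lattice[OF ch(1) lat] by blast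
          then have "m dvd det2 e v0" using sublatticeD(2)[OF lat(1)] lat(2) v01 by blast
          then show False using noh e1 nm by (simp add: det2_def)
        next
          case False
          then have "e \<in> refl_y n ` \<Lambda>" using that chain_edges_lattice[OF ch(2) mirr[OF m(2)]] lat(2) by blast
          then have "m dvd det2 e (refl_y n v0)" using sublatticeD(2)[OF mirr[OF m(2)]] lat(2) v01 by blast
          then have "m dvd n - snd v0" using e1 by (simp add: det2_def)
          then show False using noh nm dvd_diff[of n n "n - snd v0"] by simp
        qed
      qed
      have flat: "y' - y \<noteq> 1" if "(x, y) \<in> V" "(x, y') \<in> V" for x y y'
      proof
        assume "y' - y = 1"
        then have "(0, 1) \<in> \<Lambda>" using sublatticeD(1)[OF lat(1), of "(x, y')" "(x, y)"] that lat(2) by auto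
        then have "m dvd det2 (0, 1) vd" using sublatticeD(2)[OF lat(1)] lat(2) vd by blast
        then show False using nov nm by (simp add: det2_def)
      qed
      have mem: "(x, n - z) \<in> V" if "(x, z) \<in> refl_y n ` V" for x z using that by (auto simp: refl_y_def)
      have "n - Z - Y \<noteq> 1" "n - (Z + ht fs) - (Y + ht es) \<noteq> 1"
        using flat[OF L(5) mem[OF U(5)]] flat[OF L(6) mem[OF U(6), unfolded wdf]] by auto
      moreover have "no_basis es \<and> no_basis fs" by (rule nb) (use m in auto)
      ultimately show ?thesis using E[of 1 0] F[of 1 0] zh card YZ by (auto split: if_splits)
    qed
  qed
qed

lemma sum_squares_int: "(a + b) * (a + b) \<le> 2 * (a * a + b * (b::int))"
proof -
  have "0 \<le> (a - b) * (a - b)" by simp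
  then show ?thesis by (simp add: algebra_simps)
qed

text \<open>Here w is the distance from the left end to x = n, k the sum of the slopes that
  \<open>half_one_corner\<close> finds for the two chains, S and S' are the sums of their heights at
  the left and right ends, tl and tr count the vertical sides. For N > 2n + 2 the linear estimate
  yields q + r \<ge> n + 3 + k, which the quadratic one excludes with margin (n - k - 2)^2 + 4k +
  11.\<close>

lemma III_arith_general:
  fixes n N k w q r S S' c tl tr :: int
  assumes "0 \<le> k" "w \<le> n" "k \<le> c"
    "2 * N \<le> 2 * w + q + r + S' - c + 2 * (tl + tr)" "S' \<le> n - tr" "S \<le> n" "tl \<le> 1" "tr \<le> 1" "0 \<le> n"
    "q * (q - 1) + 2 * q + (r * (r - 1) + 2 * r) - 2 * (k + 2) * w \<le> 2 * S"
  shows "N \<le> 2 * n + 2"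
proof (rule ccontr)
  assume "\<not> N \<le> 2 * n + 2"
  then have Q: "n + 3 + k \<le> q + r" using assms(2-5,7,8) by (smt (verit))
  have "(k + 2) * w \<le> (k + 2) * n" using assms by (intro mult_left_mono) auto
  then have "q * q + r * r + (q + r) \<le> 2 * n + 2 * ((k + 2) * n)" using assms(6,10) by (simp add: algebra_simps)
  then have "(q + r) * (q + r) + 2 * (q + r) \<le> 4 * n + 4 * ((k + 2) * n)"
    using sum_squares_int[of q r] by (smt (verit))
  moreover have "(n + 3 + k) * (n + 5 + k) \<le> (q + r) * (q + r + 2)"
    using Q assms by (intro mult_mono) auto
  moreover have "(q + r) * (q + r + 2) = (q + r) * (q + r) + 2 * (q + r)" by (simp add: algebra_simps)
  moreover have "(n + 3 + k) * (n + 5 + k) - (4 * n + 4 * ((k + 2) * n)) = (n - k - 2) * (n - k - 2) + 4 * k + 11"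
    by (simp add: algebra_simps)
  moreover have "0 \<le> (n - k - 2) * (n - k - 2)" by simp
  ultimately show False using assms(1) by (smt (verit))
qed

text \<open>The same scheme with spacing 2. The margin is n (n - 4) + (k + 1)^2.\<close>

lemma III_arith_half:
  fixes n N k w q r S S' c tl tr :: int
  assumes "0 \<le> k" "w \<le> n" "k \<le> c"
    "2 * N + 2 \<le> 2 * w + q + r + S' - c + 2 * (tl + tr)" "S' \<le> n - tr" "S \<le> n" "tl \<le> 1" "tr \<le> 1" "4 \<le> n"
    "2 * q * (q - 1) + 2 * q + (2 * r * (r - 1) + 2 * r) - 2 * (k + 2) * w \<le> 2 * S"
  shows "N \<le> 2 * n"
proof (rule ccontr)
  assume "\<not> N \<le> 2 * n"
  then have Q: "n + 1 + k \<le> q + r" using assms(2-5,7,8) by (smt (verit))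
  have "(k + 2) * w \<le> (k + 2) * n" using assms by (intro mult_left_mono) auto
  then have "q * q + r * r \<le> n + (k + 2) * n" using assms(6,10) by (simp add: algebra_simps)
  then have "(q + r) * (q + r) \<le> 2 * n + 2 * ((k + 2) * n)"
    using sum_squares_int[of q r] by (smt (verit))
  moreover have "(n + 1 + k) * (n + 1 + k) \<le> (q + r) * (q + r)"
    using Q assms by (intro mult_mono) auto
  moreover have "(n + 1 + k) * (n + 1 + k) - (2 * n + 2 * ((k + 2) * n)) = n * (n - 4) + k * k + 2 * k + 1"
    by (simp add: algebra_simps)
  moreover have "0 \<le> n * (n - 4)" "0 \<le> k * k" using assms by simp_all
  ultimately show False using assms(1) by (smt (verit))
qed

text \<open>The same scheme with spacing n. A vertical side on the left has length at least n,
  whence the alternative S \<le> 0, and w \<le> n - 1 because the chain does not start on the wall.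
  With this side, n = 3 is separate since only Q \<ge> 3 + k is known.\<close>

lemma III_arith_full:
  fixes n N k w q r S S' c tl :: int
  assumes "0 \<le> k" "w \<le> n - 1" "k \<le> c" "3 \<le> n"
    "2 * N + 2 \<le> 2 * w + q + r + S' - c + 2 * tl" "S' \<le> n" "tl = 0 \<and> S \<le> n \<or> tl = 1 \<and> S \<le> 0"
    "n * q * (q - 1) + 2 * q + (n * r * (r - 1) + 2 * r) - 2 * (k + 2) * w \<le> 2 * S"
  shows "N \<le> 2 * n - 2"
proof (rule ccontr)
  assume "\<not> N \<le> 2 * n - 2"
  then have Q: "n + 2 + k - 2 * tl \<le> q + r" using assms(2,3,5,6) by linarith
  define Q where "Q = q + r"
  have "(k + 2) * w \<le> (k + 2) * (n - 1)" using assms by (intro mult_left_mono) auto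
  then have "n * (q * q + r * r) - n * Q + 2 * Q \<le> 2 * S + 2 * ((k + 2) * (n - 1))"
    using assms(8) unfolding Q_def by (simp add: algebra_simps)
  moreover have "n * (Q * Q) \<le> n * (2 * (q * q + r * r))"
    unfolding Q_def using assms by (intro mult_left_mono sum_squares_int) auto
  ultimately have main: "n * (Q * (Q - 2)) + 4 * Q \<le> 4 * S + 4 * ((k + 2) * (n - 1))"
    by (simp add: algebra_simps)
  show False
  proof (cases "tl = 0")
    case True
    then have "5 + k \<le> Q" using Q assms(4) unfolding Q_def by linarith
    then have "(5 + k) * (3 + k) \<le> Q * (Q - 2)" using assms by (intro mult_mono) auto
    then have "n * ((5 + k) * (3 + k)) \<le> n * (Q * (Q - 2))" using assms by (intro mult_left_mono) auto
    moreover have "n * ((5 + k) * (3 + k)) - (4 * n + 4 * ((k + 2) * (n - 1))) = n * (k * k) + 4 * (n * k) + 3 * n + 4 * (k + 2)"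
      by (simp add: algebra_simps)
    moreover have "0 \<le> n * (k * k)" "0 \<le> n * k" using assms by simp_all
    moreover have "S \<le> n" using assms(7) True by simp
    ultimately show False using main \<open>5 + k \<le> Q\<close> assms(1,4) by (smt (verit))
  next
    case False
    then have tl: "S \<le> 0" "n + k \<le> Q" using Q assms(7) unfolding Q_def by auto
    show False
    proof (cases "n = 3")
      case True
      then have "(3 + k) * (1 + k) \<le> Q * (Q - 2)" using assms tl by (intro mult_mono) auto
      moreover have "(3 + k) * (1 + k) = k * k + 4 * k + 3" by (simp add: algebra_simps)
      moreover have "0 \<le> k * k" by simp
      moreover have "3 * (Q * (Q - 2)) + 4 * Q \<le> 8 * (k + 2)" using main tl True by simp
      ultimately show False using tl(2) assms(1) True by (smt (verit))
    next
      case False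
      then have "4 + k \<le> Q" using tl assms(4) by linarith
      then have "4 * (2 + k) \<le> Q * (Q - 2)" using assms by (intro mult_mono) auto
      then have "n * (4 * (2 + k)) \<le> n * (Q * (Q - 2))" using assms by (intro mult_left_mono) auto
      moreover have "n * (4 * (2 + k)) - 4 * ((k + 2) * (n - 1)) = 4 * (k + 2)" by (simp add: algebra_simps)
      ultimately show False using main \<open>4 + k \<le> Q\<close> assms(1) tl by (smt (verit))
    qed
  qed
qed

lemma unit_edges_spaced:
  assumes "sublattice m \<Lambda>" "set es \<subseteq> \<Lambda>" "e \<in> set es" "f \<in> set es" "fst e = 1" "fst f = 1"
  shows "m dvd snd e - snd f"
proof -
  have "m dvd det2 f e" using assms sublatticeD(2)[OF assms(1)] by blast
  then show ?thesis using assms by (simp add: det2_def)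
qed

lemma refl_y_mem: "(x, y) \<in> refl_y c ` V \<Longrightarrow> (x, c - y) \<in> V"
  by (auto simp: refl_y_def)

lemma type_III_bounds:
  fixes n :: int
  assumes n: "3 \<le> n" and V: "free_config n V"
    and c2: "\<exists>\<alpha> \<beta>::real. 0 < \<alpha> \<and> 0 < \<beta> \<and> (\<forall>v\<in>V. 0 < \<alpha> * of_int (n - fst v) + \<beta> * of_int (snd v))"
    and c4: "\<exists>\<alpha> \<beta>::real. 0 < \<alpha> \<and> 0 < \<beta> \<and> (\<forall>v\<in>V. 0 < \<alpha> * of_int (n - fst v) + \<beta> * of_int (n - snd v))"
    and le: "\<forall>v\<in>V. 0 \<le> fst v" and ri: "\<exists>v\<in>V. n < fst v" and dn: "\<exists>v\<in>V. snd v < 0" and up: "\<exists>v\<in>V. n < snd v"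
  shows "vertex_bounds n V"
proof -
  have fin: "finite V" and conv: "convex_position V"
    and free: "\<And>p q. \<exists>\<alpha> \<beta>::real. \<forall>v\<in>V. 0 < \<alpha> * of_int (fst v - n * p) + \<beta> * of_int (snd v - n * q)"
    using V unfolding free_config_def by auto
  obtain \<alpha> \<beta> \<gamma> \<delta> :: real where ab: "0 < \<alpha>" "0 < \<beta>" "0 < \<gamma>" "0 < \<delta>"
      "\<And>v. v \<in> V \<Longrightarrow> 0 < \<alpha> * of_int (n - fst v) + \<beta> * of_int (snd v)"
      "\<And>v. v \<in> V \<Longrightarrow> 0 < \<gamma> * of_int (n - fst v) + \<delta> * of_int (n - snd v)"
    using c2 c4 by blast
  obtain vd vu vr where vd: "vd \<in> V" "snd vd < 0" and vu: "vu \<in> V" "n < snd vu"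
    and vr: "vr \<in> V" "n < fst vr" using dn up ri by blast
  have vdx: "fst vd < n" using pos_combination(1)[OF ab(1,2) ab(5)[OF vd(1)]] vd by simp
  have vux: "fst vu < n" using pos_combination(1)[OF ab(3,4) ab(6)[OF vu(1)]] vu by simp
  have "fst vd < fst vr" using vdx vr by simp
  then obtain X Y es Z fs where ch: "lower_chain V X Y es" "lower_chain (refl_y n ` V) X Z fs"
    and wdf: "wd fs = wd es" and YZ: "Y + Z \<le> n" "Y + ht es + (Z + ht fs) \<le> n"
    and card: "int (card V) \<le> int (length es) + int (length fs) +
       (if Y + Z = n then 0 else 1) + (if Y + ht es + (Z + ht fs) = n then 0 else 1)"
    using hull_chains[OF fin conv vd(1) vr(1), of n] by metis
  note L = lower_chainD[OF ch(1)] and U = lower_chainD[OF ch(2)]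
  define tl :: int where "tl = (if Y + Z = n then 0 else 1)"
  define tr :: int where "tr = (if Y + ht es + (Z + ht fs) = n then 0 else 1)"
  have tlr: "0 \<le> tl" "tl \<le> 1" "0 \<le> tr" "tr \<le> 1" "Y + Z \<le> n - tl" "Y + ht es + (Z + ht fs) \<le> n - tr"
    and card': "int (card V) \<le> int (length es) + int (length fs) + (tl + tr)"
    using card YZ unfolding tl_def tr_def by (auto split: if_splits)
  have X: "0 \<le> X" "X < n" "n < X + wd es"
    using L(5) le L(7)[OF vd(1)] vdx L(8)[OF vr(1)] vr by force+
  have right: "0 < Y + ht es" "0 < Z + ht fs"
  proof -
    show "0 < Y + ht es" using pos_combination(2)[OF ab(1,2) ab(5)[OF L(6)]] X by simp
    obtain v where "v \<in> V" "(X + wd fs, Z + ht fs) = refl_y n v" using U(6) by blast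
    then have "v \<in> V" "fst v = X + wd es" "n - snd v = Z + ht fs" using wdf by (auto simp: refl_y_def)
    then show "0 < Z + ht fs" using pos_combination(2)[OF ab(3,4) ab(6)[of v]] X by simp
  qed
  have ru: "refl_y n vu \<in> refl_y n ` V" "snd (refl_y n vu) < 0" "n < X + wd fs" using vu X wdf by auto
  have abu: "0 < \<gamma> * of_int (n - fst v) + \<delta> * of_int (snd v)" if "v \<in> refl_y n ` V" for v using that ab(6) by auto
  \<comment> \<open>k adds up the slopes found for the two chains. M is the spacing of the heights
    of edges of width one: 1 in general, m in a lattice.\<close>
  have halves: "\<exists>q r k. 0 \<le> k \<and> 0 \<le> q \<and> 0 \<le> r \<and>
      2 * int (card V) + 2 * d \<le> 2 * (n - X) + q + r + (Y + ht es + (Z + ht fs)) - k * (X + wd es - n) + 2 * (tl + tr) \<and>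
      M * q * (q - 1) + 2 * q + (M * r * (r - 1) + 2 * r) - 2 * (k + 2) * (n - X) \<le> 2 * (Y + Z) \<and>
      (0 < q + r \<longrightarrow> (\<exists>e\<in>set es \<union> set fs. fst e = 1))"
    if d: "d = 0 \<or> d = 1 \<and> no_basis es \<and> no_basis fs" and M: "0 < M"
      and sp: "\<And>e f. e \<in> set es \<Longrightarrow> f \<in> set es \<Longrightarrow> fst e = 1 \<Longrightarrow> fst f = 1 \<Longrightarrow> M dvd snd e - snd f"
        "\<And>e f. e \<in> set fs \<Longrightarrow> f \<in> set fs \<Longrightarrow> fst e = 1 \<Longrightarrow> fst f = 1 \<Longrightarrow> M dvd snd e - snd f" for d M
  proof -
    have d': "d = 0 \<or> d = 1 \<and> no_basis es" "d = 0 \<or> d = 1 \<and> no_basis fs" using d by auto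
    obtain s q where q: "0 \<le> s" "0 \<le> q" "0 < q \<Longrightarrow> \<exists>e\<in>set es. fst e = 1"
      "2 * int (length es) + d \<le> (n - X) + q + (Y + ht es) - s * (X + wd es - n)"
      "M * q * (q - 1) + 2 * q - 2 * (s + 1) * (n - X) \<le> 2 * Y"
      using half_one_corner[OF fin ch(1) X(3) vd ab(1,2,5) d'(1) M sp(1)] by blast
    obtain s' r where r: "0 \<le> s'" "0 \<le> r" "0 < r \<Longrightarrow> \<exists>e\<in>set fs. fst e = 1"
      "2 * int (length fs) + d \<le> (n - X) + r + (Z + ht fs) - s' * (X + wd fs - n)"
      "M * r * (r - 1) + 2 * r - 2 * (s' + 1) * (n - X) \<le> 2 * Z"
      using half_one_corner[OF finite_imageI[OF fin] ch(2) ru(3,1,2) ab(3,4) abu d'(2) M sp(2)] by blast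
    show ?thesis
    proof (rule exI[of _ q], rule exI[of _ r], rule exI[of _ "s + s'"], intro conjI impI)
      show "2 * int (card V) + 2 * d \<le> 2 * (n - X) + q + r + (Y + ht es + (Z + ht fs)) - (s + s') * (X + wd es - n) + 2 * (tl + tr)"
        using q(4) r(4) card' unfolding wdf by (simp add: algebra_simps)
      show "M * q * (q - 1) + 2 * q + (M * r * (r - 1) + 2 * r) - 2 * (s + s' + 2) * (n - X) \<le> 2 * (Y + Z)"
        using q(5) r(5) by (simp add: algebra_simps)
      show "\<exists>e\<in>set es \<union> set fs. fst e = 1" if "0 < q + r"
        using that q(2,3) r(2,3) by (cases "0 < q") auto
    qed (use q r in auto)
  qed
  have kle: "k \<le> k * (X + wd es - n)" if "0 \<le> k" for k
    using mult_left_mono[of 1 "X + wd es - n" k] that X by simp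
  show ?thesis unfolding vertex_bounds_def
  proof (intro conjI allI impI)
    obtain q r k where q: "0 \<le> k"
      "2 * int (card V) + 2 * 0 \<le> 2 * (n - X) + q + r + (Y + ht es + (Z + ht fs)) - k * (X + wd es - n) + 2 * (tl + tr)"
      "1 * q * (q - 1) + 2 * q + (1 * r * (r - 1) + 2 * r) - 2 * (k + 2) * (n - X) \<le> 2 * (Y + Z)"
      using halves[of 0 1] by auto
    show "int (card V) \<le> 2 * n + 2"
      by (rule III_arith_general[OF q(1) _ kle[OF q(1)] _ tlr(6), of "n - X" "int (card V)" q r tl "Y + Z"])
        (use q X tlr n in auto)
  next
    fix m \<Lambda> assume lat: "sublattice m \<Lambda>" "V \<subseteq> \<Lambda>"
    have mirr: "sublattice m (refl_y n ` \<Lambda>)" if "m dvd n" by (rule mirror_sublattice[OF lat(1) that])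
    have esL: "set es \<subseteq> \<Lambda>" using chain_edges_lattice[OF ch(1) lat] by blast
    have fsL: "set fs \<subseteq> refl_y n ` \<Lambda>" if "m dvd n"
      using chain_edges_lattice[OF ch(2) mirr[OF that]] lat(2) by blast
    show "int (card V) \<le> 2 * n" if nm: "n = 2 * m"
    proof -
      have m: "2 \<le> m" "m dvd n" using nm n by auto
      have sp: "2 dvd snd e - snd f" if "m dvd snd e - snd f" "even m" for e f :: "int \<times> int"
        using that by (meson dvd_trans)
      obtain q r k where q: "0 \<le> k" "0 \<le> q" "0 \<le> r"
        "2 * int (card V) + 2 * 1 \<le> 2 * (n - X) + q + r + (Y + ht es + (Z + ht fs)) - k * (X + wd es - n) + 2 * (tl + tr)"
        "m * q * (q - 1) + 2 * q + (m * r * (r - 1) + 2 * r) - 2 * (k + 2) * (n - X) \<le> 2 * (Y + Z)"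
        using halves[of 1 m] lattice_no_basis[OF lat(1) esL] lattice_no_basis[OF mirr fsL] m
          unit_edges_spaced[OF lat(1) esL] unit_edges_spaced[OF mirr fsL] by auto
      have sq: "2 * q * (q - 1) \<le> m * q * (q - 1)" if "0 \<le> q" for q
      proof -
        have "0 \<le> q * (q - 1)" using that by (cases "q = 0") auto
        then have "2 * (q * (q - 1)) \<le> m * (q * (q - 1))" using m by (intro mult_right_mono) auto
        then show ?thesis by (simp add: mult.assoc)
      qed
      show ?thesis
        by (rule III_arith_half[OF q(1) _ kle[OF q(1)] _ tlr(6), of "n - X" "int (card V)" q r tl "Y + Z"])
          (use q X tlr nm m sq[OF q(2)] sq[OF q(3)] in auto)
    qed
    show "int (card V) \<le> 2 * n - 2" if nm: "n = m"
    proof -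
      have m: "1 < m" "m dvd n" "0 < m" using nm n by auto
      have nb: "no_basis es \<and> no_basis fs"
        using lattice_no_basis[OF lat(1) esL] lattice_no_basis[OF mirr fsL] m by blast
      obtain q r k where q: "0 \<le> k" "0 \<le> q" "0 \<le> r"
        "2 * int (card V) + 2 * 1 \<le> 2 * (n - X) + q + r + (Y + ht es + (Z + ht fs)) - k * (X + wd es - n) + 2 * (tl + tr)"
        "m * q * (q - 1) + 2 * q + (m * r * (r - 1) + 2 * r) - 2 * (k + 2) * (n - X) \<le> 2 * (Y + Z)"
        "0 < q + r \<longrightarrow> (\<exists>e\<in>set es \<union> set fs. fst e = 1)"
        using halves[of 1 m] nb m(3)
          unit_edges_spaced[OF lat(1) esL] unit_edges_spaced[OF mirr[OF m(2)] fsL[OF m(2)]] by auto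
      have memu: "(X, n - Z) \<in> V" "(X + wd es, n - (Z + ht fs)) \<in> V"
        using refl_y_mem[OF U(5)] refl_y_mem[OF U(6)] wdf by simp_all
      have gapl: "(0, n - Z - Y) \<in> \<Lambda>"
        using sublatticeD(1)[OF lat(1), of "(X, n - Z)" "(X, Y)"] memu L(5) lat(2) by auto
      have gapr: "(0, n - (Z + ht fs) - (Y + ht es)) \<in> \<Lambda>"
        using sublatticeD(1)[OF lat(1), of "(X + wd es, n - (Z + ht fs))" "(X + wd es, Y + ht es)"] memu L(6) lat(2)
        by auto
      show ?thesis
      proof (cases "\<exists>e\<in>set es \<union> set fs. fst e = 1")
        case False
        then have "q = 0" "r = 0" using q by auto
        show ?thesis
        proof (rule ccontr)
          assume big: "\<not> ?thesis"
          \<comment> \<open>Without edges of width one, a counterexample needs a right side of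
            length one, that is (0,1) in the lattice. Then n divides all abscissas, and
            \<open>vd\<close> and \<open>vu\<close> lie on the wall with the origin between them,
            which freeness forbids.\<close>
          have e1: "n - (Z + ht fs) - (Y + ht es) = 1"
            using big q(4) \<open>q = 0\<close> \<open>r = 0\<close> kle[OF q(1)] q(1) X(1) tlr n
            by (smt (verit))
          have g: "(0, 1) \<in> \<Lambda>" using gapr unfolding e1 .
          have "n dvd fst v" if "v \<in> V" for v
          proof -
            have "m dvd det2 (0, 1) v" using sublatticeD(2)[OF lat(1) g] that lat(2) by blast
            then show ?thesis using nm by (simp add: det2_def)
          qed
          then have "fst vd = 0" "fst vu = 0"
            using vd(1) vu(1) vdx vux le zdvd_not_zless by (metis order_le_less)+
          moreover obtain a b :: real where "\<forall>v\<in>V. 0 < a * of_int (fst v - n * 0) + b * of_int (snd v - n * 0)"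
            using free by blast
          ultimately have "0 < b * of_int (snd vd)" "0 < b * of_int (snd vu)" using vd(1) vu(1) by fastforce+
          then show False using vd vu n by (simp add: zero_less_mult_iff)
        qed
      next
        case True
        then obtain e where "e \<in> \<Lambda>" "fst e = 1"
        proof
          fix e assume e: "e \<in> set es \<union> set fs" "fst e = 1"
          show thesis
          proof (cases "e \<in> set es")
            case True then show thesis using that esL e by blast
          next
            case False
            then have "e \<in> refl_y n ` \<Lambda>" using fsL[OF m(2)] e by blast
            then obtain e' where "e' \<in> \<Lambda>" "e = refl_y n e'" by blast
            then show thesis using that[of e'] e by simp
          qed
        qed
        \<comment> \<open>A lattice vector of width one makes all vertical lattice vectors multiples
          of n. So the right side, being shorter than n, is absent, a left side has length at least
          n, and a start on the wall would be a forbidden point.\<close>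
        then have vert: "n dvd k" if "(0, k) \<in> \<Lambda>" for k
          using sublatticeD(2)[OF lat(1) \<open>e \<in> \<Lambda>\<close> that] nm by (simp add: det2_def)
        have "n dvd n - (Z + ht fs) - (Y + ht es)" by (rule vert[OF gapr])
        then have r0: "n - (Z + ht fs) - (Y + ht es) = 0"
          using right tlr(6) YZ(2) zdvd_not_zless[of "n - (Z + ht fs) - (Y + ht es)" n] by linarith
        then have "tr = 0" unfolding tr_def by auto
        have "n dvd n - Z - Y" by (rule vert[OF gapl])
        then have "\<not> (0 < n - Z - Y \<and> n - Z - Y < n)" using zdvd_not_zless by blast
        then have l: "tl = 0 \<and> Y + Z \<le> n \<or> tl = 1 \<and> Y + Z \<le> 0"
          using YZ(1) unfolding tl_def by (smt (verit))
        have "X \<noteq> 0"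
        proof
          assume "X = 0"
          then have "(0, Y) \<in> \<Lambda>" using L(5) lat(2) by auto
          then obtain y where "Y = n * y" using vert by blast
          then show False using free[of 0 y] L(5) \<open>X = 0\<close> by force
        qed
        show ?thesis
          by (rule III_arith_full[OF q(1) _ kle[OF q(1)] n _ YZ(2) l, of "n - X" "int (card V)" q r])
            (use q X \<open>X \<noteq> 0\<close> nm \<open>tr = 0\<close> in auto)
      qed
    qed
  qed
qed

section \<open>Invariance under unimodular affine maps\<close>

definition tf :: "int \<Rightarrow> int \<Rightarrow> int \<Rightarrow> int \<Rightarrow> int \<Rightarrow> int \<Rightarrow> int \<times> int \<Rightarrow> int \<times> int" where
  "tf a b c d p q v = (a * fst v + b * snd v + p, c * fst v + d * snd v + q)"

lemma tf_simps [simp]: "fst (tf a b c d p q v) = a * fst v + b * snd v + p"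
  "snd (tf a b c d p q v) = c * fst v + d * snd v + q"
  by (simp_all add: tf_def)

text \<open>The new coefficients come from the inverse transposed matrix; the determinant \<epsilon>
  is its own inverse.\<close>

lemma tf_functional:
  fixes a b c d \<epsilon> x y :: int and \<alpha> \<beta> :: real
  assumes "a * d - b * c = \<epsilon>" "\<epsilon> * \<epsilon> = 1"
  shows "(of_int \<epsilon> * (of_int d * \<alpha> - of_int c * \<beta>)) * of_int (a * x + b * y) +
    (of_int \<epsilon> * (of_int a * \<beta> - of_int b * \<alpha>)) * of_int (c * x + d * y) = \<alpha> * of_int x + \<beta> * of_int y"
proof -
  have "(of_int \<epsilon> * (of_int d * \<alpha> - of_int c * \<beta>)) * of_int (a * x + b * y) +
    (of_int \<epsilon> * (of_int a * \<beta> - of_int b * \<alpha>)) * of_int (c * x + d * y) =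
    of_int (\<epsilon> * (a * d - b * c)) * (\<alpha> * of_int x + \<beta> * of_int y)"
    by (simp add: algebra_simps)
  then show ?thesis using assms by simp
qed

lemma inj_tf:
  assumes "\<bar>a * d - b * c\<bar> = 1"
  shows "inj_on (tf a b c d p q) A"
proof (rule inj_onI)
  fix v w assume "tf a b c d p q v = tf a b c d p q w"
  then have e: "a * (fst v - fst w) + b * (snd v - snd w) = 0" "c * (fst v - fst w) + d * (snd v - snd w) = 0"
    by (simp_all add: tf_def algebra_simps)
  have "(a * d - b * c) * (fst v - fst w) = d * (a * (fst v - fst w) + b * (snd v - snd w)) -
      b * (c * (fst v - fst w) + d * (snd v - snd w))"
    "(a * d - b * c) * (snd v - snd w) = a * (c * (fst v - fst w) + d * (snd v - snd w)) -
      c * (a * (fst v - fst w) + b * (snd v - snd w))"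
    by (simp_all add: algebra_simps)
  then show "v = w" using e assms by (auto simp: prod_eq_iff)
qed

lemma free_config_tf:
  assumes det: "\<bar>a * d - b * c\<bar> = 1" and V: "free_config n V"
  shows "free_config n (tf a b c d (n * p) (n * q) ` V)"
proof -
  define \<epsilon> where "\<epsilon> = a * d - b * c"
  have eps: "\<epsilon> * \<epsilon> = 1" using det unfolding \<epsilon>_def by (metis abs_mult_self_eq mult_1)
  have fin: "finite V" and conv: "convex_position V"
    and free: "\<And>p q. \<exists>\<alpha> \<beta>::real. \<forall>v\<in>V. 0 < \<alpha> * of_int (fst v - n * p) + \<beta> * of_int (snd v - n * q)"
    using V unfolding free_config_def by auto
  let ?T = "tf a b c d (n * p) (n * q)"
  have "convex_position (?T ` V)" unfolding convex_position_def
  proof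
    fix v' assume "v' \<in> ?T ` V"
    then obtain v where v: "v \<in> V" "v' = ?T v" by auto
    obtain \<alpha> \<beta> :: real where ab: "\<forall>w\<in>V - {v}. 0 < \<alpha> * of_int (fst w - fst v) + \<beta> * of_int (snd w - snd v)"
      using conv v unfolding convex_position_def by blast
    show "\<exists>\<alpha> \<beta>::real. \<forall>w\<in>?T ` V - {v'}. 0 < \<alpha> * of_int (fst w - fst v') + \<beta> * of_int (snd w - snd v')"
    proof (intro exI ballI)
      fix w' assume "w' \<in> ?T ` V - {v'}"
      then obtain w where w: "w \<in> V - {v}" "w' = ?T w" using v by auto
      have "fst w' - fst v' = a * (fst w - fst v) + b * (snd w - snd v)"
        "snd w' - snd v' = c * (fst w - fst v) + d * (snd w - snd v)"
        unfolding w v by (simp_all add: algebra_simps)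
      then show "0 < (of_int \<epsilon> * (of_int d * \<alpha> - of_int c * \<beta>)) * of_int (fst w' - fst v') +
        (of_int \<epsilon> * (of_int a * \<beta> - of_int b * \<alpha>)) * of_int (snd w' - snd v')"
        using bspec[OF ab w(1)] by (simp only: tf_functional[OF \<epsilon>_def[symmetric] eps])
    qed
  qed
  moreover have "\<exists>\<alpha> \<beta>::real. \<forall>v\<in>?T ` V. 0 < \<alpha> * of_int (fst v - n * P) + \<beta> * of_int (snd v - n * Q)" for P Q
  proof -
    \<comment> \<open>(n R, n S) is the preimage of (n P, n Q); it is again a point of
      \<open>n\<int>\<^sup>2\<close> because \<epsilon> is 1 or -1.\<close>
    define R where "R = \<epsilon> * (d * (P - p) - b * (Q - q))"
    define S where "S = \<epsilon> * (a * (Q - q) - c * (P - p))"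
    have RS: "a * R + b * S = P - p" "c * R + d * S = Q - q"
    proof -
      have "a * R + b * S = \<epsilon> * (a * d - b * c) * (P - p)" "c * R + d * S = \<epsilon> * (a * d - b * c) * (Q - q)"
        unfolding R_def S_def by (simp_all add: algebra_simps)
      then show "a * R + b * S = P - p" "c * R + d * S = Q - q" using eps unfolding \<epsilon>_def by simp_all
    qed
    obtain \<alpha> \<beta> :: real where ab: "\<forall>v\<in>V. 0 < \<alpha> * of_int (fst v - n * R) + \<beta> * of_int (snd v - n * S)"
      using free by blast
    show ?thesis
    proof (intro exI ballI)
      fix w' assume "w' \<in> ?T ` V"
      then obtain w where w: "w \<in> V" "w' = ?T w" by auto
      have P: "P = a * R + b * S + p" and Q: "Q = c * R + d * S + q" using RS by simp_all
      have "fst w' - n * P = a * (fst w - n * R) + b * (snd w - n * S)"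
        "snd w' - n * Q = c * (fst w - n * R) + d * (snd w - n * S)"
        unfolding w P Q by (simp_all add: algebra_simps)
      then show "0 < (of_int \<epsilon> * (of_int d * \<alpha> - of_int c * \<beta>)) * of_int (fst w' - n * P) +
        (of_int \<epsilon> * (of_int a * \<beta> - of_int b * \<alpha>)) * of_int (snd w' - n * Q)"
        using bspec[OF ab w(1)] by (simp only: tf_functional[OF \<epsilon>_def[symmetric] eps])
    qed
  qed
  ultimately show ?thesis using fin unfolding free_config_def by auto
qed

lemma sublattice_tf:
  assumes det: "\<bar>a * d - b * c\<bar> = 1" and L: "sublattice m \<Lambda>" and mn: "m dvd n"
  shows "sublattice m (tf a b c d (n * p) (n * q) ` \<Lambda>)"
proof -
  define \<epsilon> where "\<epsilon> = a * d - b * c"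
  have eps: "\<epsilon> * \<epsilon> = 1" using det unfolding \<epsilon>_def by (metis abs_mult_self_eq mult_1)
  obtain n' where n': "n = m * n'" using mn by blast
  have preim: "(x, y) \<in> tf a b c d (n * p) (n * q) ` \<Lambda>"
    if "(\<epsilon> * (d * (x - n * p) - b * (y - n * q)), \<epsilon> * (a * (y - n * q) - c * (x - n * p))) \<in> \<Lambda>" for x y
  proof -
    let ?v = "(\<epsilon> * (d * (x - n * p) - b * (y - n * q)), \<epsilon> * (a * (y - n * q) - c * (x - n * p)))"
    have "tf a b c d (n * p) (n * q) ?v = (\<epsilon> * (a * d - b * c) * (x - n * p) + n * p, \<epsilon> * (a * d - b * c) * (y - n * q) + n * q)"
      unfolding tf_def by (simp add: algebra_simps)
    then have "tf a b c d (n * p) (n * q) ?v = (x, y)" using eps unfolding \<epsilon>_def by simp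
    then show ?thesis using that by (metis imageI)
  qed
  show ?thesis unfolding sublattice_def
  proof (intro conjI ballI allI)
    fix e' f' assume "e' \<in> tf a b c d (n * p) (n * q) ` \<Lambda>" "f' \<in> tf a b c d (n * p) (n * q) ` \<Lambda>"
    then obtain e f where ef: "e \<in> \<Lambda>" "f \<in> \<Lambda>" "e' = tf a b c d (n * p) (n * q) e" "f' = tf a b c d (n * p) (n * q) f" by auto
    \<comment> \<open>t is the preimage of the translation vector under the linear part, so that a
      difference of images is the image of \<open>(e - f) - t\<close>. It lies in
      \<open>\<Lambda>\<close> because m divides n.\<close>
    define t where "t = (n * (\<epsilon> * (d * p - b * q)), n * (\<epsilon> * (a * q - c * p)))"
    have t: "t \<in> \<Lambda>" using sublatticeD(3)[OF L, of "n' * (\<epsilon> * (d * p - b * q))" "n' * (\<epsilon> * (a * q - c * p))"]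
      unfolding t_def n' by (simp add: mult.assoc)
    have "(e - f) - t \<in> \<Lambda>" using sublatticeD(1)[OF L] ef t by blast
    moreover have "a * (\<epsilon> * (d * p - b * q)) + b * (\<epsilon> * (a * q - c * p)) = \<epsilon> * (a * d - b * c) * p"
      "c * (\<epsilon> * (d * p - b * q)) + d * (\<epsilon> * (a * q - c * p)) = \<epsilon> * (a * d - b * c) * q"
      by (simp_all add: algebra_simps)
    then have tt: "a * (\<epsilon> * (d * p - b * q)) + b * (\<epsilon> * (a * q - c * p)) = p"
      "c * (\<epsilon> * (d * p - b * q)) + d * (\<epsilon> * (a * q - c * p)) = q" using eps unfolding \<epsilon>_def by simp_all
    have "a * fst t + b * snd t = n * (a * (\<epsilon> * (d * p - b * q)) + b * (\<epsilon> * (a * q - c * p)))"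
      "c * fst t + d * snd t = n * (c * (\<epsilon> * (d * p - b * q)) + d * (\<epsilon> * (a * q - c * p)))"
      unfolding t_def by (simp_all only: fst_conv snd_conv distrib_left mult.left_commute)
    then have ft: "a * fst t + b * snd t = n * p" "c * fst t + d * snd t = n * q" unfolding tt by auto
    moreover have "tf a b c d (n * p) (n * q) ((e - f) - t) = e' - f'"
      unfolding ef(3,4) prod_eq_iff tf_simps fst_diff snd_diff ft[symmetric] by (simp add: algebra_simps)
    ultimately show "e' - f' \<in> tf a b c d (n * p) (n * q) ` \<Lambda>" by (metis imageI)
    have "det2 e' f' = \<epsilon> * det2 e f + n * (p * (c * fst f + d * snd f) + q * (a * fst e + b * snd e)
       - p * (c * fst e + d * snd e) - q * (a * fst f + b * snd f))"
      unfolding ef(3,4) \<epsilon>_def by (simp add: det2_def algebra_simps)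
    then show "m dvd det2 e' f'" using sublatticeD(2)[OF L ef(1,2)] mn by simp
  next
    fix P Q
    show "(m * P, m * Q) \<in> tf a b c d (n * p) (n * q) ` \<Lambda>"
    proof (rule preim)
      have "(\<epsilon> * (d * (m * P - n * p) - b * (m * Q - n * q)), \<epsilon> * (a * (m * Q - n * q) - c * (m * P - n * p))) =
        (m * (\<epsilon> * (d * (P - n' * p) - b * (Q - n' * q))), m * (\<epsilon> * (a * (Q - n' * q) - c * (P - n' * p))))"
        unfolding n' prod.inject by (intro conjI; simp add: algebra_simps)
      also have "\<dots> \<in> \<Lambda>" by (rule sublatticeD(3)[OF L])
      finally show "(\<epsilon> * (d * (m * P - n * p) - b * (m * Q - n * q)), \<epsilon> * (a * (m * Q - n * q) - c * (m * P - n * p))) \<in> \<Lambda>" .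
    qed
  qed
qed

lemma vertex_bounds_tf:
  assumes det: "\<bar>a * d - b * c\<bar> = 1" and B: "vertex_bounds n (tf a b c d (n * p) (n * q) ` V)"
  shows "vertex_bounds n V"
proof -
  have c: "card (tf a b c d (n * p) (n * q) ` V) = card V" by (rule card_image[OF inj_tf[OF det]])
  show ?thesis unfolding vertex_bounds_def
  proof (intro conjI allI impI)
    show "int (card V) \<le> 2 * n + 2" using B c unfolding vertex_bounds_def by simp
    fix m \<Lambda> assume L: "sublattice m \<Lambda>" "V \<subseteq> \<Lambda>"
    have "tf a b c d (n * p) (n * q) ` V \<subseteq> tf a b c d (n * p) (n * q) ` \<Lambda>" using L(2) by blast
    then show "n = 2 * m \<Longrightarrow> int (card V) \<le> 2 * n" "n = m \<Longrightarrow> int (card V) \<le> 2 * n - 2"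
      using B sublattice_tf[OF det L(1), of n p q] c unfolding vertex_bounds_def by (metis dvd_triv_right dvd_refl)+
  qed
qed

section \<open>Counting vertices by columns\<close>

definition col :: "(int \<times> int) set \<Rightarrow> int \<Rightarrow> (int \<times> int) set" where
  "col V x = {v \<in> V. fst v = x}"

lemma card_columns:
  assumes "finite V" "fst ` V \<subseteq> A" "finite A"
  shows "card V = (\<Sum>x\<in>A. card (col V x))"
proof -
  have "card V = (\<Sum>x\<in>fst ` V. card (col V x))"
    using sum.image_gen[OF assms(1), of "\<lambda>_. 1::nat" fst] by (simp add: col_def)
  also have "\<dots> = (\<Sum>x\<in>A. card (col V x))"
    by (rule sum.mono_neutral_left) (use assms in \<open>auto simp: col_def rev_image_eqI\<close>)
  finally show ?thesis .
qed

text \<open>On a vertical line the exposing functional is monotone in the height, so each vertex is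
  the lowest or the highest of its column.\<close>

lemma col_le_2:
  assumes "finite V" "convex_position V"
  shows "card (col V x) \<le> 2"
proof (cases "col V x = {}")
  case False
  have fin: "finite (col V x)" using assms(1) by (simp add: col_def)
  have "v \<in> {(x, Min (snd ` col V x)), (x, Max (snd ` col V x))}" if v: "v \<in> col V x" for v
  proof -
    obtain \<alpha> \<beta> :: real where ab: "\<forall>w\<in>V - {v}. 0 < \<alpha> * of_int (fst w - fst v) + \<beta> * of_int (snd w - snd v)"
      using assms(2) v unfolding convex_position_def col_def by blast
    have "0 < \<beta> * of_int (snd w - snd v)" if "w \<in> col V x" "w \<noteq> v" for w
      using bspec[OF ab, of w] that v by (simp add: col_def)
    then have sign: "0 < \<beta> \<and> snd v < snd w \<or> \<beta> < 0 \<and> snd w < snd v" if "w \<in> col V x" "w \<noteq> v" for w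
      using that by (auto simp: zero_less_mult_iff)
    have "(\<forall>w\<in>col V x. snd v \<le> snd w) \<or> (\<forall>w\<in>col V x. snd w \<le> snd v)"
      using sign by (metis less_asym less_imp_le order_refl)
    then have "snd v = Min (snd ` col V x) \<or> snd v = Max (snd ` col V x)"
    proof
      assume "\<forall>w\<in>col V x. snd v \<le> snd w"
      then have "Min (snd ` col V x) = snd v" using fin v by (intro Min_eqI) auto
      then show ?thesis by simp
    next
      assume "\<forall>w\<in>col V x. snd w \<le> snd v"
      then have "Max (snd ` col V x) = snd v" using fin v by (intro Max_eqI) auto
      then show ?thesis by simp
    qed
    then show ?thesis using v by (auto simp: col_def prod_eq_iff)
  qed
  then have "col V x \<subseteq> {(x, Min (snd ` col V x)), (x, Max (snd ` col V x))}" by blast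
  then have "card (col V x) \<le> card {(x, Min (snd ` col V x)), (x, Max (snd ` col V x))}"
    by (rule card_mono[rotated]) simp
  also have "\<dots> \<le> 2" by (simp add: card_insert_if)
  finally show ?thesis .
qed simp

lemma free_not_multiple:
  assumes "free_config n V"
  shows "(n * p, n * q) \<notin> V"
proof
  assume "(n * p, n * q) \<in> V"
  moreover obtain \<alpha> \<beta> :: real where "\<forall>v\<in>V. 0 < \<alpha> * of_int (fst v - n * p) + \<beta> * of_int (snd v - n * q)"
    using assms unfolding free_config_def by blast
  ultimately show False by fastforce
qed

text \<open>In a column through points of \<open>n\<int>\<^sup>2\<close> all of whose lattice points are multiples of \<open>n/2\<close>,
  two vertices would enclose a forbidden point.\<close>

lemma col_le_1:
  assumes V: "free_config n V" and L: "sublattice m \<Lambda>" "V \<subseteq> \<Lambda>" "m dvd n" and n: "0 < n"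
    and half: "\<And>y. (0, y) \<in> \<Lambda> \<Longrightarrow> n dvd 2 * y"
  shows "card (col V (n * p)) \<le> 1"
proof -
  have odd: "\<exists>j. 2 * y = n * (2 * j + 1)" if "(n * p, y) \<in> V" for y
  proof -
    obtain n' where n': "n = m * n'" using L(3) by blast
    have "(n * p, 0) \<in> \<Lambda>" using sublatticeD(3)[OF L(1), of "n' * p" 0] n' by (simp add: mult.assoc)
    then have "(n * p, y) - (n * p, 0) \<in> \<Lambda>" using that L sublatticeD(1)[OF L(1)] by blast
    then obtain k where k: "2 * y = n * k" using half[of y] by auto
    have "odd k"
    proof
      assume "even k"
      then obtain j where "k = 2 * j" by blast
      then have "y = n * j" using k by simp
      then show False using that free_not_multiple[OF V] by simp
    qed
    then show ?thesis using k by (metis oddE)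
  qed
  have "y \<le> y'" if yy: "(n * p, y) \<in> V" "(n * p, y') \<in> V" for y y'
  proof (rule ccontr)
    assume "\<not> y \<le> y'"
    obtain j j' where j: "2 * y = n * (2 * j + 1)" "2 * y' = n * (2 * j' + 1)" using odd yy by blast
    have "j' < j"
    proof (rule ccontr)
      assume "\<not> j' < j"
      then have "n * (2 * j + 1) \<le> n * (2 * j' + 1)" using n by (intro mult_left_mono) auto
      then show False using j \<open>\<not> y \<le> y'\<close> by linarith
    qed
    then have "n * (j' + 1) \<le> n * j" using n by (intro mult_left_mono) auto
    then have between: "y' < n * j" "n * j < y" using j n by (simp_all add: algebra_simps)
    obtain \<alpha> \<beta> :: real where ab: "\<forall>v\<in>V. 0 < \<alpha> * of_int (fst v - n * p) + \<beta> * of_int (snd v - n * j)"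
      using V unfolding free_config_def by blast
    have "0 < \<beta> * of_int (y - n * j)" "0 < \<beta> * of_int (y' - n * j)" using bspec[OF ab yy(1)] bspec[OF ab yy(2)] by simp_all
    moreover have "real_of_int (y' - n * j) < 0" "0 < real_of_int (y - n * j)"
      using between by (simp_all only: of_int_less_0_iff of_int_0_less_iff)
    ultimately show False by (meson less_asym zero_less_mult_pos2 mult_pos_neg)
  qed
  then have "\<And>v w. v \<in> col V (n * p) \<Longrightarrow> w \<in> col V (n * p) \<Longrightarrow> v = w"
    unfolding col_def by (auto simp: prod_eq_iff intro: antisym)
  then show ?thesis by (metis card.empty card_1_singleton_iff is_singletonI' is_singleton_def One_nat_def le_SucI order_refl zero_le)
qed

text \<open>A and its translate by one are disjoint subsets of \<open>{0..k + 1}\<close>.\<close>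

lemma no_consecutive:
  fixes A :: "int set"
  assumes "A \<subseteq> {0..k}" "\<And>x. x \<in> A \<Longrightarrow> x + 1 \<notin> A" "0 \<le> k"
  shows "2 * int (card A) \<le> k + 2"
proof -
  have fin: "finite A" using assms(1) finite_subset by blast
  have "card (A \<union> (\<lambda>x. x + 1) ` A) = card A + card ((\<lambda>x. x + 1) ` A)"
    using assms(2) fin by (intro card_Un_disjoint) auto
  moreover have "card ((\<lambda>x. x + 1) ` A) = card A" by (intro card_image inj_onI) simp
  moreover have "card (A \<union> (\<lambda>x. x + 1) ` A) \<le> card {0..k + 1}" using assms(1) by (intro card_mono) auto
  ultimately show ?thesis using assms(3) by simp
qed

lemma card_le_columns:
  assumes "free_config n V"
  shows "int (card V) \<le> 2 * int (card (fst ` V))"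
proof -
  have "card V = (\<Sum>x\<in>fst ` V. card (col V x))"
    using assms unfolding free_config_def by (intro card_columns) auto
  also have "\<dots> \<le> (\<Sum>x\<in>fst ` V. 2)"
    using assms unfolding free_config_def by (intro sum_mono col_le_2) auto
  finally show ?thesis by simp
qed

lemma consecutive_columns:
  assumes "sublattice m \<Lambda>" "V \<subseteq> \<Lambda>" "\<nexists>e. e \<in> \<Lambda> \<and> fst e = c" "x \<in> fst ` V"
  shows "x + c \<notin> fst ` V"
proof
  assume "x + c \<in> fst ` V"
  then obtain w where w: "w \<in> V" "fst w = x + c" by (metis imageE)
  obtain v where v: "v \<in> V" "fst v = x" using assms(4) by (metis imageE)
  have "w \<in> \<Lambda>" "v \<in> \<Lambda>" using w v assms(2) by auto
  then have "w - v \<in> \<Lambda>" by (rule sublatticeD(1)[OF assms(1)])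
  moreover have "fst (w - v) = c" using v w by simp
  ultimately have "w - v \<in> \<Lambda>" "fst (w - v) = c" by blast+
  then show False using assms(3) by blast
qed

text \<open>n + 1 columns with at most two vertices each give 2n + 2. If the lattice has a vector of
  width one, vertical lattice vectors are multiples of m, and each of the two border columns holds
  at most one vertex for n = 2m and none for n = m. Otherwise no two neighbouring columns are
  occupied.\<close>

lemma type_I_bounds:
  assumes n: "3 \<le> n" and V: "free_config n V" and slab: "\<And>v. v \<in> V \<Longrightarrow> 0 \<le> fst v \<and> fst v \<le> n"
  shows "vertex_bounds n V"
proof -
  have fin: "finite V" and conv: "convex_position V" using V unfolding free_config_def by auto
  have sub: "fst ` V \<subseteq> {0..n}" using slab by auto
  have le2: "int (card V) \<le> 2 * int (card (fst ` V))" by (rule card_le_columns[OF V])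
  have cols: "int (card V) = (\<Sum>x\<in>{0..n}. int (card (col V x)))"
    unfolding card_columns[OF fin sub finite_atLeastAtMost_int] by simp
  have inner: "(\<Sum>x\<in>{1..n-1}. int (card (col V x))) \<le> 2 * (n - 1)"
  proof -
    have "(\<Sum>x\<in>{1..n-1}. int (card (col V x))) \<le> (\<Sum>x\<in>{1..n-1}. 2)"
      by (rule sum_mono) (use col_le_2[OF fin conv] in simp)
    then show ?thesis using n by simp
  qed
  have "{0..n} = insert 0 (insert n {1..n-1})" using n by auto
  then have split: "int (card V) = int (card (col V 0)) + (int (card (col V n)) + (\<Sum>x\<in>{1..n-1}. int (card (col V x))))"
    using cols n by simp
  show ?thesis unfolding vertex_bounds_def
  proof (intro conjI allI impI)
    have "card (fst ` V) \<le> card {0..n}" by (intro card_mono sub) simp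
    then show "int (card V) \<le> 2 * n + 2" using le2 n by simp
  next
    fix m \<Lambda> assume L: "sublattice m \<Lambda>" "V \<subseteq> \<Lambda>"
    have vert: "m dvd y" if "e \<in> \<Lambda>" "fst e = 1" "(0, y) \<in> \<Lambda>" for e y
      using sublatticeD(2)[OF L(1) that(1,3)] that(2) by (simp add: det2_def)
    have sparse: "2 * int (card (fst ` V)) \<le> n + 2" if "\<nexists>e. e \<in> \<Lambda> \<and> fst e = 1"
      by (rule no_consecutive[OF sub]) (use consecutive_columns[OF L that] n in auto)
    show "int (card V) \<le> 2 * n" if nm: "n = 2 * m"
    proof (cases "\<exists>e. e \<in> \<Lambda> \<and> fst e = 1")
      case True
      then have half: "n dvd 2 * y" if "(0, y) \<in> \<Lambda>" for y using vert that nm by auto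
      have "card (col V (n * p)) \<le> 1" for p by (rule col_le_1[OF V L]) (use nm n half in auto)
      from this[of 0] this[of 1] show ?thesis using split inner by simp
    next
      case False
      then show ?thesis using sparse[OF False] le2 n by linarith
    qed
    show "int (card V) \<le> 2 * n - 2" if nm: "n = m"
    proof (cases "\<exists>e. e \<in> \<Lambda> \<and> fst e = 1")
      case True
      have "col V (n * p) = {}" for p
      proof (rule ccontr)
        assume "col V (n * p) \<noteq> {}"
        then obtain y where y: "(n * p, y) \<in> V" unfolding col_def by auto
        have "(n * p, 0) \<in> \<Lambda>" using sublatticeD(3)[OF L(1), of p 0] nm by simp
        then have "(0, y) \<in> \<Lambda>" using sublatticeD(1)[OF L(1), of "(n * p, y)" "(n * p, 0)"] y L(2) by auto
        then have "n dvd y" using vert True nm by blast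
        then obtain q where "y = n * q" by (rule dvdE)
        then show False using y free_not_multiple[OF V] by simp
      qed
      from this[of 0] this[of 1] show ?thesis using split inner by simp
    next
      case False
      then show ?thesis using sparse[OF False] le2 n by (smt (verit))
    qed
  qed
qed

section \<open>Passing around the corners of a triangle\<close>

lemma flat_weight:
  fixes z :: int
  assumes "turning es" "\<And>e. e \<in> set es \<Longrightarrow> snd e = s * fst e" "0 \<le> z" "\<And>e. e \<in> set es \<Longrightarrow> 2 - fst e \<le> z"
  shows "2 * int (length es) \<le> wd es + z"
proof -
  have "length es \<le> 1" by (rule flat_le_1[OF assms(1)]) (simp add: det2_def assms(2))
  then show ?thesis
    using assms(3,4) by (cases es) auto
qed

lemma sum_weight:
  assumes "\<And>e. e \<in> set es \<Longrightarrow> k \<le> a * fst e + b * snd e"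
  shows "k * int (length es) \<le> a * wd es + b * ht es"
  using assms by (induction es) (force simp: algebra_simps)+

text \<open>The triangle has the corners (0,0), (n,0), (n,n). Edges of slope strictly between 0 and
  1 have width at least two and need no corner. Edges of slope 0 or 1 are parallel to sides of the
  triangle and leave the deficits z and z'. The others form the chains around (0,0) and
  (n,0).\<close>

lemma theta_lower:
  fixes d n z z' :: int and \<alpha> \<beta> \<gamma> \<delta> :: real
  assumes ch: "lower_chain V X Y es" and X: "X < 0" "n < X + wd es"
    and v: "v \<in> V" "snd v < 0" and w: "w \<in> V" "snd w - fst w + n < 0"
    and ab: "0 < \<alpha>" "0 < \<beta>" "\<And>v. v \<in> V \<Longrightarrow> 0 < \<alpha> * of_int (fst v) + \<beta> * of_int (snd v)"
    and gd: "0 < \<gamma>" "0 < \<delta>" "\<And>v. v \<in> V \<Longrightarrow> 0 < \<gamma> * of_int (n - fst v) + \<delta> * of_int (snd v - fst v + n)"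
    and d: "d = 0 \<or> d = 1 \<and> no_basis es"
    and z: "0 \<le> z" "\<And>e. e \<in> set es \<Longrightarrow> snd e = 0 \<Longrightarrow> 2 - fst e \<le> z"
    and z': "0 \<le> z'" "\<And>e. e \<in> set es \<Longrightarrow> snd e = fst e \<Longrightarrow> 2 - fst e \<le> z'"
  shows "2 * int (length es) + 2 * d \<le> 2 * n + Y + (Y + ht es) - (X + wd es) + z + z'"
proof -
  note L = lower_chainD[OF ch]
  define as where "as = filter (\<lambda>e. snd e < 0 * fst e) es"
  define r1 where "r1 = filter (\<lambda>e. 0 * fst e \<le> snd e) es"
  define zs where "zs = filter (\<lambda>e. snd e \<le> 0 * fst e) r1"
  define r2 where "r2 = filter (\<lambda>e. 0 * fst e < snd e) r1"
  define ms where "ms = filter (\<lambda>e. snd e < 1 * fst e) r2"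
  define r3 where "r3 = filter (\<lambda>e. 1 * fst e \<le> snd e) r2"
  define ys where "ys = filter (\<lambda>e. snd e \<le> 1 * fst e) r3"
  define bs where "bs = filter (\<lambda>e. 1 * fst e < snd e) r3"
  have mem: "e \<in> set es" if "e \<in> set as \<or> e \<in> set r1 \<or> e \<in> set zs \<or> e \<in> set r2 \<or> e \<in> set ms \<or> e \<in> set r3 \<or> e \<in> set ys \<or> e \<in> set bs" for e
    using that unfolding as_def bs_def ys_def r3_def ms_def r2_def zs_def r1_def by auto
  have tu: "turning as" "turning r1" "turning zs" "turning r2" "turning ms" "turning r3" "turning ys" "turning bs"
    using L(1) unfolding as_def bs_def ys_def r3_def ms_def r2_def zs_def r1_def by (auto intro!: turning_filter)
  have s1: "es = as @ r1" unfolding as_def r1_def by (rule slope_split_less[OF L(1,2)])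
  have s2: "r1 = zs @ r2" unfolding zs_def r2_def by (rule slope_split_le[OF tu(2)]) (use mem L(2) in blast)
  have s3: "r2 = ms @ r3" unfolding ms_def r3_def by (rule slope_split_less[OF tu(4)]) (use mem L(2) in blast)
  have s4: "r3 = ys @ bs" unfolding ys_def bs_def by (rule slope_split_le[OF tu(6)]) (use mem L(2) in blast)
  have es: "es = as @ zs @ ms @ ys @ bs" unfolding s1 s2 s3 s4 by simp
  have sg: "e \<in> set as \<Longrightarrow> snd e < 0" "e \<in> set zs \<Longrightarrow> snd e = 0" "e \<in> set ms \<Longrightarrow> 0 < snd e \<and> snd e < fst e"
    "e \<in> set ys \<Longrightarrow> snd e = fst e" "e \<in> set bs \<Longrightarrow> fst e < snd e" for e
    unfolding as_def bs_def ys_def r3_def ms_def r2_def zs_def r1_def by auto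
  have pos: "0 < fst e" if "e \<in> set as \<or> e \<in> set zs \<or> e \<in> set ms \<or> e \<in> set ys \<or> e \<in> set bs" for e
    using that mem L(2) by blast
  have dd: "d = 0 \<or> d = 1 \<and> no_basis as" "d = 0 \<or> d = 1 \<and> no_basis bs"
    using d no_basis_subset[of es as] no_basis_subset[of es bs] unfolding es by auto
  have low1: "Y + ht as < 0"
  proof -
    obtain ps ss where "es = ps @ ss" "Y + ht ps - 0 * (X + wd ps) \<le> snd v - 0 * fst v"
      using L(11)[OF v(1), of 0] by blast
    moreover have "ht as - 0 * wd as \<le> ht ps - 0 * wd ps"
    proof (rule split_minimizes[OF es \<open>es = ps @ ss\<close>])
      show "e \<in> set as \<Longrightarrow> snd e \<le> 0 * fst e" for e using sg(1)[of e] by simp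
      show "e \<in> set (zs @ ms @ ys @ bs) \<Longrightarrow> 0 * fst e \<le> snd e" for e
        using sg(2-5)[of e] pos[of e] by auto
    qed
    ultimately show ?thesis using v by simp
  qed
  have low2: "Y + ht (as @ zs @ ms @ ys) - (X + wd (as @ zs @ ms @ ys)) + n < 0"
  proof -
    obtain ps ss where "es = ps @ ss" "Y + ht ps - 1 * (X + wd ps) \<le> snd w - 1 * fst w"
      using L(11)[OF w(1), of 1] by blast
    moreover have "ht (as @ zs @ ms @ ys) - 1 * wd (as @ zs @ ms @ ys) \<le> ht ps - 1 * wd ps"
    proof (rule split_minimizes[of es _ bs, OF _ \<open>es = ps @ ss\<close>])
      show "e \<in> set (as @ zs @ ms @ ys) \<Longrightarrow> snd e \<le> 1 * fst e" for e
        using sg(1-4)[of e] pos[of e] by auto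
      show "e \<in> set bs \<Longrightarrow> 1 * fst e \<le> snd e" for e using sg(5)[of e] by auto
    qed (simp add: es)
    ultimately show ?thesis using w by simp
  qed
  have "rounds_origin \<alpha> \<beta> X Y as" unfolding rounds_origin_def
  proof (intro conjI allI impI ballI)
    fix ps ss assume "as = ps @ ss"
    then have "(X + wd ps, Y + ht ps) \<in> V" using L(4)[of ps "ss @ r1"] s1 by simp
    from ab(3)[OF this] show "0 < \<alpha> * real_of_int (X + wd ps) + \<beta> * real_of_int (Y + ht ps)" by simp
  next
    fix e assume "e \<in> set as" then show "0 < fst e" "snd e < 0" using sg pos by auto
  qed (use tu(1) ab(1,2) X low1 in auto)
  from corner[OF this dd(1)] have A: "2 * int (length as) + d \<le> X + wd as + Y" .
  have Z: "2 * int (length zs) \<le> wd zs + z"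
  proof (rule flat_weight[OF tu(3)])
    show "e \<in> set zs \<Longrightarrow> snd e = 0 * fst e" for e using sg(2)[of e] by simp
    show "e \<in> set zs \<Longrightarrow> 2 - fst e \<le> z" for e using sg(2)[of e] z mem by blast
  qed (rule z)
  have "2 \<le> 1 * fst e + 0 * snd e" if "e \<in> set ms" for e using sg(3)[OF that] by linarith
  from sum_weight[of ms, OF this] have M: "2 * int (length ms) \<le> wd ms" by simp
  have F: "2 * int (length ys) \<le> wd ys + z'"
  proof (rule flat_weight[OF tu(7)])
    show "e \<in> set ys \<Longrightarrow> snd e = 1 * fst e" for e using sg(4)[of e] by simp
    show "e \<in> set ys \<Longrightarrow> 2 - fst e \<le> z'" for e using sg(4)[of e] z' mem by blast
  qed (rule z')
  let ?x = "X + wd (as @ zs @ ms @ ys) - n" and ?y = "Y + ht (as @ zs @ ms @ ys)"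
  have B: "2 * int (length bs) + d \<le> - ?x + (?y + ht bs - 1 * (?x + wd bs))"
  proof (rule corner_right[OF tu(8) _ gd(1,2)])
    show "e \<in> set bs \<Longrightarrow> 0 < fst e \<and> 1 * fst e < snd e" for e using sg(5)[of e] pos[of e] by auto
    fix ps ss assume "bs = ps @ ss"
    then have "(X + wd ((as @ zs @ ms @ ys) @ ps), Y + ht ((as @ zs @ ms @ ys) @ ps)) \<in> V"
      using L(4)[of "(as @ zs @ ms @ ys) @ ps" ss] es by simp
    from gd(3)[OF this]
    show "0 < - \<gamma> * real_of_int (?x + wd ps) + \<delta> * real_of_int (?y + ht ps - 1 * (?x + wd ps))"
      by (simp add: algebra_simps)
  next
    show "?y < 1 * ?x" using low2 by simp
    show "0 < ?x + wd bs" using X(2) unfolding es by simp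
    show "d = 0 \<or> d = 1 \<and> no_basis bs" by (rule dd(2))
  qed
  have "length es = length as + length zs + length ms + length ys + length bs"
    "wd es = wd as + wd zs + wd ms + wd ys + wd bs" "ht es = ht (as @ zs @ ms @ ys) + ht bs"
    unfolding es by simp_all
  then show ?thesis using A Z M F B by simp
qed

text \<open>With n - y in place of y the upper boundary passes only the corner (n,n), now at (n,0),
  and does so with the edges of slope strictly between -1 and 0. Steeper falling edges pay by their
  depth, rising ones by width plus height.\<close>

lemma theta_upper:
  fixes d n z z' :: int and \<alpha> \<beta> :: real
  assumes ch: "lower_chain V X Z fs"
    and v: "v \<in> V" "snd v < 0" and w: "w \<in> V" "fst w + snd w < n"
    and ab: "0 < \<alpha>" "0 < \<beta>" "\<And>v. v \<in> V \<Longrightarrow> 0 < \<alpha> * of_int (fst v + snd v - n) + \<beta> * of_int (snd v)"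
    and d: "d = 0 \<or> d = 1 \<and> no_basis fs"
    and z: "0 \<le> z" "\<And>e. e \<in> set fs \<Longrightarrow> snd e = 0 \<Longrightarrow> 2 - fst e \<le> z"
    and z': "0 \<le> z'" "\<And>e. e \<in> set fs \<Longrightarrow> snd e = - fst e \<Longrightarrow> 2 - fst e \<le> z'"
  shows "2 * int (length fs) + d \<le> (X + wd fs) - n + Z + (Z + ht fs) + z + z'"
proof -
  note L = lower_chainD[OF ch]
  define as where "as = filter (\<lambda>e. snd e < (-1) * fst e) fs"
  define r1 where "r1 = filter (\<lambda>e. (-1) * fst e \<le> snd e) fs"
  define ys where "ys = filter (\<lambda>e. snd e \<le> (-1) * fst e) r1"
  define r2 where "r2 = filter (\<lambda>e. (-1) * fst e < snd e) r1"
  define ms where "ms = filter (\<lambda>e. snd e < 0 * fst e) r2"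
  define r3 where "r3 = filter (\<lambda>e. 0 * fst e \<le> snd e) r2"
  define zs where "zs = filter (\<lambda>e. snd e \<le> 0 * fst e) r3"
  define bs where "bs = filter (\<lambda>e. 0 * fst e < snd e) r3"
  have mem: "e \<in> set fs" if "e \<in> set as \<or> e \<in> set r1 \<or> e \<in> set zs \<or> e \<in> set r2 \<or> e \<in> set ms \<or> e \<in> set r3 \<or> e \<in> set ys \<or> e \<in> set bs" for e
    using that unfolding as_def bs_def zs_def r3_def ms_def r2_def ys_def r1_def by auto
  have tu: "turning as" "turning r1" "turning ys" "turning r2" "turning ms" "turning r3" "turning zs" "turning bs"
    using L(1) unfolding as_def bs_def zs_def r3_def ms_def r2_def ys_def r1_def by (auto intro!: turning_filter)
  have s1: "fs = as @ r1" unfolding as_def r1_def by (rule slope_split_less[OF L(1,2)])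
  have s2: "r1 = ys @ r2" unfolding ys_def r2_def by (rule slope_split_le[OF tu(2)]) (use mem L(2) in blast)
  have s3: "r2 = ms @ r3" unfolding ms_def r3_def by (rule slope_split_less[OF tu(4)]) (use mem L(2) in blast)
  have s4: "r3 = zs @ bs" unfolding zs_def bs_def by (rule slope_split_le[OF tu(6)]) (use mem L(2) in blast)
  have fs: "fs = as @ ys @ ms @ zs @ bs" unfolding s1 s2 s3 s4 by simp
  have sg: "e \<in> set as \<Longrightarrow> snd e < - fst e" "e \<in> set ys \<Longrightarrow> snd e = - fst e" "e \<in> set ms \<Longrightarrow> - fst e < snd e \<and> snd e < 0"
    "e \<in> set zs \<Longrightarrow> snd e = 0" "e \<in> set bs \<Longrightarrow> 0 < snd e" for e
    unfolding as_def bs_def zs_def r3_def ms_def r2_def ys_def r1_def by auto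
  have pos: "0 < fst e" if "e \<in> set as \<or> e \<in> set zs \<or> e \<in> set ms \<or> e \<in> set ys \<or> e \<in> set bs" for e
    using that mem L(2) by blast
  have low1: "Z + ht (as @ ys @ ms) < 0"
  proof -
    obtain ps ss where "fs = ps @ ss" "Z + ht ps - 0 * (X + wd ps) \<le> snd v - 0 * fst v"
      using L(11)[OF v(1), of 0] by blast
    moreover have "ht (as @ ys @ ms) - 0 * wd (as @ ys @ ms) \<le> ht ps - 0 * wd ps"
    proof (rule split_minimizes[of fs _ "zs @ bs", OF _ \<open>fs = ps @ ss\<close>])
      show "e \<in> set (as @ ys @ ms) \<Longrightarrow> snd e \<le> 0 * fst e" for e using sg(1-3)[of e] pos[of e] by auto
      show "e \<in> set (zs @ bs) \<Longrightarrow> 0 * fst e \<le> snd e" for e using sg(4,5)[of e] by auto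
    qed (simp add: fs)
    ultimately show ?thesis using v by simp
  qed
  have low2: "Z + ht (as @ ys) + (X + wd (as @ ys)) - n < 0"
  proof -
    obtain ps ss where "fs = ps @ ss" "Z + ht ps - (-1) * (X + wd ps) \<le> snd w - (-1) * fst w"
      using L(11)[OF w(1), of "-1"] by blast
    moreover have "ht (as @ ys) - (-1) * wd (as @ ys) \<le> ht ps - (-1) * wd ps"
    proof (rule split_minimizes[of fs _ "ms @ zs @ bs", OF _ \<open>fs = ps @ ss\<close>])
      show "e \<in> set (as @ ys) \<Longrightarrow> snd e \<le> (-1) * fst e" for e using sg(1,2)[of e] by auto
      show "e \<in> set (ms @ zs @ bs) \<Longrightarrow> (-1) * fst e \<le> snd e" for e using sg(3-5)[of e] pos[of e] by auto
    qed (simp add: fs)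
    ultimately show ?thesis using w by simp
  qed
  \<comment> \<open>This shear makes the direction (1,-1) of the third side vertical, so that
    \<open>corner\<close> applies.\<close>
  define g where "g e = (1 * fst e + 1 * snd e, 0 * fst e + 1 * snd e)" for e :: "int \<times> int"
  have wg: "wd (map g xs) = wd xs + ht xs" "ht (map g xs) = ht xs" for xs
    using wd_map_lin[of 1 1 0 1 xs] ht_map_lin[of 1 1 0 1 xs] unfolding g_def by simp_all
  let ?x = "X + wd (as @ ys)" and ?y = "Z + ht (as @ ys)"
  have "rounds_origin \<alpha> \<beta> (?x + ?y - n) ?y (map g ms)" unfolding rounds_origin_def
  proof (intro conjI allI impI ballI)
    show "turning (map g ms)" by (rule turning_map[OF tu(5)]) (simp add: det2_def g_def algebra_simps)
    fix e assume "e \<in> set (map g ms)"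
    then show "0 < fst e" "snd e < 0" using sg(3) by (force simp: g_def)+
  next
    fix ps ss assume "map g ms = ps @ ss"
    then obtain ps' ss' where p: "ms = ps' @ ss'" "ps = map g ps'" by (auto simp: map_eq_append_conv)
    then have "(X + wd ((as @ ys) @ ps'), Z + ht ((as @ ys) @ ps')) \<in> V"
      using L(4)[of "(as @ ys) @ ps'" "ss' @ zs @ bs"] fs by simp
    from ab(3)[OF this] show "0 < \<alpha> * real_of_int (?x + ?y - n + wd ps) + \<beta> * real_of_int (?y + ht ps)"
      unfolding p(2) wg by (simp add: algebra_simps)
  next
    show "?x + ?y - n < 0" using low2 by linarith
    show "?y + ht (map g ms) < 0" using low1 unfolding wg by simp
  qed (use ab in auto)
  moreover have "d = 0 \<or> d = 1 \<and> no_basis (map g ms)"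
  proof -
    have "no_basis (map g ms)" if nb: "no_basis fs"
      unfolding no_basis_def
    proof (intro ballI)
      fix e f assume "e \<in> set (map g ms)" "f \<in> set (map g ms)"
      then obtain e' f' where ef: "e = g e'" "f = g f'" "e' \<in> set fs" "f' \<in> set fs" using mem by auto
      have "det2 e f = det2 e' f'" unfolding ef g_def by (simp add: det2_def algebra_simps)
      then show "\<bar>det2 e f\<bar> \<noteq> 1" using nb ef unfolding no_basis_def by simp
    qed
    then show ?thesis using d by blast
  qed
  ultimately have "2 * int (length (map g ms)) + d \<le> (?x + ?y - n) + wd (map g ms) + ?y" by (rule corner)
  then have M: "2 * int (length ms) + d \<le> ?x + ?y - n + wd ms + ht ms + ?y" unfolding wg by simp
  have "2 \<le> 0 * fst e + (-1) * snd e" if "e \<in> set as" for e using sg(1)[OF that] pos[of e] that by auto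
  from sum_weight[of as, OF this] have A: "2 * int (length as) \<le> - ht as" by simp
  have "2 \<le> 1 * fst e + 1 * snd e" if "e \<in> set bs" for e using sg(5)[OF that] pos[of e] that by auto
  from sum_weight[of bs, OF this] have B: "2 * int (length bs) \<le> wd bs + ht bs" by simp
  have Zz: "2 * int (length zs) \<le> wd zs + z"
  proof (rule flat_weight[OF tu(7)])
    show "e \<in> set zs \<Longrightarrow> snd e = 0 * fst e" for e using sg(4)[of e] by simp
    show "e \<in> set zs \<Longrightarrow> 2 - fst e \<le> z" for e using sg(4)[of e] z mem by blast
  qed (rule z)
  have F: "2 * int (length ys) \<le> wd ys + z'"
  proof (rule flat_weight[OF tu(3)])
    show "e \<in> set ys \<Longrightarrow> snd e = (-1) * fst e" for e using sg(2)[of e] by simp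
    show "e \<in> set ys \<Longrightarrow> 2 - fst e \<le> z'" for e using sg(2)[of e] z' mem by blast
  qed (rule z')
  have "ht ys = - wd ys" using sg(2) by (induction ys) auto
  moreover have "ht zs = 0" using sg(4) by (induction zs) auto
  moreover have "length fs = length as + length ys + length ms + length zs + length bs"
    "wd fs = wd as + wd ys + wd ms + wd zs + wd bs" "ht fs = ht as + ht ys + ht ms + ht zs + ht bs"
    unfolding fs by simp_all
  ultimately show ?thesis using A F M Zz B by simp
qed

text \<open>The corners are \<open>(0, 0)\<close>, \<open>(n, 0)\<close> and \<open>(n, n)\<close>, each in unimodular coordinates whose axes
  run along the sides of the triangle that they span.\<close>

lemma theta_bounds:
  fixes n :: int
  assumes n: "3 \<le> n" and V: "free_config n V"
    and c1: "\<exists>\<alpha> \<beta>::real. 0 < \<alpha> \<and> 0 < \<beta> \<and> (\<forall>v\<in>V. 0 < \<alpha> * of_int (fst v) + \<beta> * of_int (snd v))"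
    and c2: "\<exists>\<alpha> \<beta>::real. 0 < \<alpha> \<and> 0 < \<beta> \<and> (\<forall>v\<in>V. 0 < \<alpha> * of_int (n - fst v) + \<beta> * of_int (snd v - fst v + n))"
    and c3: "\<exists>\<alpha> \<beta>::real. 0 < \<alpha> \<and> 0 < \<beta> \<and> (\<forall>v\<in>V. 0 < \<alpha> * of_int (fst v - snd v) + \<beta> * of_int (n - snd v))"
    and le: "\<exists>v\<in>V. fst v < 0" and ri: "\<exists>v\<in>V. n < fst v" and dn: "\<exists>v\<in>V. snd v < 0" and up: "\<exists>v\<in>V. n < snd v"
    and ul: "\<exists>v\<in>V. fst v < snd v" and lr: "\<exists>v\<in>V. snd v - fst v + n < 0"
  shows "vertex_bounds n V"
proof -
  have fin: "finite V" and conv: "convex_position V" using V unfolding free_config_def by auto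
  obtain v0 v1 where v01: "v0 \<in> V" "fst v0 < 0" "v1 \<in> V" "n < fst v1" using le ri by blast
  then have "fst v0 < fst v1" using n by simp
  then obtain X Y es Z fs where ch: "lower_chain V X Y es" "lower_chain (refl_y n ` V) X Z fs"
    and wdf: "wd fs = wd es" and YZ: "Y + Z \<le> n" "Y + ht es + (Z + ht fs) \<le> n"
    and card: "int (card V) \<le> int (length es) + int (length fs) +
       (if Y + Z = n then 0 else 1) + (if Y + ht es + (Z + ht fs) = n then 0 else 1)"
    using hull_chains[OF fin conv v01(1,3), of n] by metis
  note L = lower_chainD[OF ch(1)] and U = lower_chainD[OF ch(2)]
  have X: "X < 0" "n < X + wd es" using L(7)[OF v01(1)] L(8)[OF v01(3)] v01 by linarith+
  obtain vd vu vl vr where vd: "vd \<in> V" "snd vd < 0" and vu: "vu \<in> V" "n < snd vu"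
    and vl: "vl \<in> V" "fst vl < snd vl" and vr: "vr \<in> V" "snd vr - fst vr + n < 0" using dn up ul lr by blast
  have E: "2 * int (length es) + 2 * d \<le> 2 * n + Y + (Y + ht es) - (X + wd es) + z + z'"
    if d: "d = 0 \<or> d = 1 \<and> no_basis es" and z: "0 \<le> z" "\<And>e. e \<in> set es \<Longrightarrow> snd e = 0 \<Longrightarrow> 2 - fst e \<le> z"
      "0 \<le> z'" "\<And>e. e \<in> set es \<Longrightarrow> snd e = fst e \<Longrightarrow> 2 - fst e \<le> z'" for d z z'
  proof -
    obtain \<alpha> \<beta> \<gamma> \<delta> :: real where ab: "0 < \<alpha>" "0 < \<beta>" "0 < \<gamma>" "0 < \<delta>"
      "\<And>v. v \<in> V \<Longrightarrow> 0 < \<alpha> * of_int (fst v) + \<beta> * of_int (snd v)"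
      "\<And>v. v \<in> V \<Longrightarrow> 0 < \<gamma> * of_int (n - fst v) + \<delta> * of_int (snd v - fst v + n)"
      using c1 c2 by blast
    show ?thesis by (rule theta_lower[OF ch(1) X vd vr ab(1,2,5) ab(3,4,6) d z])
  qed
  have F: "2 * int (length fs) + d \<le> (X + wd fs) - n + Z + (Z + ht fs) + z + z'"
    if d: "d = 0 \<or> d = 1 \<and> no_basis fs" and z: "0 \<le> z" "\<And>e. e \<in> set fs \<Longrightarrow> snd e = 0 \<Longrightarrow> 2 - fst e \<le> z"
      "0 \<le> z'" "\<And>e. e \<in> set fs \<Longrightarrow> snd e = - fst e \<Longrightarrow> 2 - fst e \<le> z'" for d z z'
  proof -
    obtain \<alpha> \<beta> :: real where ab: "0 < \<alpha>" "0 < \<beta>"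
      "\<forall>v\<in>V. 0 < \<alpha> * of_int (fst v - snd v) + \<beta> * of_int (n - snd v)" using c3 by blast
    then have ab3: "0 < \<alpha> * of_int (fst v + snd v - n) + \<beta> * of_int (snd v)" if "v \<in> refl_y n ` V" for v
      using that by (auto simp: algebra_simps)
    have r: "refl_y n vu \<in> refl_y n ` V" "snd (refl_y n vu) < 0"
      "refl_y n vl \<in> refl_y n ` V" "fst (refl_y n vl) + snd (refl_y n vl) < n" using vu vl by auto
    show ?thesis by (rule theta_upper[OF ch(2) r ab(1,2) ab3 d z])
  qed
  have one: "2 - fst e \<le> 1" if "e \<in> set es \<or> e \<in> set fs" for e using that L(2)[of e] U(2)[of e] by auto
  show ?thesis unfolding vertex_bounds_def
  proof (intro conjI allI impI)
    show "int (card V) \<le> 2 * n + 2"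
      using E[of 0 1 1] F[of 0 1 1] one card YZ wdf n by (auto split: if_splits)
  next
    fix m \<Lambda> assume lat: "sublattice m \<Lambda>" "V \<subseteq> \<Lambda>"
    have mirr: "sublattice m (refl_y n ` \<Lambda>)" if "m dvd n" by (rule mirror_sublattice[OF lat(1) that])
    have nb: "no_basis es \<and> no_basis fs" if "1 < m" "m dvd n"
    proof
      show "no_basis es" by (rule lattice_no_basis[OF lat(1) _ that(1)]) (use chain_edges_lattice[OF ch(1) lat] in blast)
      show "no_basis fs"
        by (rule lattice_no_basis[OF mirr[OF that(2)] _ that(1)])
          (use chain_edges_lattice[OF ch(2) mirr[OF that(2)]] lat(2) in blast)
    qed
    show "int (card V) \<le> 2 * n" if "n = 2 * m"
    proof -
      have "no_basis es \<and> no_basis fs" by (rule nb) (use that n in auto)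
      then show ?thesis using E[of 1 1 1] F[of 1 1 1] one card YZ wdf n by (auto split: if_splits)
    qed
    show "int (card V) \<le> 2 * n - 2" if nm: "n = m"
    proof -
      have m: "1 < m" "m dvd n" using nm n by auto
      define h :: int where "h = (if (1, 0) \<in> \<Lambda> then 1 else 0)"
      define g :: int where "g = (if (1, 1) \<in> \<Lambda> then 1 else 0)"
      define w :: int where "w = (if (0, 1) \<in> \<Lambda> then 1 else 0)"
      have nod: "\<not> (e \<in> \<Lambda> \<and> f \<in> \<Lambda>)" if "\<bar>det2 e f\<bar> = 1" for e f
        using lattice_no_basis[OF lat(1), of "[e, f]"] m(1) that unfolding no_basis_def by auto
      \<comment> \<open>Any two of (1,0), (1,1), (0,1) form a basis, so at most one of the three
        side directions admits an edge of lattice length one.\<close>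
      have hgw: "h + g + w \<le> 1" "0 \<le> h" "0 \<le> g" "0 \<le> w"
        using nod[of "(1,0)" "(1,1)"] nod[of "(1,0)" "(0,1)"] nod[of "(1,1)" "(0,1)"]
        unfolding h_def g_def w_def by (auto simp: det2_def)
      have inL: "e \<in> \<Lambda>" if "e \<in> set es" for e using chain_edges_lattice[OF ch(1) lat that] .
      have inL': "(fst e, - snd e) \<in> \<Lambda>" if e: "e \<in> set fs" for e
      proof -
        obtain ps ss where fs: "fs = ps @ e # ss" using e by (meson split_list)
        have "(X + wd ps, n - (Z + ht ps)) \<in> \<Lambda>" "(X + wd (ps @ [e]), n - (Z + ht (ps @ [e]))) \<in> \<Lambda>"
          using refl_y_mem[OF U(4)[of ps "e # ss"]] refl_y_mem[OF U(4)[of "ps @ [e]" ss]] fs lat(2) by auto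
        from sublatticeD(1)[OF lat(1) this(2) this(1)] show ?thesis by simp
      qed
      have z: "2 - fst e \<le> h" if "e \<in> set es \<and> snd e = 0 \<or> e \<in> set fs \<and> snd e = 0" for e
        using that L(2)[of e] U(2)[of e] inL[of e] inL'[of e] unfolding h_def
        by (cases e; cases "fst e = 1") auto
      have z': "2 - fst e \<le> g" if "e \<in> set es \<and> snd e = fst e \<or> e \<in> set fs \<and> snd e = - fst e" for e
        using that L(2)[of e] U(2)[of e] inL[of e] inL'[of e] unfolding g_def
        by (cases e; cases "fst e = 1") auto
      have flat: "y' - y = 1 \<Longrightarrow> w = 1" if "(x, y) \<in> V" "(x, y') \<in> V" for x y y'
        using sublatticeD(1)[OF lat(1), of "(x, y')" "(x, y)"] that lat(2) unfolding w_def by auto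
      have f1: "n - Z - Y = 1 \<Longrightarrow> w = 1" by (rule flat[OF L(5) refl_y_mem[OF U(5)]])
      have f2: "n - (Z + ht fs) - (Y + ht es) = 1 \<Longrightarrow> w = 1"
        by (rule flat[OF L(6) refl_y_mem[OF U(6), unfolded wdf]])
      have "no_basis es \<and> no_basis fs" by (rule nb) (use m in auto)
      then have EF: "2 * int (length es) + 2 * 1 \<le> 2 * n + Y + (Y + ht es) - (X + wd es) + h + g"
        "2 * int (length fs) + 1 \<le> (X + wd fs) - n + Z + (Z + ht fs) + h + g"
        using E[of 1 h g] F[of 1 h g] hgw z z' by auto
      define tl :: int where "tl = (if Y + Z = n then 0 else 1)"
      define tr :: int where "tr = (if Y + ht es + (Z + ht fs) = n then 0 else 1)"
      have "2 * tl + (Y + Z) \<le> n + w" "2 * tr + (Y + ht es + (Z + ht fs)) \<le> n + w"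
        using f1 f2 YZ hgw(4) unfolding tl_def tr_def by (smt (verit))+
      moreover have "int (card V) \<le> int (length es) + int (length fs) + tl + tr"
        using card unfolding tl_def tr_def by simp
      ultimately show ?thesis using EF wdf hgw n by linarith
    qed
  qed
qed

section \<open>Large triangles\<close>

definition in_triangle :: "int \<Rightarrow> (int \<times> int) set \<Rightarrow> bool" where
  "in_triangle n V \<longleftrightarrow> (\<forall>v\<in>V. 0 \<le> fst v \<and> 0 \<le> snd v \<and> fst v + snd v \<le> 2 * n)"

lemma exception_weight:
  fixes k a b :: int
  assumes "turning es" "finite E" "\<And>e. e \<in> E \<Longrightarrow> 0 \<le> c e"
    "\<And>e. e \<in> set es \<Longrightarrow> e \<in> E \<Longrightarrow> k - c e \<le> a * fst e + b * snd e"
    "\<And>e. e \<in> set es \<Longrightarrow> e \<notin> E \<Longrightarrow> k \<le> a * fst e + b * snd e"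
  shows "k * int (length es) \<le> a * wd es + b * ht es + sum c E"
proof -
  have "- sum c E \<le> sum_list (map (\<lambda>e. a * fst e + b * snd e + (- k)) es)"
    by (rule sum_list_exceptions[OF turning_distinct[OF assms(1)] assms(2,3)]) (use assms(4,5) in force)+
  then show ?thesis unfolding sum_list_lin by simp
qed

lemma exception_weight1:
  fixes k a b c :: int
  assumes "turning es" "0 \<le> c" "x \<in> set es \<Longrightarrow> k - c \<le> a * fst x + b * snd x"
    "\<And>e. e \<in> set es \<Longrightarrow> e \<noteq> x \<Longrightarrow> k \<le> a * fst e + b * snd e"
  shows "k * int (length es) \<le> a * wd es + b * ht es + (if x \<in> set es then c else 0)"
proof (cases "x \<in> set es")
  case True
  then show ?thesis using exception_weight[of es "{x}" "\<lambda>_. c" k a b] assms by auto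
next
  case False
  then have "\<And>e. e \<in> set es \<Longrightarrow> k \<le> a * fst e + b * snd e" using assms(4) by metis
  then show ?thesis using exception_weight[of es "{}" "\<lambda>_. 0" k a b] assms(1) False by simp
qed

text \<open>Made for the weight width plus depth with k = 4, where x = (1,-1) falls short by 2 and
  the edges (1,-2) and (2,-1) by 1 each.\<close>

lemma exception_weight3:
  fixes k a b :: int
  assumes tu: "turning es" and ne: "x \<noteq> y" "x \<noteq> z" "y \<noteq> z"
    and w: "k - 2 \<le> a * fst x + b * snd x" "k - 1 \<le> a * fst y + b * snd y" "k - 1 \<le> a * fst z + b * snd z"
    and rest: "\<forall>e\<in>set es. e \<noteq> x \<longrightarrow> e \<noteq> y \<longrightarrow> e \<noteq> z \<longrightarrow> k \<le> a * fst e + b * snd e"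
  shows "k * int (length es) \<le> a * wd es + b * ht es + 4"
    "x \<in> set es \<Longrightarrow> y \<notin> set es \<and> z \<notin> set es \<Longrightarrow> k * int (length es) \<le> a * wd es + b * ht es + 2"
    "x \<notin> set es \<Longrightarrow> k * int (length es) \<le> a * wd es + b * ht es + 2"
proof -
  define c where "c e = (if e = x then 2 else 1 :: int)" for e
  have E: "k * int (length es) \<le> a * wd es + b * ht es + sum c E"
    if "E \<subseteq> {x, y, z}" "\<And>e. e \<in> set es \<Longrightarrow> e \<in> {x, y, z} \<Longrightarrow> e \<in> E" for E
  proof (rule exception_weight[OF tu])
    show "finite E" using that(1) finite_subset by blast
    show "0 \<le> c e" for e unfolding c_def by simp
    show "k - c e \<le> a * fst e + b * snd e" if "e \<in> E" for e
    proof -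
      have "e = x \<or> e = y \<or> e = z" using that \<open>E \<subseteq> {x, y, z}\<close> by blast
      then show ?thesis using w ne unfolding c_def by (elim disjE) auto
    qed
    show "k \<le> a * fst e + b * snd e" if "e \<in> set es" "e \<notin> E" for e
      using rest that \<open>\<And>e. e \<in> set es \<Longrightarrow> e \<in> {x, y, z} \<Longrightarrow> e \<in> E\<close> by blast
  qed
  have c: "c x = 2" "c y = 1" "c z = 1" using ne unfolding c_def by auto
  show "k * int (length es) \<le> a * wd es + b * ht es + 4" using E[of "{x, y, z}"] c ne by simp
  show "k * int (length es) \<le> a * wd es + b * ht es + 2" if "x \<in> set es" "y \<notin> set es \<and> z \<notin> set es"
  proof -
    have "k * int (length es) \<le> a * wd es + b * ht es + sum c {x}" by (rule E) (use that in blast)+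
    then show ?thesis using c by simp
  qed
  show "k * int (length es) \<le> a * wd es + b * ht es + 2" if "x \<notin> set es"
  proof -
    have "k * int (length es) \<le> a * wd es + b * ht es + sum c {y, z}" by (rule E) (use that in blast)+
    then show ?thesis using c ne by simp
  qed
qed

text \<open>Width plus depth is 2 only for (1,-1) and 3 only for (1,-2) and (2,-1). As (1,-1) forms
  a basis with either of the other two, the total deficit from 4 drops from 4 to 2 under
  \<open>no_basis\<close>.\<close>

lemma arc_weights:
  assumes tu: "turning es" and sg: "\<And>e. e \<in> set es \<Longrightarrow> 0 < fst e \<and> snd e < 0"
  shows "3 * int (length es) \<le> wd es - ht es + 1" "4 * int (length es) \<le> wd es - ht es + 4"
    "no_basis es \<Longrightarrow> 4 * int (length es) \<le> wd es - ht es + 2"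
    "int (length es) \<le> wd es" "int (length es) \<le> - ht es"
proof -
  have big: "\<forall>e\<in>set es. e \<noteq> (1,-1) \<longrightarrow> e \<noteq> (1,-2) \<longrightarrow> e \<noteq> (2,-1) \<longrightarrow> 4 \<le> 1 * fst e + (-1) * snd e"
  proof (intro ballI impI)
    fix e assume e: "e \<in> set es" "e \<noteq> (1,-1)" "e \<noteq> (1,-2)" "e \<noteq> (2,-1)"
    show "4 \<le> 1 * fst e + (-1) * snd e"
      using sg[OF e(1)] e(2-4) by (cases e) (simp, smt (verit))
  qed
  have W: "4 * int (length es) \<le> 1 * wd es + (-1) * ht es + 4"
    "(1,-1) \<in> set es \<Longrightarrow> (1,-2) \<notin> set es \<and> (2,-1) \<notin> set es \<Longrightarrow> 4 * int (length es) \<le> 1 * wd es + (-1) * ht es + 2"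
    "(1,-1) \<notin> set es \<Longrightarrow> 4 * int (length es) \<le> 1 * wd es + (-1) * ht es + 2"
    by (rule exception_weight3[OF tu _ _ _ _ _ _ big]; simp)+
  have three: "3 \<le> 1 * fst e + (-1) * snd e" if "e \<in> set es" "e \<noteq> (1,-1)" for e
    using sg[OF that(1)] that(2) by (cases e) (simp, smt (verit))
  have "3 * int (length es) \<le> 1 * wd es + (-1) * ht es + (if (1,-1) \<in> set es then 1 else 0)"
    by (rule exception_weight1[OF tu _ _ three]) auto
  then show "3 * int (length es) \<le> wd es - ht es + 1" by (auto split: if_splits)
  show "4 * int (length es) \<le> wd es - ht es + 4" using W(1) by simp
  show "4 * int (length es) \<le> wd es - ht es + 2" if "no_basis es"
  proof (cases "(1,-1) \<in> set es")
    case True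
    then have "(1,-2) \<notin> set es" "(2,-1) \<notin> set es"
      using that unfolding no_basis_def by (force simp: det2_def)+
    then show ?thesis using W(2)[OF True] by simp
  next
    case False
    then show ?thesis using W(3) by simp
  qed
  show "int (length es) \<le> wd es" "int (length es) \<le> - ht es"
    using sum_weight[of es 1 1 0] sum_weight[of es 1 0 "-1"] sg by force+
qed

text \<open>After the reflection the side x + y = 2n has slope one. This shear makes it horizontal,
  so that the arc at (0, 2n) becomes a falling chain like the one at the origin.\<close>

definition shear :: "(int \<times> int) list \<Rightarrow> (int \<times> int) list" where
  "shear es = map (\<lambda>e. (fst e, snd e - fst e)) es"

lemma shear_simps [simp]: "wd (shear es) = wd es" "ht (shear es) = ht es - wd es" "length (shear es) = length es"
  unfolding shear_def by (induction es) auto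

lemma turning_shear: "turning es \<Longrightarrow> turning (shear es)"
  unfolding shear_def by (rule turning_map) (auto simp: det2_def algebra_simps)

lemma no_basis_shear: "no_basis es \<Longrightarrow> no_basis (shear es)"
  unfolding no_basis_def shear_def by (auto simp: det2_def algebra_simps)

text \<open>The boundary of a polygon in the triangle splits into three arcs, between the sides
  \<open>x = 0\<close>, \<open>y = 0\<close>, \<open>x + y = 2n\<close>, and the flat edges parallel to these sides. \<open>U\<close>, \<open>V\<close>
  are the extents of the arcs in the coordinates adapted to the vertex of the triangle.\<close>

lemma triangle_arcs:
  fixes n :: int
  assumes V: "free_config n V" and tri: "in_triangle n V"
    and uv: "u \<in> V" "v \<in> V" "fst u < fst v"
  obtains X Y S U1 V1 U2 V2 U3 V3 f1 f2 f3 e1 e2 e3 c1 c2 c3 :: int where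
    "0 \<le> X" "0 \<le> Y" "S \<le> 2 * n"
    "(X + U1, Y) \<in> V" "(X + U1 + f1, Y) \<in> V" "(X, Y + V1) \<in> V" "(X, Y + V1 + f2) \<in> V"
    "(X + U3, S - X - U3) \<in> V" "(X + U3 + f3, S - X - U3 - f3) \<in> V"
    "U1 + f1 + V2 = S - X - Y" "V1 + f2 + V3 = S - X - Y" "U2 + f3 + U3 = S - X - Y"
    "int (card V) \<le> e1 + e2 + e3 + c1 + c2 + c3"
    "c1 \<le> 1" "c1 \<le> f1" "c2 \<le> 1" "c2 \<le> f2" "c3 \<le> 1" "c3 \<le> f3"
    "e1 \<le> U1" "e1 \<le> V1" "e2 \<le> U2" "e2 \<le> V2" "e3 \<le> U3" "e3 \<le> V3"
    "3 * e1 \<le> U1 + V1 + 1" "3 * e2 \<le> U2 + V2 + 1" "3 * e3 \<le> U3 + V3 + 1"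
    "4 * e1 \<le> U1 + V1 + 4" "4 * e2 \<le> U2 + V2 + 4" "4 * e3 \<le> U3 + V3 + 4"
    "\<And>m \<Lambda>. sublattice m \<Lambda> \<Longrightarrow> V \<subseteq> \<Lambda> \<Longrightarrow> 1 < m \<Longrightarrow> m dvd n \<Longrightarrow>
       4 * e1 \<le> U1 + V1 + 2 \<and> 4 * e2 \<le> U2 + V2 + 2 \<and> 4 * e3 \<le> U3 + V3 + 2"
proof -
  have fin: "finite V" and conv: "convex_position V" using V unfolding free_config_def by auto
  obtain X Y es Z fs where ch: "lower_chain V X Y es" "lower_chain (refl_y (2 * n) ` V) X Z fs"
    and wdf: "wd fs = wd es" and YZ: "Y + Z \<le> 2 * n" "Y + ht es + (Z + ht fs) \<le> 2 * n"
    and card: "int (card V) \<le> int (length es) + int (length fs) +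
       (if Y + Z = 2 * n then 0 else 1) + (if Y + ht es + (Z + ht fs) = 2 * n then 0 else 1)"
    using hull_chains[OF fin conv uv, of "2 * n"] by metis
  note L = lower_chainD[OF ch(1)] and U = lower_chainD[OF ch(2)]
  \<comment> \<open>The lower chain consists of the arc at the origin, the bottom edge and the first
    part of the arc at (2n, 0); the reflected upper chain consists of the arc at (0, 2n), the edge
    along x + y = 2n and the last part of the arc at (2n, 0). A vertical side on the right belongs
    to this arc, between \<open>ps\<close> and \<open>bs\<close>.\<close>
  define as where "as = filter (\<lambda>e. snd e < 0 * fst e) es"
  define r1 where "r1 = filter (\<lambda>e. 0 * fst e \<le> snd e) es"
  define zs where "zs = filter (\<lambda>e. snd e \<le> 0 * fst e) r1"
  define ps where "ps = filter (\<lambda>e. 0 * fst e < snd e) r1"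
  define ms where "ms = filter (\<lambda>e. snd e < 1 * fst e) fs"
  define r2 where "r2 = filter (\<lambda>e. 1 * fst e \<le> snd e) fs"
  define ys where "ys = filter (\<lambda>e. snd e \<le> 1 * fst e) r2"
  define bs where "bs = filter (\<lambda>e. 1 * fst e < snd e) r2"
  have mem: "e \<in> set as \<or> e \<in> set r1 \<or> e \<in> set zs \<or> e \<in> set ps \<Longrightarrow> e \<in> set es"
    "e \<in> set ms \<or> e \<in> set r2 \<or> e \<in> set ys \<or> e \<in> set bs \<Longrightarrow> e \<in> set fs" for e
    unfolding as_def r1_def zs_def ps_def ms_def r2_def ys_def bs_def by auto
  have tu: "turning as" "turning r1" "turning zs" "turning ps" "turning ms" "turning r2" "turning ys" "turning bs"
    using L(1) U(1) unfolding as_def r1_def zs_def ps_def ms_def r2_def ys_def bs_def by (auto intro!: turning_filter)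
  have s1: "es = as @ r1" unfolding as_def r1_def by (rule slope_split_less[OF L(1,2)])
  have s2: "r1 = zs @ ps" unfolding zs_def ps_def by (rule slope_split_le[OF tu(2)]) (use mem L(2) in blast)
  have s3: "fs = ms @ r2" unfolding ms_def r2_def by (rule slope_split_less[OF U(1,2)])
  have s4: "r2 = ys @ bs" unfolding ys_def bs_def by (rule slope_split_le[OF tu(6)]) (use mem U(2) in blast)
  have es: "es = as @ zs @ ps" unfolding s1 s2 by simp
  have fs: "fs = ms @ ys @ bs" unfolding s3 s4 by simp
  have sg: "e \<in> set as \<Longrightarrow> 0 < fst e \<and> snd e < 0" "e \<in> set zs \<Longrightarrow> 0 < fst e \<and> snd e = 0"
    "e \<in> set ps \<Longrightarrow> 0 < fst e \<and> 0 < snd e" "e \<in> set ms \<Longrightarrow> 0 < fst e \<and> snd e < fst e"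
    "e \<in> set ys \<Longrightarrow> 0 < fst e \<and> snd e = fst e" "e \<in> set bs \<Longrightarrow> 0 < fst e \<and> fst e < snd e" for e
    using L(2)[of e] U(2)[of e]
    unfolding as_def r1_def zs_def ps_def ms_def r2_def ys_def bs_def by auto
  have hz: "ht zs = 0" "ht ys = wd ys"
  proof -
    show "ht zs = 0" using sg(2) by (induction zs) auto
    show "ht ys = wd ys" using sg(5) by (induction ys) auto
  qed
  have flat: "int (length zs) \<le> 1" "int (length zs) \<le> wd zs" "int (length ys) \<le> 1" "int (length ys) \<le> wd ys"
    using flat_le_1[OF tu(3)] flat_le_1[OF tu(7)] sg(2,5) wd_ge_length[of zs] wd_ge_length[of ys]
    by (auto simp: det2_def)
  define tl :: int where "tl = (if Y + Z = 2 * n then 0 else 1)"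
  define tr :: int where "tr = (if Y + ht es + (Z + ht fs) = 2 * n then 0 else 1)"
  define la where "la = 2 * n - Z - Y"
  define rh where "rh = 2 * n - (Z + ht fs) - (Y + ht es)"
  have t: "tl \<le> 1" "tl \<le> la" "0 \<le> tr" "tr \<le> 1" "tr \<le> rh" "rh = 0 \<Longrightarrow> tr = 0"
    using YZ unfolding tl_def tr_def la_def rh_def by auto
  have card': "int (card V) \<le> int (length as) + (int (length ps) + tr + int (length bs)) + int (length ms)
      + int (length zs) + tl + int (length ys)"
    using card es fs unfolding tl_def tr_def by simp
  \<comment> \<open>In the coordinates of (2n, 0) an edge of \<open>ps\<close> weighs
    \<open>fst e + 2 * snd e\<close>, an edge of \<open>bs\<close> weighs
    \<open>2 * snd e - fst e\<close>, and the vertical side weighs \<open>2 * rh\<close>. So (1,1)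
    and (1,2) have weight 3, and a vertical side of length one takes the role of (1,-1).\<close>
  have pW: "3 * int (length ps) \<le> wd ps + 2 * ht ps"
    "4 * int (length ps) \<le> wd ps + 2 * ht ps + (if (1,1) \<in> set ps then 1 else 0)"
  proof -
    show "3 * int (length ps) \<le> wd ps + 2 * ht ps"
      using sum_weight[of ps 3 1 2] sg(3) by force
    have "4 \<le> 1 * fst e + 2 * snd e" if "e \<in> set ps" "e \<noteq> (1,1)" for e
      using sg(3)[OF that(1)] that(2) by (cases e) (simp, smt (verit))
    then show "4 * int (length ps) \<le> wd ps + 2 * ht ps + (if (1,1) \<in> set ps then 1 else 0)"
      using exception_weight1[of ps 1 "(1,1)" 4 1 2, OF tu(4)] by simp
  qed
  have bW: "3 * int (length bs) \<le> 2 * ht bs - wd bs"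
    "4 * int (length bs) \<le> 2 * ht bs - wd bs + (if (1,2) \<in> set bs then 1 else 0)"
  proof -
    show "3 * int (length bs) \<le> 2 * ht bs - wd bs"
      using sum_weight[of bs 3 "-1" 2] sg(6) by force
    have "4 \<le> (-1) * fst e + 2 * snd e" if "e \<in> set bs" "e \<noteq> (1,2)" for e
      using sg(6)[OF that(1)] that(2) by (cases e) (simp, smt (verit))
    then show "4 * int (length bs) \<le> 2 * ht bs - wd bs + (if (1,2) \<in> set bs then 1 else 0)"
      using exception_weight1[of bs 1 "(1,2)" 4 "-1" 2, OF tu(8)] by simp
  qed
  have l2: "int (length ps) \<le> ht ps" "int (length ps) \<le> wd ps + ht ps" "int (length bs) \<le> ht bs"
    "int (length bs) \<le> ht bs - wd bs"
    using sum_weight[of ps 1 0 1] sum_weight[of ps 1 1 1] sum_weight[of bs 1 0 1]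
      sum_weight[of bs 1 "-1" 1] sg(3,6) by force+
  note A = arc_weights[OF tu(1) sg(1)]
  have sgm: "0 < fst e \<and> snd e < 0" if "e \<in> set (shear ms)" for e
    using that sg(4) unfolding shear_def by auto
  note M = arc_weights[OF turning_shear[OF tu(5)] sgm, simplified]
  have pts: "(X + wd as, Y + ht as) \<in> V" "(X + wd as + wd zs, Y + ht as) \<in> V" "(X, Y) \<in> V" "(X, 2 * n - Z) \<in> V"
    "(X + wd ms, 2 * n - (Z + ht ms)) \<in> V" "(X + wd ms + wd ys, 2 * n - (Z + ht ms + wd ys)) \<in> V"
    using L(4)[of as r1] L(4)[of "as @ zs" ps] L(5) refl_y_mem[OF U(5)] refl_y_mem[OF U(4)[of ms r2]]
      refl_y_mem[OF U(4)[of "ms @ ys" bs]] s1 s3 es fs hz by (simp_all add: add.assoc)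
  define S where "S = X + wd ms + (2 * n - (Z + ht ms))"
  have nn: "0 \<le> X" "0 \<le> Y + ht as" "S \<le> 2 * n"
    using tri pts(1,3,5) unfolding in_triangle_def S_def by force+
  have eqs: "wd as + wd zs + (wd ps + ht ps + rh + ht bs - wd bs) = S - X - (Y + ht as)"
    "- ht as + la + (wd ms - ht ms) = S - X - (Y + ht as)"
    "(ht ps + rh + ht bs) + wd ys + wd ms = S - X - (Y + ht as)"
    using wdf hz unfolding es fs rh_def la_def S_def by simp_all
  show thesis
  proof (rule that[of X "Y + ht as" S "wd as" "wd zs" "- ht as" la "wd ms" "wd ys"
        "wd ps + ht ps + rh + ht bs - wd bs" "wd ms - ht ms" "ht ps + rh + ht bs" "int (length as)"
        "int (length ps) + tr + int (length bs)" "int (length ms)" "int (length zs)" tl "int (length ys)"])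
    show "(X + wd as, Y + ht as) \<in> V" "(X + wd as + wd zs, Y + ht as) \<in> V" by (fact pts)+
    show "(X, Y + ht as + - ht as) \<in> V" using pts(3) by simp
    show "(X, Y + ht as + - ht as + la) \<in> V" using pts(4) unfolding la_def by simp
    have e5: "S - X - wd ms = 2 * n - (Z + ht ms)" unfolding S_def by simp
    show "(X + wd ms, S - X - wd ms) \<in> V" unfolding e5 by (fact pts)
    show "(X + wd ms + wd ys, S - X - wd ms - wd ys) \<in> V" using pts(6) unfolding e5 by (simp add: algebra_simps)
    show "int (card V) \<le> int (length as) + (int (length ps) + tr + int (length bs)) + int (length ms) + int (length zs) + tl + int (length ys)"
      by (fact card')
    show "3 * (int (length ps) + tr + int (length bs)) \<le> ht ps + rh + ht bs + (wd ps + ht ps + rh + ht bs - wd bs) + 1"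
      using pW(1) bW(1) t(2-5) by (smt (verit))
    show "4 * (int (length ps) + tr + int (length bs)) \<le> ht ps + rh + ht bs + (wd ps + ht ps + rh + ht bs - wd bs) + 4"
      using pW(2) bW(2) t by (auto split: if_splits)
    fix m \<Lambda> assume lat: "sublattice m \<Lambda>" "V \<subseteq> \<Lambda>" and m: "1 < m" "m dvd n"
    have mirr: "sublattice m (refl_y (2 * n) ` \<Lambda>)" by (rule mirror_sublattice[OF lat(1)]) (use m in simp)
    have nb: "no_basis es" "no_basis fs"
    proof -
      show "no_basis es" by (rule lattice_no_basis[OF lat(1) _ m(1)]) (use chain_edges_lattice[OF ch(1) lat] in blast)
      show "no_basis fs" by (rule lattice_no_basis[OF mirr _ m(1)]) (use chain_edges_lattice[OF ch(2) mirr] lat(2) in blast)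
    qed
    have nod: "\<not> (e \<in> \<Lambda> \<and> f \<in> \<Lambda>)" if "\<bar>det2 e f\<bar> = 1" for e f
      using lattice_no_basis[OF lat(1), of "[e, f]"] m(1) that unfolding no_basis_def by auto
    have vert: "(0, rh) \<in> \<Lambda>"
      using sublatticeD(1)[OF lat(1), of "(X + wd es, 2 * n - (Z + ht fs))" "(X + wd es, Y + ht es)"]
        refl_y_mem[OF U(6)] wdf L(6) lat(2) unfolding rh_def by auto
    \<comment> \<open>A right side of length one puts (0,1) into the lattice, and (0,1) forms a
      basis with (1,1) as well as with (1,-2), the reflection of (1,2).\<close>
    have p1: "rh \<noteq> 1" if "(1,1) \<in> set ps"
      using nod[of "(0,1)" "(1,1)"] vert chain_edges_lattice[OF ch(1) lat, of "(1,1)"] that mem(1)[of "(1,1)"]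
      by (auto simp: det2_def)
    have b1: "rh \<noteq> 1" if b: "(1,2) \<in> set bs"
    proof -
      have "(1,2) \<in> set fs" using b mem(2) by blast
      then obtain qs ss where q: "fs = qs @ (1,2) # ss" by (meson split_list)
      have "(X + wd qs, 2 * n - (Z + ht qs)) \<in> \<Lambda>" "(X + wd (qs @ [(1,2)]), 2 * n - (Z + ht (qs @ [(1,2)]))) \<in> \<Lambda>"
        using refl_y_mem[OF U(4)[of qs "(1,2) # ss"]] refl_y_mem[OF U(4)[of "qs @ [(1,2)]" ss]] q lat(2) by auto
      from sublatticeD(1)[OF lat(1) this(2) this(1)] have "(1,-2) \<in> \<Lambda>" by simp
      then show ?thesis using nod[of "(0,1)" "(1,-2)"] vert by (auto simp: det2_def)
    qed
    have "4 * (int (length ps) + tr + int (length bs)) \<le> ht ps + rh + ht bs + (wd ps + ht ps + rh + ht bs - wd bs) + 2"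
      using pW(2) bW(2) t p1 b1 by (cases "rh = 1"; cases "rh = 0") (auto split: if_splits)
    moreover have "no_basis as" "no_basis ms"
      using nb no_basis_subset[of es as] no_basis_subset[of fs ms] mem by blast+
    ultimately show "4 * int (length as) \<le> wd as + - ht as + 2 \<and>
        4 * (int (length ps) + tr + int (length bs)) \<le> ht ps + rh + ht bs + (wd ps + ht ps + rh + ht bs - wd bs) + 2 \<and>
        4 * int (length ms) \<le> wd ms + (wd ms - ht ms) + 2"
      using A(3) M(3) no_basis_shear by simp
  qed (use A M l2 t flat nn eqs in \<open>simp_all\<close>)
qed

text \<open>The case that the weights leave open: each side of the triangle carries an edge of
  lattice length one. Neither end of it is the midpoint of the side, so it lies on one side of the
  midpoint; in each of the eight distributions the arcs are too short for 2n edges.\<close>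

lemma triangle_arith:
  fixes n U1 U2 U3 V1 V2 V3 e1 e2 e3 :: int
  assumes "n = 3 \<or> n = 4" "U1 + V2 = 2 * n - 1" "V1 + V3 = 2 * n - 1" "U2 + U3 = 2 * n - 1"
    "e1 \<le> U1" "e1 \<le> V1" "e2 \<le> U2" "e2 \<le> V2" "e3 \<le> U3" "e3 \<le> V3"
    "3 * e1 \<le> U1 + V1 + 1" "3 * e2 \<le> U2 + V2 + 1" "3 * e3 \<le> U3 + V3 + 1"
    "U1 \<noteq> n" "U1 \<noteq> n - 1" "V1 \<noteq> n" "V1 \<noteq> n - 1" "U3 \<noteq> n" "U3 \<noteq> n - 1"
  shows "e1 + e2 + e3 < 2 * n"
proof -
  have a: "U1 \<le> n - 2 \<or> n + 1 \<le> U1" "V1 \<le> n - 2 \<or> n + 1 \<le> V1" "U3 \<le> n - 2 \<or> n + 1 \<le> U3"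
    using assms by linarith+
  have n: "n \<le> 4" "3 \<le> n" using assms(1) by auto
  note facts = n assms(2-13)
  from a(1) show ?thesis
  proof
    assume 1: "U1 \<le> n - 2"
    from a(2) show ?thesis
    proof
      assume 2: "V1 \<le> n - 2"
      from a(3) show ?thesis
        by (rule disjE) (use 1 2 facts in \<open>smt (verit)\<close>)+
    next
      assume 2: "n + 1 \<le> V1"
      from a(3) show ?thesis
        by (rule disjE) (use 1 2 facts in \<open>smt (verit)\<close>)+
    qed
  next
    assume 1: "n + 1 \<le> U1"
    from a(2) show ?thesis
    proof
      assume 2: "V1 \<le> n - 2"
      from a(3) show ?thesis
        by (rule disjE) (use 1 2 facts in \<open>smt (verit)\<close>)+
    next
      assume 2: "n + 1 \<le> V1"
      from a(3) show ?thesis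
        by (rule disjE) (use 1 2 facts in \<open>smt (verit)\<close>)+
    qed
  qed
qed

lemma single_column:
  assumes "free_config n V" "\<nexists>u v. u \<in> V \<and> v \<in> V \<and> fst u < fst v"
  shows "card V \<le> 2"
proof (cases "V = {}")
  case False
  then obtain v where v: "v \<in> V" by blast
  have "fst w = fst v" if "w \<in> V" for w using assms(2) v that by (meson linorder_cases)
  then have "V = col V (fst v)" by (auto simp: col_def)
  then show ?thesis using col_le_2[of V "fst v"] assms(1) unfolding free_config_def by simp
qed simp

text \<open>Weight 3 gives the bound unless the polygon touches every side of the triangle in an
  edge of lattice length one and has 2n edges in the arcs. Weight 4 then leaves only n = 3 and n =
  4, where the midpoints of the sides, points of \<open>n\<int>\<^sup>2\<close>, decide.\<close>

lemma triangle_general: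
  assumes n: "3 \<le> n" and V: "free_config n V" and tri: "in_triangle n V"
  shows "int (card V) \<le> 2 * n + 2"
proof (cases "\<exists>u v. u \<in> V \<and> v \<in> V \<and> fst u < fst v")
  case False
  then show ?thesis using single_column[OF V] n by simp
next
  case True
  then obtain u v where uv: "u \<in> V" "v \<in> V" "fst u < fst v" by blast
  show ?thesis
  proof (rule triangle_arcs[OF V tri uv], rule ccontr)
    fix X Y S U1 V1 U2 V2 U3 V3 f1 f2 f3 e1 e2 e3 c1 c2 c3 :: int
    assume pos: "0 \<le> X" "0 \<le> Y" "S \<le> 2 * n"
      and pts: "(X + U1, Y) \<in> V" "(X + U1 + f1, Y) \<in> V" "(X, Y + V1) \<in> V" "(X, Y + V1 + f2) \<in> V"
        "(X + U3, S - X - U3) \<in> V" "(X + U3 + f3, S - X - U3 - f3) \<in> V"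
      and eqs: "U1 + f1 + V2 = S - X - Y" "V1 + f2 + V3 = S - X - Y" "U2 + f3 + U3 = S - X - Y"
      and card: "int (card V) \<le> e1 + e2 + e3 + c1 + c2 + c3"
      and c: "c1 \<le> 1" "c1 \<le> f1" "c2 \<le> 1" "c2 \<le> f2" "c3 \<le> 1" "c3 \<le> f3"
      and e: "e1 \<le> U1" "e1 \<le> V1" "e2 \<le> U2" "e2 \<le> V2" "e3 \<le> U3" "e3 \<le> V3"
      and e3: "3 * e1 \<le> U1 + V1 + 1" "3 * e2 \<le> U2 + V2 + 1" "3 * e3 \<le> U3 + V3 + 1"
      and e4: "4 * e1 \<le> U1 + V1 + 4" "4 * e2 \<le> U2 + V2 + 4" "4 * e3 \<le> U3 + V3 + 4"
      and big: "\<not> int (card V) \<le> 2 * n + 2"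
    define D where "D = S - X - Y"
    have a: "3 * (e1 + e2 + e3) \<le> 3 * D - (f1 + f2 + f3) + 3" using eqs e3 unfolding D_def by (smt (verit))
    have b: "4 * (e1 + e2 + e3) \<le> 3 * D - (f1 + f2 + f3) + 12" using eqs e4 unfolding D_def by (smt (verit))
    have D2: "D \<le> 2 * n" using pos unfolding D_def by linarith
    have N: "2 * n + 3 \<le> e1 + e2 + e3 + c1 + c2 + c3" using card big by linarith
    have D: "D = 2 * n" using a N c D2 by (smt (verit))
    have f: "f1 = 1" "f2 = 1" "f3 = 1" using a N c D by (smt (verit))+
    have XYS: "X = 0" "Y = 0" "S = 2 * n" using D pos unfolding D_def by linarith+
    have e2n: "2 * n \<le> e1 + e2 + e3" using N c by linarith
    then have n4: "n = 3 \<or> n = 4" using b f D n by (smt (verit))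
    have avoid: "(n * p, n * q) \<notin> V" for p q by (rule free_not_multiple[OF V])
    have "U1 \<noteq> n" "U1 \<noteq> n - 1" "V1 \<noteq> n" "V1 \<noteq> n - 1" "U3 \<noteq> n" "U3 \<noteq> n - 1"
      using pts avoid[of 1 0] avoid[of 0 1] avoid[of 1 1] unfolding XYS f by auto
    then have "e1 + e2 + e3 < 2 * n"
      using triangle_arith[OF n4, of U1 V2 V1 V3 U2 U3 e1 e2 e3] eqs e e3 unfolding XYS f by (smt (verit))
    then show False using e2n by simp
  qed
qed

text \<open>Weight 4 with deficit 2 for each arc bounds four times the number of vertices by 6n +
  15, which suffices from n = 6 on.\<close>

lemma triangle_half_large:
  assumes n: "6 \<le> n" and V: "free_config n V" and tri: "in_triangle n V"
    and L: "sublattice m \<Lambda>" "V \<subseteq> \<Lambda>" and nm: "n = 2 * m"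
  shows "int (card V) \<le> 2 * n"
proof (cases "\<exists>u v. u \<in> V \<and> v \<in> V \<and> fst u < fst v")
  case False
  then show ?thesis using single_column[OF V] n by simp
next
  case True
  then obtain u v where uv: "u \<in> V" "v \<in> V" "fst u < fst v" by blast
  show ?thesis
  proof (rule triangle_arcs[OF V tri uv])
    fix X Y S U1 V1 U2 V2 U3 V3 f1 f2 f3 e1 e2 e3 c1 c2 c3 :: int
    assume pos: "0 \<le> X" "0 \<le> Y" "S \<le> 2 * n"
      and eqs: "U1 + f1 + V2 = S - X - Y" "V1 + f2 + V3 = S - X - Y" "U2 + f3 + U3 = S - X - Y"
      and card: "int (card V) \<le> e1 + e2 + e3 + c1 + c2 + c3"
      and c: "c1 \<le> 1" "c1 \<le> f1" "c2 \<le> 1" "c2 \<le> f2" "c3 \<le> 1" "c3 \<le> f3"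
      and lat: "\<And>m \<Lambda>. sublattice m \<Lambda> \<Longrightarrow> V \<subseteq> \<Lambda> \<Longrightarrow> 1 < m \<Longrightarrow> m dvd n \<Longrightarrow>
       4 * e1 \<le> U1 + V1 + 2 \<and> 4 * e2 \<le> U2 + V2 + 2 \<and> 4 * e3 \<le> U3 + V3 + 2"
    have "1 < m" "m dvd n" using n nm by auto
    then have e4: "4 * e1 \<le> U1 + V1 + 2" "4 * e2 \<le> U2 + V2 + 2" "4 * e3 \<le> U3 + V3 + 2" using lat[OF L] by blast+
    have b: "4 * (e1 + e2 + e3) \<le> 3 * (S - X - Y) - (f1 + f2 + f3) + 6" using eqs e4 by (smt (verit))
    have "4 * int (card V) \<le> 3 * (S - X - Y) + 15" using b card c by (smt (verit))
    then show ?thesis using pos n by (smt (verit))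
  qed
qed

lemma sublattice_scale:
  assumes "sublattice m \<Lambda>" "e \<in> \<Lambda>"
  shows "(k * fst e, k * snd e) \<in> \<Lambda>"
proof -
  have nn: "(int j * fst e, int j * snd e) \<in> \<Lambda>" for j
  proof (induction j)
    case 0
    then show ?case using sublatticeD(3)[OF assms(1), of 0 0] by simp
  next
    case (Suc j)
    have "(int j * fst e, int j * snd e) - (- e) \<in> \<Lambda>" using sublatticeD(1,4)[OF assms(1)] assms(2) Suc by blast
    moreover have "(int j * fst e, int j * snd e) - (- e) = (int (Suc j) * fst e, int (Suc j) * snd e)"
      by (simp add: prod_eq_iff algebra_simps)
    ultimately show ?case by simp
  qed
  show ?thesis
  proof (cases "0 \<le> k")
    case True
    then show ?thesis using nn[of "nat k"] by simp
  next
    case False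
    then have "- (int (nat (- k)) * fst e, int (nat (- k)) * snd e) \<in> \<Lambda>" using sublatticeD(4)[OF assms(1) nn] by blast
    then show ?thesis using False by simp
  qed
qed

lemma no_near:
  fixes A :: "int set"
  assumes "A \<subseteq> {0..k}" "\<And>x. x \<in> A \<Longrightarrow> x + 1 \<notin> A \<and> x + 2 \<notin> A" "0 \<le> k"
  shows "3 * int (card A) \<le> k + 3"
proof -
  have fin: "finite A" using assms(1) finite_subset by blast
  let ?B = "(\<lambda>x. x + 1) ` A" and ?C = "(\<lambda>x. x + 2) ` A"
  have "card (A \<union> (?B \<union> ?C)) = card A + card (?B \<union> ?C)"
    using assms(2) fin by (intro card_Un_disjoint) auto
  moreover have "card (?B \<union> ?C) = card ?B + card ?C"
  proof (rule card_Un_disjoint)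
    have "a + 1 \<noteq> b + 2" if "a \<in> A" "b \<in> A" for a b
    proof
      assume "a + 1 = b + 2"
      then have "a = b + 1" by simp
      then show False using assms(2) that by blast
    qed
    then show "?B \<inter> ?C = {}" by blast
  qed (use fin in auto)
  moreover have "card ?B = card A" "card ?C = card A" by (intro card_image inj_onI, simp)+
  moreover have "card (A \<union> (?B \<union> ?C)) \<le> card {0..k + 2}" using assms(1) by (intro card_mono) auto
  ultimately show ?thesis using assms(3) by simp
qed

text \<open>No two neighbouring columns are occupied, and column 2n could hold only the forbidden
  point (2n, 0), so at most n columns remain. For n = m, either occupied columns are at least three
  apart, or all abscissas are even and the columns 0 and n hold at most one vertex each.\<close>

lemma triangle_rows:
  assumes n: "3 \<le> n" and V: "free_config n V" and tri: "in_triangle n V"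
    and L: "sublattice m \<Lambda>" "V \<subseteq> \<Lambda>" and no1: "\<nexists>e. e \<in> \<Lambda> \<and> fst e = 1"
  shows "int (card V) \<le> 2 * n" "n = m \<Longrightarrow> int (card V) \<le> 2 * n - 2"
proof -
  have fin: "finite V" and conv: "convex_position V" using V unfolding free_config_def by auto
  have sub: "fst ` V \<subseteq> {0..2 * n - 1}"
  proof
    fix x assume "x \<in> fst ` V"
    then obtain v where v: "v \<in> V" "x = fst v" by blast
    then have t: "0 \<le> fst v" "0 \<le> snd v" "fst v + snd v \<le> 2 * n" using tri unfolding in_triangle_def by auto
    have "v \<noteq> (n * 2, n * 0)" using v free_not_multiple[OF V, of 2 0] by auto
    then have "fst v \<noteq> 2 * n" using t by (auto simp: prod_eq_iff)
    then show "x \<in> {0..2 * n - 1}" using t v by auto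
  qed
  have two: "2 * int (card (fst ` V)) \<le> 2 * n - 1 + 2"
    by (rule no_consecutive[OF sub]) (use consecutive_columns[OF L no1] n in auto)
  then have cn: "int (card (fst ` V)) \<le> n" by linarith
  have le: "int (card V) \<le> 2 * int (card (fst ` V))" by (rule card_le_columns[OF V])
  then show "int (card V) \<le> 2 * n" using cn by linarith
  show "int (card V) \<le> 2 * n - 2" if nm: "n = m"
  proof (cases "\<exists>e. e \<in> \<Lambda> \<and> fst e = 2")
    case False
    have "3 * int (card (fst ` V)) \<le> 2 * n - 1 + 3"
      by (rule no_near[OF sub]) (use consecutive_columns[OF L no1] consecutive_columns[OF L False] n in auto)
    then have c: "3 * int (card (fst ` V)) \<le> 2 * n + 2" by simp
    consider "n = 3" | "n = 4" | "5 \<le> n" using n by linarith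
    then show ?thesis
    proof cases
      case 1
      then have "int (card (fst ` V)) \<le> 2" using c by simp
      then show ?thesis using le 1 by simp
    next
      case 2
      then have "int (card (fst ` V)) \<le> 3" using c by simp
      then show ?thesis using le 2 by simp
    next
      case 3
      have "3 * int (card V) \<le> 2 * (2 * n + 2)" using le c by simp
      then show ?thesis using 3 by simp
    qed
  next
    case True
    then obtain e where e: "e \<in> \<Lambda>" "fst e = 2" by blast
    have even: "even (fst f)" if f: "f \<in> \<Lambda>" for f
    proof (rule ccontr)
      assume "odd (fst f)"
      then obtain k where k: "fst f = 2 * k + 1" by (rule oddE)
      have "f - (k * fst e, k * snd e) \<in> \<Lambda>" using sublatticeD(1)[OF L(1) f sublattice_scale[OF L(1) e(1)]] .
      moreover have "fst (f - (k * fst e, k * snd e)) = 1" using k e by simp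
      ultimately show False using no1 by blast
    qed
    have half: "n dvd 2 * y" if "(0, y) \<in> \<Lambda>" for y
      using sublatticeD(2)[OF L(1) e(1) that] e nm by (simp add: det2_def)
    have one: "card (col V (n * p)) \<le> 1" for p by (rule col_le_1[OF V L]) (use nm n half in auto)
    have "even n" using even[OF sublatticeD(3)[OF L(1), of 1 0]] nm by simp
    then obtain h where h: "n = 2 * h" by (rule evenE)
    have ev: "fst ` V \<subseteq> insert 0 (insert n ((\<lambda>i. 2 * i) ` ({1..n - 1} - {h})))"
    proof
      fix x assume x: "x \<in> fst ` V"
      then have "even x" "x \<in> {0..2 * n - 1}" using even L(2) sub by auto
      then obtain i where i: "x = 2 * i" by (auto elim: evenE)
      then have "i = 0 \<or> i = h \<or> i \<in> {1..n - 1} - {h}" using \<open>x \<in> {0..2 * n - 1}\<close> by auto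
      then show "x \<in> insert 0 (insert n ((\<lambda>i. 2 * i) ` ({1..n - 1} - {h})))" using i h by auto
    qed
    let ?A = "(\<lambda>i. 2 * i) ` ({1..n - 1} - {h})"
    have "n \<notin> ?A" "0 \<notin> ?A" "n \<noteq> 0" using h n by auto
    then have "int (card V) = int (card (col V 0)) + (int (card (col V n)) + (\<Sum>x\<in>?A. int (card (col V x))))"
      using card_columns[OF fin ev] by simp
    moreover have "(\<Sum>x\<in>?A. int (card (col V x))) \<le> (\<Sum>x\<in>?A. 2)"
      by (rule sum_mono) (use col_le_2[OF fin conv] in simp)
    moreover have "card ?A = card ({1..n - 1} - {h})" by (intro card_image inj_onI) simp
    moreover have "int (card ({1..n - 1} - {h})) = n - 2" using h n by simp
    ultimately show ?thesis using one[of 0] one[of 1] by simp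
  qed
qed

text \<open>The three vectors make every lattice vector parallel to a side of the triangle a
  multiple of n. Columns over multiples of n are then empty. The columns j, n + j, n - j, 2n - j
  together account for at most four vertices, and summing over j counts every vertex twice.\<close>

lemma triangle_count:
  assumes n: "3 \<le> n" and V: "free_config n V" and tri: "in_triangle n V"
    and L: "sublattice n \<Lambda>" "V \<subseteq> \<Lambda>"
    and e1: "e1 \<in> \<Lambda>" "fst e1 = 1" and e2: "e2 \<in> \<Lambda>" "snd e2 = 1" and e3: "e3 \<in> \<Lambda>" "fst e3 + snd e3 = 1"
  shows "int (card V) \<le> 2 * n - 2"
proof -
  have fin: "finite V" and conv: "convex_position V" using V unfolding free_config_def by auto
  have avoid: "(n * p, n * q) \<notin> V" for p q by (rule free_not_multiple[OF V])
  have vert: "n dvd d" if "(0, d) \<in> \<Lambda>" for d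
    using sublatticeD(2)[OF L(1) e1(1) that] e1 by (simp add: det2_def)
  have horiz: "n dvd d" if "(d, 0) \<in> \<Lambda>" for d
    using sublatticeD(2)[OF L(1) that e2(1)] e2 by (simp add: det2_def)
  have diag: "n dvd d" if "(d, - d) \<in> \<Lambda>" for d
  proof -
    have "det2 (d, - d) e3 = d * (fst e3 + snd e3)" by (simp add: det2_def algebra_simps)
    then show ?thesis using sublatticeD(2)[OF L(1) that e3(1)] e3 by simp
  qed
  have diff: "(x - x', y - y') \<in> \<Lambda>" if "(x, y) \<in> \<Lambda>" "(x', y') \<in> \<Lambda>" for x y x' y'
    using sublatticeD(1)[OF L(1) that] by simp
  have tri': "0 \<le> x \<and> 0 \<le> y \<and> x + y \<le> 2 * n" if "(x, y) \<in> V" for x y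
    using tri that unfolding in_triangle_def by force
  have empty: "col V (n * p) = {}" for p
  proof (rule ccontr)
    assume "col V (n * p) \<noteq> {}"
    then obtain y where y: "(n * p, y) \<in> V" unfolding col_def by auto
    then have "(n * p - n * p, y - n * 0) \<in> \<Lambda>" using diff[OF _ sublatticeD(3)[OF L(1), of p 0]] L(2) by blast
    then have "n dvd y" using vert by simp
    then obtain q where "y = n * q" by (rule dvdE)
    then show False using y avoid by simp
  qed
  define s where "s j = int (card (col V j)) + int (card (col V (n + j)))" for j
  have colx: "v \<in> col V x \<longleftrightarrow> (x, snd v) \<in> V \<and> fst v = x" for v x by (cases v) (auto simp: col_def)
  \<comment> \<open>If the columns j and n + j hold two vertices, some lattice point (j, y) lies
    inside the triangle with vertices (0,0), (n,0), (0,n). Heights over n - j and 2n - j are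
    congruent to -y modulo n, and the large triangle then leaves room only for (n - j, n -
    y).\<close>
  have small: "s j \<le> 3" "s (n - j) \<le> 1" if j: "0 < j" "j < n" and s2: "2 \<le> s j" for j
  proof -
    have nj: "\<not> n dvd j" using j zdvd_not_zless by blast
    have cong: "n dvd y - y'" if "(j, y) \<in> \<Lambda>" "(j, y') \<in> \<Lambda>" for y y'
      using vert diff[OF that] by simp
    have down: "(j, y) \<in> \<Lambda>" if "(n + j, y) \<in> \<Lambda>" for y
      using diff[OF that sublatticeD(3)[OF L(1), of 1 0]] by simp
    have col1: "card (col V (n + j)) \<le> 1"
    proof -
      have yy: "y = y'" if "(n + j, y) \<in> V" "(n + j, y') \<in> V" for y y'
      proof (rule ccontr)
        assume ne: "y \<noteq> y'"
        have "(n + j, y) \<in> \<Lambda>" "(n + j, y') \<in> \<Lambda>" using that L(2) by blast+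
        then have "n dvd y - y'" by (intro cong down)
        then have "n dvd \<bar>y - y'\<bar>" by simp
        then have "n \<le> \<bar>y - y'\<bar>" using ne by (intro zdvd_imp_le) auto
        moreover have "0 \<le> y" "0 \<le> y'" "n + j + y \<le> 2 * n" "n + j + y' \<le> 2 * n"
          using tri'[OF that(1)] tri'[OF that(2)] by blast+
        ultimately show False using j by (smt (verit))
      qed
      have "v = w" if "v \<in> col V (n + j)" "w \<in> col V (n + j)" for v w
        using that yy[of "snd v" "snd w"] unfolding colx prod_eq_iff by simp
      moreover have "finite (col V (n + j))" using fin by (simp add: col_def)
      ultimately show ?thesis using card_le_Suc0_iff_eq[of "col V (n + j)"] by simp
    qed
    then show "s j \<le> 3" using col_le_2[OF fin conv, of j] unfolding s_def by simp
    \<comment> \<open>Either a vertex of column n + j is moved left by n, or column j has two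
      vertices, whose heights differ by at least n, and the lower one serves.\<close>
    have "\<exists>y. (j, y) \<in> \<Lambda> \<and> 0 \<le> y \<and> y \<le> n - j"
    proof (cases "col V (n + j) = {}")
      case False
      then obtain y where "(n + j, y) \<in> V" by (auto simp: col_def)
      then have "(j, y) \<in> \<Lambda>" "0 \<le> y" "n + j + y \<le> 2 * n" using down tri' L(2) by blast+
      then show ?thesis by (intro exI[of _ y]) simp
    next
      case True
      then have c2: "2 \<le> card (col V j)" using s2 unfolding s_def by simp
      have "\<not> card (col V j) \<le> Suc 0" using c2 by simp
      moreover have "finite (col V j)" using fin by (simp add: col_def)
      ultimately obtain v w where vw: "v \<in> col V j" "w \<in> col V j" "v \<noteq> w"
        using card_le_Suc0_iff_eq by blast
      have "snd v \<noteq> snd w" using vw unfolding colx by (metis prod_eqI)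
      then have "\<exists>y y'. (j, y) \<in> V \<and> (j, y') \<in> V \<and> y < y'"
        using vw unfolding colx by (metis linorder_neqE_linordered_idom)
      then obtain y y' where y: "(j, y) \<in> V" "(j, y') \<in> V" "y < y'" by blast
      have "(j, y') \<in> \<Lambda>" "(j, y) \<in> \<Lambda>" using y L(2) by blast+
      then have "n dvd y' - y" by (rule cong)
      then have "n \<le> y' - y" using y(3) by (intro zdvd_imp_le) auto
      moreover have "0 \<le> y" "j + y' \<le> 2 * n" using tri'[OF y(1)] tri'[OF y(2)] by blast+
      ultimately have "(j, y) \<in> \<Lambda> \<and> 0 \<le> y \<and> y \<le> n - j" using \<open>(j, y) \<in> \<Lambda>\<close> by simp
      then show ?thesis by blast
    qed
    then obtain y where y: "(j, y) \<in> \<Lambda>" "0 \<le> y" "y \<le> n - j" by blast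
    have "y \<noteq> 0" using horiz y nj by auto
    moreover have "y \<noteq> n - j"
    proof
      assume "y = n - j"
      then have "(j, - j) \<in> \<Lambda>" using diff[OF y(1) sublatticeD(3)[OF L(1), of 0 1]] by simp
      then show False using diag nj by blast
    qed
    ultimately have yy: "0 < y" "y < n - j" using y by linarith+
    have opp: "z = n - y \<and> x = n - j" if xz: "(x, z) \<in> V" "x = n - j \<or> x = n + (n - j)" for x z
    proof -
      have "(x, z) \<in> \<Lambda>" using xz L(2) by blast
      then have "(- x, - z) \<in> \<Lambda>" using sublatticeD(4)[OF L(1)] by fastforce
      from diff[OF y(1) this] have a: "(j + x, y + z) \<in> \<Lambda>" by simp
      have "n dvd y + z"
      proof (cases "x = n - j")
        case True
        then show ?thesis using vert diff[OF a sublatticeD(3)[OF L(1), of 1 0]] by simp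
      next
        case False
        then show ?thesis using xz vert diff[OF a sublatticeD(3)[OF L(1), of 2 0]] by simp
      qed
      then obtain k where k: "y + z = n * k" by (rule dvdE)
      have t: "0 \<le> z" "x + z \<le> 2 * n" using tri'[OF xz(1)] by auto
      have "n * 0 < n * k" using t yy k by simp
      then have k0: "0 < k" using n by (simp only: mult_less_cancel_left_pos)
      have xj: "x = n - j"
      proof (rule ccontr)
        assume "x \<noteq> n - j"
        then have "x = n + (n - j)" using xz by simp
        then have "n * k < n * 1" using t yy k by (smt (verit))
        then have "k < 1" using n by (simp only: mult_less_cancel_left_pos)
        then show False using k0 by simp
      qed
      then have "n * k < n * 2" using t yy k by (smt (verit))
      then have "k < 2" using n by (simp only: mult_less_cancel_left_pos)
      then have "x = n - j" "k = 1" using xj k0 by linarith+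
      then show ?thesis using k by simp
    qed
    have "col V (n - j) \<union> col V (n + (n - j)) \<subseteq> {(n - j, n - y)}"
      using opp unfolding col_def by force
    moreover have "col V (n - j) \<inter> col V (n + (n - j)) = {}" using n unfolding col_def by auto
    moreover have "finite (col V (n - j))" "finite (col V (n + (n - j)))" using fin by (simp_all add: col_def)
    ultimately have "card (col V (n - j)) + card (col V (n + (n - j))) \<le> card {(n - j, n - y)}"
      by (metis card_Un_disjoint card_mono finite.emptyI finite.insertI)
    then show "s (n - j) \<le> 1" unfolding s_def by simp
  qed
  have four: "s j + s (n - j) \<le> 4" if j: "j \<in> {1..n - 1}" for j
  proof (cases "2 \<le> s j")
    case True
    then show ?thesis using small[of j] j by force
  next
    case False
    show ?thesis
    proof (cases "2 \<le> s (n - j)")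
      case True
      then show ?thesis using small[of "n - j"] j by force
    next
      case False
      then show ?thesis using \<open>\<not> 2 \<le> s j\<close> by linarith
    qed
  qed
  have sub: "fst ` V \<subseteq> insert 0 (insert n (insert (2 * n) ({1..n - 1} \<union> (\<lambda>j. n + j) ` {1..n - 1})))"
  proof
    fix x assume "x \<in> fst ` V"
    then obtain y where "(x, y) \<in> V" by force
    then have "0 \<le> x" "x \<le> 2 * n" using tri' by force+
    then consider "x = 0" | "x = n" | "x = 2 * n" | "x \<in> {1..n - 1}" | "x - n \<in> {1..n - 1}" by force
    then show "x \<in> insert 0 (insert n (insert (2 * n) ({1..n - 1} \<union> (\<lambda>j. n + j) ` {1..n - 1})))"
      by cases (auto simp: image_iff intro: bexI[of _ "x - n"])
  qed
  have "int (card V) = (\<Sum>x\<in>{1..n - 1} \<union> (\<lambda>j. n + j) ` {1..n - 1}. int (card (col V x)))"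
  proof -
    have "card V = (\<Sum>x\<in>insert 0 (insert n (insert (2 * n) ({1..n - 1} \<union> (\<lambda>j. n + j) ` {1..n - 1}))). card (col V x))"
      by (rule card_columns[OF fin sub]) simp
    also have "\<dots> = (\<Sum>x\<in>{1..n - 1} \<union> (\<lambda>j. n + j) ` {1..n - 1}. card (col V x))"
      by (rule sum.mono_neutral_right) (use empty[of 0] empty[of 1] empty[of 2] in \<open>auto simp: mult.commute\<close>)
    finally show ?thesis by simp
  qed
  also have "\<dots> = (\<Sum>x\<in>{1..n - 1}. int (card (col V x))) + (\<Sum>x\<in>(\<lambda>j. n + j) ` {1..n - 1}. int (card (col V x)))"
    by (rule sum.union_disjoint) auto
  also have "(\<Sum>x\<in>(\<lambda>j. n + j) ` {1..n - 1}. int (card (col V x))) = (\<Sum>j\<in>{1..n - 1}. int (card (col V (n + j))))"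
    by (subst sum.reindex) (auto simp: inj_on_def)
  finally have N: "int (card V) = (\<Sum>j\<in>{1..n - 1}. s j)" by (simp add: s_def sum.distrib)
  also have "(\<Sum>j\<in>{1..n - 1}. s j) = (\<Sum>j\<in>{1..n - 1}. s (n - j))"
    by (rule sum.reindex_bij_witness[of _ "\<lambda>j. n - j" "\<lambda>j. n - j"]) auto
  finally have "2 * int (card V) = (\<Sum>j\<in>{1..n - 1}. s j + s (n - j))" using N by (simp add: sum.distrib)
  also have "\<dots> \<le> (\<Sum>j\<in>{1..n - 1}. 4)" by (rule sum_mono) (use four in blast)
  also have "\<dots> = 4 * (n - 1)" using n by simp
  finally show ?thesis by simp
qed

text \<open>If one of x, y, x + y does not take the value one on the lattice, a symmetry of the
  triangle brings this direction into the form of \<open>triangle_rows\<close>. Otherwise the bound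
  for n = m is \<open>triangle_count\<close>, and for n = 2m only n = 4 is not settled by
  \<open>triangle_half_large\<close>.\<close>

lemma triangle_bounds:
  assumes n: "3 \<le> n" and V: "free_config n V" and tri: "in_triangle n V"
  shows "vertex_bounds n V"
  unfolding vertex_bounds_def
proof (intro conjI allI impI)
  show "int (card V) \<le> 2 * n + 2" by (rule triangle_general[OF n V tri])
  fix m \<Lambda> assume L: "sublattice m \<Lambda>" "V \<subseteq> \<Lambda>"
  have rows_y: "int (card V) \<le> 2 * n \<and> (n = m \<longrightarrow> int (card V) \<le> 2 * n - 2)"
    if no: "\<nexists>e. e \<in> \<Lambda> \<and> snd e = 1" and mn: "m dvd n"
  proof -
    let ?T = "tf 0 1 1 0 (n * 0) (n * 0)"
    have det: "\<bar>0 * 0 - 1 * 1 :: int\<bar> = 1" by simp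
    have c: "card (?T ` V) = card V" by (rule card_image[OF inj_tf[OF det]])
    have t: "in_triangle n (?T ` V)" using tri unfolding in_triangle_def by auto
    have i: "?T ` V \<subseteq> ?T ` \<Lambda>" using L(2) by blast
    have no': "\<nexists>e. e \<in> ?T ` \<Lambda> \<and> fst e = 1" using no by auto
    show ?thesis
      using triangle_rows[OF n free_config_tf[OF det V] t sublattice_tf[OF det L(1) mn] i no'] unfolding c by blast
  qed
  have rows_xy: "int (card V) \<le> 2 * n \<and> (n = m \<longrightarrow> int (card V) \<le> 2 * n - 2)"
    if no: "\<nexists>e. e \<in> \<Lambda> \<and> fst e + snd e = 1" and mn: "m dvd n"
  proof -
    \<comment> \<open>The new abscissa 2n - x - y vanishes on the slanted side, so the symmetry
      moves this side to x = 0.\<close>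
    let ?T = "tf (-1) (-1) 0 1 (n * 2) (n * 0)"
    have det: "\<bar>(-1) * 1 - (-1) * 0 :: int\<bar> = 1" by simp
    have c: "card (?T ` V) = card V" by (rule card_image[OF inj_tf[OF det]])
    have t: "in_triangle n (?T ` V)" using tri unfolding in_triangle_def by auto
    have i: "?T ` V \<subseteq> ?T ` \<Lambda>" using L(2) by blast
    have no': "\<nexists>e. e \<in> ?T ` \<Lambda> \<and> fst e = 1"
    proof
      assume "\<exists>e. e \<in> ?T ` \<Lambda> \<and> fst e = 1"
      then obtain e where e: "e \<in> \<Lambda>" "fst (?T e) = 1" by auto
      obtain n' where n': "n = m * n'" using mn by blast
      have "(m * (n' * 2), m * 0) - e \<in> \<Lambda>" using sublatticeD(1)[OF L(1) sublatticeD(3)[OF L(1)] e(1)] .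
      moreover have "fst ((m * (n' * 2), m * 0) - e) + snd ((m * (n' * 2), m * 0) - e) = 1" using e(2) n' by simp
      ultimately show False using no by blast
    qed
    show ?thesis
      using triangle_rows[OF n free_config_tf[OF det V] t sublattice_tf[OF det L(1) mn] i no'] unfolding c by blast
  qed
  show "int (card V) \<le> 2 * n" if nm: "n = 2 * m"
  proof (cases "6 \<le> n")
    case True
    then show ?thesis by (rule triangle_half_large[OF _ V tri L nm])
  next
    case False
    then have m: "m = 2" "m dvd n" using nm n by auto
    show ?thesis
    proof (cases "(\<exists>e. e \<in> \<Lambda> \<and> fst e = 1) \<and> (\<exists>e. e \<in> \<Lambda> \<and> snd e = 1) \<and> (\<exists>e. e \<in> \<Lambda> \<and> fst e + snd e = 1)")
      case True
      then obtain a b c where abc: "(1, a) \<in> \<Lambda>" "(b, 1) \<in> \<Lambda>" "(c, 1 - c) \<in> \<Lambda>"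
        by (metis prod.collapse add_diff_cancel_left')
      \<comment> \<open>The first determinant, 1 - a b, makes a odd; then the second, 1 - c (1 + a),
        is odd. So the three vectors cannot coexist.\<close>
      have "even (det2 (1, a) (b, 1))" "even (det2 (1, a) (c, 1 - c))"
        using sublatticeD(2)[OF L(1)] abc m by auto
      then show ?thesis by (auto simp: det2_def)
    next
      case False
      then consider "\<nexists>e. e \<in> \<Lambda> \<and> fst e = 1" | "\<nexists>e. e \<in> \<Lambda> \<and> snd e = 1" | "\<nexists>e. e \<in> \<Lambda> \<and> fst e + snd e = 1"
        by blast
      then show ?thesis
      proof cases
        case 1 then show ?thesis by (rule triangle_rows(1)[OF n V tri L])
      next
        case 2 then show ?thesis using rows_y m by blast
      next
        case 3 then show ?thesis using rows_xy m by blast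
      qed
    qed
  qed
  show "int (card V) \<le> 2 * n - 2" if nm: "n = m"
  proof (cases "(\<exists>e. e \<in> \<Lambda> \<and> fst e = 1) \<and> (\<exists>e. e \<in> \<Lambda> \<and> snd e = 1) \<and> (\<exists>e. e \<in> \<Lambda> \<and> fst e + snd e = 1)")
    case True
    then obtain e1 e2 e3 where "e1 \<in> \<Lambda>" "fst e1 = 1" "e2 \<in> \<Lambda>" "snd e2 = 1" "e3 \<in> \<Lambda>" "fst e3 + snd e3 = 1" by blast
    then show ?thesis using triangle_count[OF n V tri] L nm by blast
  next
    case False
    then consider "\<nexists>e. e \<in> \<Lambda> \<and> fst e = 1" | "\<nexists>e. e \<in> \<Lambda> \<and> snd e = 1" | "\<nexists>e. e \<in> \<Lambda> \<and> fst e + snd e = 1"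
      by blast
    then show ?thesis
    proof cases
      case 1 then show ?thesis using triangle_rows(2)[OF n V tri L] nm by blast
    next
      case 2 then show ?thesis using rows_y[OF 2] nm by (metis dvd_refl)
    next
      case 3 then show ?thesis using rows_xy[OF 3] nm by (metis dvd_refl)
    qed
  qed
qed

section \<open>Reduction by unimodular maps\<close>

text \<open>V lies strictly on one side of a line through the point X = Y = 0, and the quadrant X, Y
  \<le> 0 on the other. X and Y are functions, so that coordinates adapted to a corner can be used
  without moving V.\<close>

definition corner_at :: "(int \<times> int) set \<Rightarrow> (int \<times> int \<Rightarrow> int) \<Rightarrow> (int \<times> int \<Rightarrow> int) \<Rightarrow> bool" where
  "corner_at V X Y \<longleftrightarrow> (\<exists>\<alpha> \<beta>::real. 0 < \<alpha> \<and> 0 < \<beta> \<and> (\<forall>v\<in>V. 0 < \<alpha> * of_int (X v) + \<beta> * of_int (Y v)))"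

lemma corner_atI:
  fixes \<alpha> \<beta> :: real
  assumes "0 < \<alpha>" "0 < \<beta>" "\<And>v. v \<in> V \<Longrightarrow> 0 < \<alpha> * of_int (X v) + \<beta> * of_int (Y v)"
  shows "corner_at V X Y"
  using assms unfolding corner_at_def by blast

lemma corner_at_commute: "corner_at V X Y \<Longrightarrow> corner_at V Y X"
  unfolding corner_at_def by (metis add.commute)

lemma corner_at_pos:
  assumes "corner_at V X Y" "v \<in> V"
  shows "Y v \<le> 0 \<Longrightarrow> 0 < X v" "X v \<le> 0 \<Longrightarrow> 0 < Y v"
  using assms pos_combination unfolding corner_at_def by blast+

text \<open>Changing one of the two coordinates of a corner by a shear: the tangent direction stays
  inside the new quadrant as soon as some vertex witnesses this.\<close>

lemma corner_at_slope:
  fixes \<alpha> \<beta> :: real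
  assumes "0 < \<alpha>" "\<And>v. v \<in> V \<Longrightarrow> 0 < \<alpha> * of_int (X v) + \<beta> * of_int (Y v)" "w \<in> V" "X w \<le> 0" "0 < Y w"
  shows "corner_at V X Y"
proof (rule corner_atI[OF assms(1) _ assms(2)])
  have "\<alpha> * of_int (X w) \<le> 0" using assms by (simp add: mult_nonneg_nonpos)
  then have "0 < \<beta> * of_int (Y w)" using assms(2)[OF assms(3)] by linarith
  then show "0 < \<beta>" using assms(5) by (simp add: zero_less_mult_iff)
qed

lemma corner_at_add:
  assumes "corner_at V X Y" "w \<in> V" "X w + Y w \<le> 0" "0 < Y w" "\<And>v. Z v = X v + Y v"
  shows "corner_at V Z Y"
proof -
  obtain \<alpha> \<beta> :: real where ab: "0 < \<alpha>" "\<And>v. v \<in> V \<Longrightarrow> 0 < \<alpha> * of_int (X v) + \<beta> * of_int (Y v)"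
    using assms(1) unfolding corner_at_def by blast
  show ?thesis
  proof (rule corner_at_slope[OF ab(1), of V Z "\<beta> - \<alpha>" Y w])
    show "0 < \<alpha> * of_int (Z v) + (\<beta> - \<alpha>) * of_int (Y v)" if "v \<in> V" for v
      using ab(2)[OF that] by (simp add: assms(5) algebra_simps)
  qed (use assms in auto)
qed

text \<open>Since X = Z + Y, the quadrant Z, Y \<le> 0 lies inside the quadrant X, Y \<le> 0, and
  the old functional keeps positive coefficients.\<close>

lemma corner_at_diff:
  assumes "corner_at V X Y" "\<And>v. Z v = X v - Y v"
  shows "corner_at V Z Y"
proof -
  obtain \<alpha> \<beta> :: real where ab: "0 < \<alpha>" "0 < \<beta>" "\<And>v. v \<in> V \<Longrightarrow> 0 < \<alpha> * of_int (X v) + \<beta> * of_int (Y v)"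
    using assms(1) unfolding corner_at_def by blast
  show ?thesis
  proof (rule corner_atI[of \<alpha> "\<alpha> + \<beta>"])
    show "0 < \<alpha> * of_int (Z v) + (\<alpha> + \<beta>) * of_int (Y v)" if "v \<in> V" for v
      using ab(3)[OF that] by (simp add: assms(2) algebra_simps)
  qed (use ab in auto)
qed

text \<open>Two splitting segments meet at the corner, and each fixes the sign of one coefficient.
  If neither functional has its other coefficient positive, elimination of Y makes a fixed multiple
  of X positive on all of V, against v and w.\<close>

lemma corner_at_of_sides:
  fixes \<beta> \<delta> :: real
  assumes X: "\<And>v. v \<in> V \<Longrightarrow> 0 < of_int (X v) + \<beta> * of_int (Y v)"
    and Y: "\<And>v. v \<in> V \<Longrightarrow> 0 < of_int (Y v) + \<delta> * of_int (X v)"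
    and v: "v \<in> V" "X v < 0" and w: "w \<in> V" "0 < X w"
  shows "corner_at V X Y"
proof -
  consider "0 < \<beta>" | "0 < \<delta>" | "\<beta> \<le> 0" "\<delta> \<le> 0" by linarith
  then show ?thesis
  proof cases
    case 1
    then show ?thesis using X by (intro corner_atI[of 1 \<beta>]) auto
  next
    case 2
    then show ?thesis using Y by (intro corner_atI[of \<delta> 1]) (auto simp: add.commute)
  next
    case 3
    have key: "0 < (1 - \<beta> * \<delta>) * of_int (X u)" if "u \<in> V" for u
    proof -
      have "\<beta> * (of_int (Y u) + \<delta> * of_int (X u)) \<le> 0" using Y[OF that] 3 by (simp add: mult_nonpos_nonneg)
      then have "\<beta> * of_int (Y u) + \<beta> * \<delta> * of_int (X u) \<le> 0" by (simp add: algebra_simps)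
      then have "0 < of_int (X u) - \<beta> * \<delta> * of_int (X u)" using X[OF that] by linarith
      then show ?thesis by (simp add: algebra_simps)
    qed
    show ?thesis using key[OF v(1)] key[OF w(1)] v(2) w(2) by (auto simp: zero_less_mult_iff)
  qed
qed

text \<open>The bounds for the model regions, in arbitrary unimodular coordinates X, Y whose origin
  is a point of \<open>n\<int>\<^sup>2\<close>.\<close>

context
  fixes n a b c d p q :: int and V :: "(int \<times> int) set" and X Y :: "int \<times> int \<Rightarrow> int"
  assumes n: "3 \<le> n" and V: "free_config n V" and det: "\<bar>a * d - b * c\<bar> = 1"
    and X: "\<And>v. X v = a * fst v + b * snd v + n * p" and Y: "\<And>v. Y v = c * fst v + d * snd v + n * q"
begin

lemma strip_bounds:
  assumes "\<And>v. v \<in> V \<Longrightarrow> 0 \<le> X v \<and> X v \<le> n"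
  shows "vertex_bounds n V"
proof (rule vertex_bounds_tf[OF det type_I_bounds[OF n free_config_tf[OF det V, of p q]]])
  fix v assume "v \<in> tf a b c d (n * p) (n * q) ` V"
  then obtain w where "w \<in> V" "v = tf a b c d (n * p) (n * q) w" by blast
  then show "0 \<le> fst v \<and> fst v \<le> n" using assms[of w] by (simp add: X)
qed

lemma triangle_bounds':
  assumes "\<And>v. v \<in> V \<Longrightarrow> 0 \<le> X v \<and> 0 \<le> Y v \<and> X v + Y v \<le> 2 * n"
  shows "vertex_bounds n V"
proof (rule vertex_bounds_tf[OF det triangle_bounds[OF n free_config_tf[OF det V, of p q]]])
  show "in_triangle n (tf a b c d (n * p) (n * q) ` V)"
    unfolding in_triangle_def using assms by (simp add: X Y)
qed

lemma square_bounds: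
  assumes "corner_at V X Y" "corner_at V (\<lambda>v. n - X v) Y" "corner_at V X (\<lambda>v. n - Y v)"
    "corner_at V (\<lambda>v. n - X v) (\<lambda>v. n - Y v)"
    "\<exists>v\<in>V. X v < 0" "\<exists>v\<in>V. n < X v" "\<exists>v\<in>V. Y v < 0" "\<exists>v\<in>V. n < Y v"
  shows "vertex_bounds n V"
  by (rule vertex_bounds_tf[OF det type_II_bounds[OF n free_config_tf[OF det V, of p q]]])
    (use assms in \<open>simp_all add: corner_at_def X Y\<close>)

lemma half_strip_bounds:
  assumes "corner_at V (\<lambda>v. n - X v) Y" "corner_at V (\<lambda>v. n - X v) (\<lambda>v. n - Y v)"
    "\<And>v. v \<in> V \<Longrightarrow> 0 \<le> X v" "\<exists>v\<in>V. n < X v" "\<exists>v\<in>V. Y v < 0" "\<exists>v\<in>V. n < Y v"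
  shows "vertex_bounds n V"
  by (rule vertex_bounds_tf[OF det type_III_bounds[OF n free_config_tf[OF det V, of p q]]])
    (use assms in \<open>simp_all add: corner_at_def X Y\<close>)

end

text \<open>If the polygon stays on one side of a line through a point of \<open>n\<int>\<^sup>2\<close> and crosses another
  one, it passes this point on the inner side.\<close>

lemma wall_functional:
  fixes V :: "(int \<times> int) set"
  assumes ab: "\<And>v. v \<in> V \<Longrightarrow> 0 < \<alpha> * real_of_int (X v) + \<beta> * of_int (Y v)"
    and wall: "\<And>v. v \<in> V \<Longrightarrow> 0 \<le> X v" and v: "v \<in> V" "Y v < 0" and w: "w \<in> V" "0 < Y w"
  shows "\<exists>\<gamma>::real. \<forall>v\<in>V. 0 < of_int (X v) + \<gamma> * of_int (Y v)"
proof -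
  have "0 < \<alpha>"
  proof (rule ccontr)
    assume "\<not> 0 < \<alpha>"
    then have "\<alpha> * of_int (X u) \<le> 0" if "u \<in> V" for u using wall[OF that] by (simp add: mult_nonpos_nonneg)
    then have "0 < \<beta> * of_int (Y u)" if "u \<in> V" for u using ab[OF that] that by fastforce
    from this[OF v(1)] this[OF w(1)] show False using v w by (auto simp: zero_less_mult_iff)
  qed
  then have "0 < of_int (X u) + \<beta> / \<alpha> * of_int (Y u)" if "u \<in> V" for u
    using divide_pos_pos[OF ab[OF that] \<open>0 < \<alpha>\<close>] by (simp add: add_divide_distrib)
  then show ?thesis by blast
qed

lemma free_functional:
  assumes "free_config n V"
  obtains \<alpha> \<beta> :: real where "\<And>v. v \<in> V \<Longrightarrow> 0 < \<alpha> * of_int (fst v - n * p) + \<beta> * of_int (snd v - n * q)"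
  using assms unfolding free_config_def by blast

section \<open>Descent for type V\<close>

definition corner_V :: "int \<Rightarrow> (int \<times> int) set \<Rightarrow> bool" where
  "corner_V n V \<longleftrightarrow> free_config n V \<and> corner_at V (\<lambda>v. - fst v) snd \<and> (\<exists>v\<in>V. snd v < 0) \<and> (\<exists>v\<in>V. 0 < fst v) \<and>
     (\<forall>v\<in>V. - n \<le> fst v \<and> snd v \<le> n)"

text \<open>Below the diagonal, V stays on one side of the vertical axis: in the form (\<alpha> -
  \<beta>) (-x) + \<beta> (y - x) the second term is negative there, so -x must have the sign of
  \<alpha> - \<beta>.\<close>

lemma below_left_or_right:
  assumes "corner_at V (\<lambda>v. - fst v) snd" "v \<in> V" "w \<in> V" "snd v < fst v" "fst v < 0"
  shows "\<not> (0 < fst w \<and> snd w < fst w)"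
proof
  assume w: "0 < fst w \<and> snd w < fst w"
  obtain \<alpha> \<beta> :: real where ab: "0 < \<alpha>" "0 < \<beta>" "\<And>v. v \<in> V \<Longrightarrow> 0 < \<alpha> * of_int (- fst v) + \<beta> * of_int (snd v)"
    using assms(1) unfolding corner_at_def by blast
  have k: "0 < (\<alpha> - \<beta>) * of_int (- fst u) + \<beta> * of_int (snd u - fst u)" if "u \<in> V" for u
    using ab(3)[OF that] by (simp add: algebra_simps)
  have "\<beta> * of_int (snd v - fst v) < 0" "\<beta> * of_int (snd w - fst w) < 0"
    using ab(2) assms(4) w by (simp_all add: mult_pos_neg)
  then have "0 < (\<alpha> - \<beta>) * of_int (- fst v)" "0 < (\<alpha> - \<beta>) * of_int (- fst w)"
    using k[OF assms(2)] k[OF assms(3)] by linarith+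
  moreover from this(1) have "0 < \<alpha> - \<beta>" by (rule zero_less_mult_pos2) (use assms(5) in simp)
  then have "(\<alpha> - \<beta>) * of_int (- fst w) \<le> 0" by (rule mult_nonneg_nonpos[OF less_imp_le]) (use w in simp)
  ultimately show False by linarith
qed

text \<open>The shear (x, y) to (x, y - x) keeps the corner at the origin, as v witnesses. If a
  vertex comes to lie above height n, then (0, n) is a second corner, and the half-strip along the
  wall x = -n takes over. Otherwise the configuration is of the same kind, and its lowest vertex is
  higher.\<close>

lemma corner_V_left:
  assumes n: "3 \<le> n" and V: "corner_V n V" and v: "v \<in> V" "snd v < fst v" "fst v < 0"
    and bnd: "\<And>v w. v \<in> V \<Longrightarrow> w \<in> V \<Longrightarrow> fst v - snd w \<le> k"
    and IH: "\<And>V'. corner_V n V' \<Longrightarrow> (\<And>v w. v \<in> V' \<Longrightarrow> w \<in> V' \<Longrightarrow> fst v - snd w \<le> k - 1) \<Longrightarrow> vertex_bounds n V'"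
  shows "vertex_bounds n V"
proof -
  have F: "free_config n V" and C: "corner_at V (\<lambda>v. - fst v) snd" and W: "\<And>v. v \<in> V \<Longrightarrow> - n \<le> fst v \<and> snd v \<le> n"
    and ex: "\<exists>v\<in>V. snd v < 0" "\<exists>v\<in>V. 0 < fst v" using V unfolding corner_V_def by auto
  have C': "corner_at V (\<lambda>v. - fst v) (\<lambda>v. snd v - fst v)"
    by (rule corner_at_commute[OF corner_at_add[OF corner_at_commute[OF C] v(1)]]) (use v in auto)
  show ?thesis
  proof (cases "\<exists>v\<in>V. n < snd v - fst v")
    case True
    then obtain u where u: "u \<in> V" "n < snd u - fst u" by blast
    obtain r where r: "r \<in> V" "0 < fst r" using ex by blast
    obtain \<alpha> \<beta> :: real where "\<And>v. v \<in> V \<Longrightarrow> 0 < \<alpha> * of_int (fst v - n * 0) + \<beta> * of_int (snd v - n * 1)"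
      using free_functional[OF F, of 0 1] by blast
    then have "\<exists>\<gamma>::real. \<forall>v\<in>V. 0 < of_int (n - snd v) + \<gamma> * of_int (fst v)"
      by (intro wall_functional[of V "- \<beta>" "\<lambda>v. n - snd v" \<alpha> fst v r]) (use W v r in \<open>auto simp: algebra_simps\<close>)
    then obtain \<gamma> :: real where g: "\<And>v. v \<in> V \<Longrightarrow> 0 < of_int (n - snd v) + \<gamma> * of_int (fst v)" by blast
    have "corner_at V (\<lambda>v. n - (snd v - fst v)) (\<lambda>v. - fst v)"
    proof (rule corner_at_slope[of 1 V _ "1 - \<gamma>" _ u])
      show "0 < 1 * real_of_int (n - (snd v - fst v)) + (1 - \<gamma>) * real_of_int (- fst v)" if "v \<in> V" for v
        using g[OF that] by (simp add: algebra_simps)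
    qed (use u W[OF u(1)] in auto)
    then have C2: "corner_at V (\<lambda>v. - fst v) (\<lambda>v. n - (snd v - fst v))" by (rule corner_at_commute)
    have W': "0 \<le> fst v + n" if "v \<in> V" for v using W[OF that] by simp
    show ?thesis
    proof (rule half_strip_bounds[OF n F, of 1 1 0 "-1" "\<lambda>v. fst v + n" 1 "\<lambda>v. snd v - fst v" 0])
      show "corner_at V (\<lambda>v. n - (fst v + n)) (\<lambda>v. snd v - fst v)" using C' by simp
      show "corner_at V (\<lambda>v. n - (fst v + n)) (\<lambda>v. n - (snd v - fst v))" using C2 by simp
      show "\<exists>v\<in>V. n < fst v + n" using r by (intro bexI[of _ r]) simp
      show "\<exists>v\<in>V. snd v - fst v < 0" using v by (intro bexI[of _ v]) simp
    qed (use W' True in simp_all)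
  next
    case False
    let ?T = "tf 1 0 (-1) 1 (n * 0) (n * 0)"
    have det: "\<bar>1 * 1 - 0 * (-1) :: int\<bar> = 1" by simp
    have "vertex_bounds n (?T ` V)"
    proof (rule IH)
      have "corner_at (?T ` V) (\<lambda>v. - fst v) snd" using C' unfolding corner_at_def by simp
      moreover have "- n \<le> fst u \<and> snd u - fst u \<le> n" if "u \<in> V" for u
        using W[OF that] False that by (simp add: not_less)
      moreover have "\<exists>u\<in>V. snd u - fst u < 0" using v by (intro bexI[of _ v]) simp
      ultimately show "corner_V n (?T ` V)" unfolding corner_V_def
        using free_config_tf[OF det F, of 0 0] ex(2) by simp
      fix x y assume "x \<in> ?T ` V" "y \<in> ?T ` V"
      then obtain x' y' where x: "x' \<in> V" "y' \<in> V" "x = ?T x'" "y = ?T y'" by auto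
      obtain u where u: "u \<in> V" "snd u < 0" using ex by blast
      show "fst x - snd y \<le> k - 1"
      \<comment> \<open>Vertices below the diagonal have negative abscissa and are raised; the
        others arrive at height at least 0, above the old minimum.\<close>
      proof (cases "snd y' < fst y'")
        case True
        then have "fst y' < 0 \<or> fst y' = 0" using below_left_or_right[OF C v(1) x(2) v(2,3)] by linarith
        moreover have "fst y' \<noteq> 0" using corner_at_pos(2)[OF C x(2)] True by auto
        ultimately show ?thesis using bnd[OF x(1,2)] x by simp
      next
        case False
        then show ?thesis using bnd[OF x(1) u(1)] u(2) x by simp
      qed
    qed
    then show ?thesis by (rule vertex_bounds_tf[OF det])
  qed
qed

text \<open>Induction on the largest abscissa minus the smallest height. If no vertex is below the
  diagonal, V lies in the triangle with vertices (-n,-n), (-n,n), (n,n). Otherwise the reflection in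
  y = -x, which preserves the measure, brings such a vertex to the left.\<close>

lemma corner_V_bounds:
  assumes n: "3 \<le> n" and V: "corner_V n V"
  shows "vertex_bounds n V"
proof -
  have main: "vertex_bounds n V"
    if "corner_V n V" "\<And>v w. v \<in> V \<Longrightarrow> w \<in> V \<Longrightarrow> fst v - snd w \<le> int k" for k V
    using that
  proof (induction k arbitrary: V)
    case 0
    obtain v w where "v \<in> V" "snd v < 0" "w \<in> V" "0 < fst w" using 0(1) unfolding corner_V_def by blast
    then show ?case using 0(2)[of w v] by simp
  next
    case (Suc k)
    have F: "free_config n V" and C: "corner_at V (\<lambda>v. - fst v) snd" and W: "\<And>v. v \<in> V \<Longrightarrow> - n \<le> fst v \<and> snd v \<le> n"
      and ex: "\<exists>v\<in>V. snd v < 0" "\<exists>v\<in>V. 0 < fst v" using Suc.prems(1) unfolding corner_V_def by auto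
    have IH: "vertex_bounds n V'" if "corner_V n V'" "\<And>v w. v \<in> V' \<Longrightarrow> w \<in> V' \<Longrightarrow> fst v - snd w \<le> int (Suc k) - 1" for V'
      using Suc.IH[OF that(1)] that(2) by simp
    show ?case
    proof (cases "\<exists>v\<in>V. snd v < fst v")
      case False
      have "0 \<le> fst v + n \<and> 0 \<le> n - snd v \<and> fst v + n + (n - snd v) \<le> 2 * n" if "v \<in> V" for v
      proof -
        have "\<not> snd v < fst v" using False that by blast
        then show ?thesis using W[OF that] by linarith
      qed
      from triangle_bounds'[OF n F, of 1 "-1" 0 0 "\<lambda>v. fst v + n" 1 "\<lambda>v. n - snd v" 1, OF _ _ _ this] show ?thesis by simp
    next
      case True
      then obtain v where v: "v \<in> V" "snd v < fst v" by blast
      show ?thesis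
      proof (cases "fst v < 0")
        case True
        show ?thesis by (rule corner_V_left[OF n Suc.prems(1) v True Suc.prems(2) IH])
      next
        case False
        have "fst v \<noteq> 0" using corner_at_pos(2)[OF C v(1)] v(2) by auto
        then have v0: "0 < fst v" using False by linarith
        then have "0 < snd v" using corner_at_pos(2)[OF C v(1)] by simp
        let ?T = "tf 0 (-1) (-1) 0 (n * 0) (n * 0)"
        have det: "\<bar>0 * 0 - (-1) * (-1) :: int\<bar> = 1" by simp
        have "corner_at (?T ` V) (\<lambda>v. - fst v) snd"
          using corner_at_commute[OF C] unfolding corner_at_def by simp
        moreover have "- n \<le> - snd u \<and> - fst u \<le> n" if "u \<in> V" for u
          using W[OF that] by simp
        ultimately have CT: "corner_V n (?T ` V)" unfolding corner_V_def
          using free_config_tf[OF det F, of 0 0] ex by simp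
        have "vertex_bounds n (?T ` V)"
        proof (rule corner_V_left[OF n CT])
          show "?T v \<in> ?T ` V" using v by blast
          show "snd (?T v) < fst (?T v)" "fst (?T v) < 0" using v \<open>0 < snd v\<close> by simp_all
          fix x y assume "x \<in> ?T ` V" "y \<in> ?T ` V"
          then obtain x' y' where "x' \<in> V" "y' \<in> V" "x = ?T x'" "y = ?T y'" by blast
          then show "fst x - snd y \<le> int (Suc k)" using Suc.prems(2)[of y' x'] by simp
        next
          fix V' assume "corner_V n V'" "\<And>v w. v \<in> V' \<Longrightarrow> w \<in> V' \<Longrightarrow> fst v - snd w \<le> int (Suc k) - 1"
          then show "vertex_bounds n V'" by (rule IH)
        qed
        then show ?thesis by (rule vertex_bounds_tf[OF det])
      qed
    qed
  qed
  have fin: "finite V" using V unfolding corner_V_def free_config_def by auto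
  have "fst v - snd w \<le> int (nat (Max ((\<lambda>(v, w). fst v - snd w) ` (V \<times> V))))" if "v \<in> V" "w \<in> V" for v w
  proof -
    have "fst v - snd w \<le> Max ((\<lambda>(v, w). fst v - snd w) ` (V \<times> V))"
      using fin that by (intro Max_ge) auto
    then show ?thesis by simp
  qed
  then show ?thesis by (rule main[OF V])
qed

section \<open>Descent for type VI\<close>

definition corner_VI :: "int \<Rightarrow> (int \<times> int) set \<Rightarrow> bool" where
  "corner_VI n V \<longleftrightarrow> free_config n V \<and> corner_at V (\<lambda>v. - fst v) snd \<and> corner_at V fst (\<lambda>v. n - snd v) \<and>
     (\<exists>v\<in>V. snd v < 0) \<and> (\<exists>v\<in>V. n < snd v) \<and> (\<forall>v\<in>V. - n \<le> fst v \<and> fst v \<le> n)"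

lemma corner_at_image: "corner_at (f ` V) X Y \<longleftrightarrow> corner_at V (\<lambda>v. X (f v)) (\<lambda>v. Y (f v))"
  unfolding corner_at_def by simp

lemma corner_VI_D:
  assumes "corner_VI n V"
  shows "free_config n V" "corner_at V (\<lambda>v. - fst v) snd" "corner_at V fst (\<lambda>v. n - snd v)"
    "\<exists>v\<in>V. snd v < 0" "\<exists>v\<in>V. n < snd v" "\<And>v. v \<in> V \<Longrightarrow> - n \<le> fst v" "\<And>v. v \<in> V \<Longrightarrow> fst v \<le> n"
    "\<And>v. v \<in> V \<Longrightarrow> fst v = 0 \<Longrightarrow> 0 < snd v \<and> snd v < n"
proof -
  show C: "corner_at V (\<lambda>v. - fst v) snd" "corner_at V fst (\<lambda>v. n - snd v)"
    using assms unfolding corner_VI_def by blast+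
  show "0 < snd v \<and> snd v < n" if "v \<in> V" "fst v = 0" for v
    using corner_at_pos(2)[OF C(1) that(1)] corner_at_pos(2)[OF C(2) that(1)] that(2) by simp
qed (use assms in \<open>unfold corner_VI_def, blast+\<close>)

text \<open>The shear (x, y) to (x, y - x) keeps the corner at the origin. A vertex on the left that
  then lies above height n makes (0, n) the second corner of a half-strip; otherwise the height is
  at most n everywhere, and the configuration is that of type V.\<close>

lemma corner_VI_left:
  assumes n: "3 \<le> n" and V: "corner_VI n V" and LL: "v \<in> V" "fst v < 0" "snd v < fst v"
    and UR: "\<And>v. v \<in> V \<Longrightarrow> 0 < fst v \<Longrightarrow> snd v \<le> n + fst v"
  shows "vertex_bounds n V"
proof -
  note D = corner_VI_D[OF V]
  have C: "corner_at V (\<lambda>v. - fst v) (\<lambda>v. snd v - fst v)"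
    by (rule corner_at_commute[OF corner_at_add[OF corner_at_commute[OF D(2)] LL(1)]]) (use LL in auto)
  obtain t where t: "t \<in> V" "n < snd t" using D(5) by blast
  then have t0: "0 < fst t" using corner_at_pos(1)[OF D(3) t(1)] by simp
  show ?thesis
  proof (cases "\<exists>u\<in>V. fst u < 0 \<and> n + fst u < snd u")
    case True
    then obtain u where u: "u \<in> V" "fst u < 0" "n + fst u < snd u" by blast
    obtain \<alpha> \<beta> :: real where ab: "0 < \<alpha>" "0 < \<beta>" "\<And>v. v \<in> V \<Longrightarrow> 0 < \<alpha> * of_int (fst v) + \<beta> * of_int (n - snd v)"
      using D(3) unfolding corner_at_def by blast
    have "corner_at V (\<lambda>v. n - (snd v - fst v)) (\<lambda>v. - fst v)"
    proof (rule corner_at_slope[OF ab(2) _ u(1)])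
      show "0 < \<beta> * of_int (n - (snd v - fst v)) + (\<beta> - \<alpha>) * of_int (- fst v)" if "v \<in> V" for v
        using ab(3)[OF that] by (simp add: algebra_simps)
    qed (use u in auto)
    then have C2: "corner_at V (\<lambda>v. - fst v) (\<lambda>v. n - (snd v - fst v))" by (rule corner_at_commute)
    show ?thesis
    proof (rule half_strip_bounds[OF n D(1), of 1 1 0 "-1" "\<lambda>v. fst v + n" 1 "\<lambda>v. snd v - fst v" 0])
      show "corner_at V (\<lambda>v. n - (fst v + n)) (\<lambda>v. snd v - fst v)" using C by simp
      show "corner_at V (\<lambda>v. n - (fst v + n)) (\<lambda>v. n - (snd v - fst v))" using C2 by simp
      show "\<exists>v\<in>V. n < fst v + n" using t t0 by (intro bexI[of _ t]) simp
      show "\<exists>v\<in>V. snd v - fst v < 0" using LL by (intro bexI[of _ v]) simp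
      show "\<exists>v\<in>V. n < snd v - fst v" using u by (intro bexI[of _ u]) simp
      show "0 \<le> fst v + n" if "v \<in> V" for v using D(6)[OF that] by simp
    qed simp_all
  next
    case False
    let ?T = "tf 1 0 (-1) 1 (n * 0) (n * 0)"
    have det: "\<bar>1 * 1 - 0 * (-1) :: int\<bar> = 1" by simp
    have "corner_at (?T ` V) (\<lambda>v. - fst v) snd" using C unfolding corner_at_def by simp
    moreover have "- n \<le> fst u \<and> snd u - fst u \<le> n" if "u \<in> V" for u
    proof -
      consider "0 < fst u" | "fst u = 0" | "fst u < 0" by linarith
      then have "snd u \<le> n + fst u"
        using UR[OF that] D(8)[OF that] False that by cases (auto simp: not_less)
      then show ?thesis using D(6)[OF that] by simp
    qed
    moreover have "\<exists>u\<in>V. snd u - fst u < 0" using LL by (intro bexI[of _ v]) simp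
    moreover have "\<exists>u\<in>V. 0 < fst u" using t t0 by blast
    ultimately have "corner_V n (?T ` V)" unfolding corner_V_def
      using free_config_tf[OF det D(1), of 0 0] by simp
    then show ?thesis by (rule vertex_bounds_tf[OF det corner_V_bounds[OF n]])
  qed
qed

text \<open>The parallelogram (-n,0), (0,0), (n,n), (0,n) is a square in the coordinates X and y.
  Whether V extends beyond X = 0 and beyond X = n decides between square, half-strip and strip; the
  corners (-n,0) and (n,n) come from the walls.\<close>

lemma corner_VI_middle:
  assumes n: "3 \<le> n" and V: "corner_VI n V"
    and LL: "\<And>v. v \<in> V \<Longrightarrow> fst v < 0 \<Longrightarrow> fst v \<le> snd v"
    and UR: "\<And>v. v \<in> V \<Longrightarrow> 0 < fst v \<Longrightarrow> snd v \<le> n + fst v"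
  shows "vertex_bounds n V"
proof -
  note D = corner_VI_D[OF V]
  obtain t s where t: "t \<in> V" "n < snd t" and s: "s \<in> V" "snd s < 0" using D(4,5) by blast
  define X where "X v = fst v - snd v + n" for v :: "int \<times> int"
  have neg: "0 \<le> n + fst v" if "v \<in> V" for v using D(6)[OF that] by simp
  have lo: "corner_at V X snd" "corner_at V X (\<lambda>v. n - snd v)" if w: "w \<in> V" "X w < 0" for w
  proof -
    have w0: "fst w < 0" using UR[OF w(1)] D(8)[OF w(1)] w(2) unfolding X_def by linarith
    obtain \<alpha> \<beta> :: real where "\<And>v. v \<in> V \<Longrightarrow> 0 < \<alpha> * of_int (fst v - n * (-1)) + \<beta> * of_int (snd v - n * 0)"
      using free_functional[OF D(1), of "-1" 0] by blast
    then have "\<exists>\<gamma>::real. \<forall>v\<in>V. 0 < of_int (fst v + n) + \<gamma> * of_int (snd v)"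
      by (intro wall_functional[of V \<alpha> _ \<beta> _ s t]) (use neg t s n in \<open>auto simp: algebra_simps\<close>)
    then obtain \<gamma> :: real where g: "\<And>v. v \<in> V \<Longrightarrow> 0 < of_int (fst v + n) + \<gamma> * of_int (snd v)" by blast
    show "corner_at V X snd"
    proof (rule corner_at_slope[of 1 V X "1 + \<gamma>" snd w])
      show "0 < 1 * real_of_int (X v) + (1 + \<gamma>) * of_int (snd v)" if "v \<in> V" for v
        using g[OF that] by (simp add: X_def algebra_simps)
    qed (use w D(6)[OF w(1)] in \<open>auto simp: X_def\<close>)
    show "corner_at V X (\<lambda>v. n - snd v)"
      by (rule corner_at_add[OF D(3) w(1)]) (use corner_at_pos(2)[OF D(3) w(1)] w w0 in \<open>auto simp: X_def\<close>)
  qed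
  have hi: "corner_at V (\<lambda>v. n - X v) snd" "corner_at V (\<lambda>v. n - X v) (\<lambda>v. n - snd v)" if w: "w \<in> V" "n < X w" for w
  proof -
    have w0: "0 < fst w" using LL[OF w(1)] D(8)[OF w(1)] w(2) unfolding X_def by linarith
    obtain \<alpha> \<beta> :: real where "\<And>v. v \<in> V \<Longrightarrow> 0 < \<alpha> * of_int (fst v - n * 1) + \<beta> * of_int (snd v - n * 1)"
      using free_functional[OF D(1), of 1 1] by blast
    then have "\<exists>\<gamma>::real. \<forall>v\<in>V. 0 < of_int (n - fst v) + \<gamma> * of_int (snd v - n)"
      by (intro wall_functional[of V "- \<alpha>" _ \<beta> _ s t]) (use D(7) t s n in \<open>auto simp: algebra_simps\<close>)
    then obtain \<gamma> :: real where g: "\<And>v. v \<in> V \<Longrightarrow> 0 < of_int (n - fst v) + \<gamma> * of_int (snd v - n)" by blast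
    show "corner_at V (\<lambda>v. n - X v) (\<lambda>v. n - snd v)"
    proof (rule corner_at_slope[of 1 V _ "1 - \<gamma>" _ w])
      show "0 < 1 * real_of_int (n - X v) + (1 - \<gamma>) * of_int (n - snd v)" if "v \<in> V" for v
        using g[OF that] by (simp add: X_def algebra_simps)
    qed (use w D(7)[OF w(1)] in \<open>auto simp: X_def\<close>)
    show "corner_at V (\<lambda>v. n - X v) snd"
      by (rule corner_at_add[OF D(2) w(1)]) (use corner_at_pos(2)[OF D(2) w(1)] w w0 in \<open>auto simp: X_def\<close>)
  qed
  have st: "\<exists>v\<in>V. snd v < 0" "\<exists>v\<in>V. n < snd v" using s t by blast+
  consider (both) u w where "u \<in> V" "X u < 0" "w \<in> V" "n < X w" | (right) w where "w \<in> V" "n < X w" "\<And>u. u \<in> V \<Longrightarrow> 0 \<le> X u"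
    | (left) u where "u \<in> V" "X u < 0" "\<And>w. w \<in> V \<Longrightarrow> X w \<le> n" | (none) "\<And>u. u \<in> V \<Longrightarrow> 0 \<le> X u \<and> X u \<le> n"
    by (metis not_less)
  then show ?thesis
  proof cases
    case both
    show ?thesis
      by (rule square_bounds[OF n D(1), of 1 1 "-1" 0 X 1 snd 0])
        (use both lo[OF both(1,2)] hi[OF both(3,4)] st in \<open>auto simp: X_def\<close>)
  next
    case right
    show ?thesis
      by (rule half_strip_bounds[OF n D(1), of 1 1 "-1" 0 X 1 snd 0])
        (use right hi[OF right(1,2)] st in \<open>auto simp: X_def\<close>)
  next
    case left
    show ?thesis
    proof (rule half_strip_bounds[OF n D(1), of "-1" 1 1 0 "\<lambda>v. n - X v" 0 snd 0])
      show "corner_at V (\<lambda>v. n - (n - X v)) snd" "corner_at V (\<lambda>v. n - (n - X v)) (\<lambda>v. n - snd v)"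
        using lo[OF left(1,2)] by simp_all
      show "\<exists>v\<in>V. n < n - X v" using left(1,2) by (intro bexI[of _ u]) simp
    qed (use left(3) st in \<open>auto simp: X_def\<close>)
  next
    case none
    show ?thesis by (rule strip_bounds[OF n D(1), of 1 1 "-1" 0 X 1 ]) (use none in \<open>auto simp: X_def\<close>)
  qed
qed

text \<open>Induction on the depth of the lowest vertex. With vertices below y = x on the left and
  above y = x + n on the right, the shear preserves both corners and raises the lowest vertex. If
  only the latter occur, the point reflection in (0, n/2) exchanges the two kinds.\<close>

lemma corner_VI_bounds:
  assumes n: "3 \<le> n" and V: "corner_VI n V"
  shows "vertex_bounds n V"
proof -
  have main: "vertex_bounds n V" if "corner_VI n V" "\<And>v. v \<in> V \<Longrightarrow> - snd v \<le> int k" for k V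
    using that
  proof (induction k arbitrary: V)
    case 0
    then show ?case using corner_VI_D(4)[OF 0(1)] by fastforce
  next
    case (Suc k)
    note D = corner_VI_D[OF Suc.prems(1)]
    show ?case
    proof (cases "\<exists>v\<in>V. fst v < 0 \<and> snd v < fst v")
      case LL: True
      then obtain v where v: "v \<in> V" "fst v < 0" "snd v < fst v" by blast
      show ?thesis
      proof (cases "\<exists>v\<in>V. 0 < fst v \<and> n + fst v < snd v")
        case True
        then obtain u where u: "u \<in> V" "0 < fst u" "n + fst u < snd u" by blast
        let ?T = "tf 1 0 (-1) 1 (n * 0) (n * 0)"
        have det: "\<bar>1 * 1 - 0 * (-1) :: int\<bar> = 1" by simp
        have "corner_at V (\<lambda>v. - fst v) (\<lambda>v. snd v - fst v)"
          by (rule corner_at_commute[OF corner_at_add[OF corner_at_commute[OF D(2)] v(1)]]) (use v in auto)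
        then have 1: "corner_at (?T ` V) (\<lambda>v. - fst v) snd" unfolding corner_at_def by simp
        have "corner_at V fst (\<lambda>v. n - (snd v - fst v))"
          by (rule corner_at_commute[OF corner_at_add[OF corner_at_commute[OF D(3)] u(1)]]) (use u in auto)
        then have 2: "corner_at (?T ` V) fst (\<lambda>v. n - snd v)" unfolding corner_at_def by simp
        have "\<exists>v\<in>V. snd v - fst v < 0" "\<exists>v\<in>V. n < snd v - fst v"
          using v u by (intro bexI[of _ v] bexI[of _ u]; simp)+
        then have 3: "corner_VI n (?T ` V)" unfolding corner_VI_def
          using free_config_tf[OF det D(1), of 0 0] 1 2 D(6,7) by simp
        have "fst w - snd w \<le> int k" if "w \<in> V" for w
        proof (cases "fst w < 0")
          case True
          then show ?thesis using Suc.prems(2)[OF that] by simp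
        next
          case False
          then have "fst w \<le> snd w"
            using below_left_or_right[OF D(2) v(1) that v(3,2)] D(8)[OF that] by linarith
          then show ?thesis by simp
        qed
        then have "vertex_bounds n (?T ` V)" by (intro Suc.IH[OF 3]) auto
        then show ?thesis by (rule vertex_bounds_tf[OF det])
      next
        case False
        then have "snd v \<le> n + fst v" if "v \<in> V" "0 < fst v" for v using that by (meson not_less)
        then show ?thesis by (rule corner_VI_left[OF n Suc.prems(1) v])
      qed
    next
      case LL: False
      then have LL': "fst v \<le> snd v" if "v \<in> V" "fst v < 0" for v using that by (meson not_less)
      show ?thesis
      proof (cases "\<exists>v\<in>V. 0 < fst v \<and> n + fst v < snd v")
        case True
        then obtain u where u: "u \<in> V" "0 < fst u" "n + fst u < snd u" by blast
        let ?T = "tf (-1) 0 0 (-1) (n * 0) (n * 1)"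
        have det: "\<bar>(-1) * (-1) - 0 * 0 :: int\<bar> = 1" by simp
        have 1: "corner_at (?T ` V) (\<lambda>v. - fst v) snd" "corner_at (?T ` V) fst (\<lambda>v. n - snd v)"
          unfolding corner_at_image using D(2,3) by simp_all
        have 2: "- n \<le> - fst u \<and> - fst u \<le> n" if "u \<in> V" for u using D(6,7)[OF that] by simp
        have 3: "corner_VI n (?T ` V)" unfolding corner_VI_def
          using free_config_tf[OF det D(1), of 0 1] 1 2 D(4,5) by simp
        have "vertex_bounds n (?T ` V)"
        proof (rule corner_VI_left[OF n 3])
          show "?T u \<in> ?T ` V" using u by blast
          show "fst (?T u) < 0" "snd (?T u) < fst (?T u)" using u by simp_all
          show "snd w \<le> n + fst w" if "w \<in> ?T ` V" "0 < fst w" for w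
            using that LL' by auto
        qed
        then show ?thesis by (rule vertex_bounds_tf[OF det])
      next
        case False
        then have "snd v \<le> n + fst v" if "v \<in> V" "0 < fst v" for v using that by (meson not_less)
        then show ?thesis using LL' by (intro corner_VI_middle[OF n Suc.prems(1)])
      qed
    qed
  qed
  have "finite V" using corner_VI_D(1)[OF V] unfolding free_config_def by auto
  then have "- snd v \<le> int (nat (Max ((\<lambda>v. - snd v) ` V)))" if "v \<in> V" for v
  proof -
    have "- snd v \<le> Max ((\<lambda>v. - snd v) ` V)" using \<open>finite V\<close> that by (intro Max_ge) auto
    then show ?thesis by simp
  qed
  then show ?thesis by (rule main[OF V])
qed

text \<open>In the coordinates x - y and y, the corners (0,0), (n,0), (n,n), (2n,n) are those of a
  square. If x - y never exceeds n, a half-strip remains. If it does so above the x-axis, all four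
  corners persist. If it does so on or below the axis, V passes around the triangle (0,0), (n,0),
  (n,n).\<close>

lemma corner_IV_bounds:
  assumes n: "3 \<le> n" and V: "free_config n V"
    and c1: "corner_at V fst snd" and c2: "corner_at V (\<lambda>v. n - fst v) snd"
    and c3: "corner_at V (\<lambda>v. fst v - n) (\<lambda>v. n - snd v)"
    and c4: "\<And>v. v \<in> V \<Longrightarrow> 0 < of_int (2 * n - fst v) + (\<beta>::real) * of_int (snd v - n)"
    and wall: "\<And>v. v \<in> V \<Longrightarrow> fst v < 2 * n"
    and ex: "\<exists>v\<in>V. fst v < 0" "\<exists>v\<in>V. snd v < 0" "\<exists>v\<in>V. n < snd v"
  shows "vertex_bounds n V"
proof -
  obtain v0 t where v0: "v0 \<in> V" "fst v0 < 0" and t: "t \<in> V" "n < snd t" using ex by blast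
  have v0': "0 < snd v0" "snd v0 < n" using corner_at_pos(2)[OF c1 v0(1)] corner_at_pos(2)[OF c3 v0(1)] v0 n by auto
  have d1: "corner_at V (\<lambda>v. fst v - snd v) snd" by (rule corner_at_diff[OF c1]) simp
  have d3: "corner_at V (\<lambda>v. fst v - snd v) (\<lambda>v. n - snd v)"
    by (rule corner_at_add[OF c3 v0(1)]) (use v0 v0' in auto)
  show ?thesis
  proof (cases "\<exists>v\<in>V. n < fst v - snd v")
    case False
    have 1: "0 \<le> n - fst v + snd v" if "v \<in> V" for v
    proof -
      have "\<not> n < fst v - snd v" using False that by blast
      then show ?thesis by simp
    qed
    show ?thesis
    proof (rule half_strip_bounds[OF n V, of "-1" 1 1 0 "\<lambda>v. n - fst v + snd v" 1 snd 0])
      show "corner_at V (\<lambda>v. n - (n - fst v + snd v)) snd" using d1 by simp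
      show "corner_at V (\<lambda>v. n - (n - fst v + snd v)) (\<lambda>v. n - snd v)" using d3 by simp
      show "\<exists>v\<in>V. n < n - fst v + snd v" using v0 v0' by (intro bexI[of _ v0]) simp
    qed (use 1 ex in simp_all)
  next
    case True
    then obtain v1 where v1: "v1 \<in> V" "n < fst v1 - snd v1" by blast
    show ?thesis
    proof (cases "0 < snd v1")
      case True
      show ?thesis
      proof (rule square_bounds[OF n V, of 1 1 "-1" 0 "\<lambda>v. fst v - snd v" 0 snd 0])
        show "corner_at V (\<lambda>v. n - (fst v - snd v)) snd"
          by (rule corner_at_add[OF c2 v1(1)]) (use v1 True in auto)
        show "corner_at V (\<lambda>v. n - (fst v - snd v)) (\<lambda>v. n - snd v)"
        proof (rule corner_at_slope[of 1 V _ "1 - \<beta>" _ v1])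
          show "0 < 1 * real_of_int (n - (fst v - snd v)) + (1 - \<beta>) * of_int (n - snd v)" if "v \<in> V" for v
            using c4[OF that] by (simp add: algebra_simps)
        qed (use v1 wall[OF v1(1)] in auto)
        show "\<exists>v\<in>V. fst v - snd v < 0" using v0 v0' by (intro bexI[of _ v0]) simp
        show "\<exists>v\<in>V. n < fst v - snd v" using v1 by blast
      qed (use d1 d3 ex in simp_all)
    next
      case False
      then have v1': "fst v1 < n" using corner_at_pos(1)[OF c2 v1(1)] by simp
      have d2: "corner_at V (\<lambda>v. n - fst v) (\<lambda>v. snd v - fst v + n)"
        by (rule corner_at_commute[OF corner_at_add[OF corner_at_commute[OF c2] v1(1)]]) (use v1 v1' in auto)
      have "\<exists>v\<in>V. n < fst v" using corner_at_pos(1)[OF c3 t(1)] t by (intro bexI[of _ t]) auto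
      moreover have "\<exists>v\<in>V. fst v < snd v" using v0 v0' by (intro bexI[of _ v0]) auto
      moreover have "\<exists>v\<in>V. snd v - fst v + n < 0" using v1 by (intro bexI[of _ v1]) auto
      ultimately show ?thesis
        by (intro theta_bounds[OF n V]) (use c1 d2 d3 ex in \<open>auto simp: corner_at_def\<close>)
    qed
  qed
qed

section \<open>Vertices of integer polygons\<close>

definition real_pt :: "int \<times> int \<Rightarrow> real^2" where
  "real_pt v = vector [of_int (fst v), of_int (snd v)]"

lemma real_pt_nth [simp]: "real_pt v $ 1 = of_int (fst v)" "real_pt v $ 2 = of_int (snd v)"
  unfolding real_pt_def by simp_all

lemma inj_real_pt: "inj real_pt"
  by (rule injI) (metis of_int_eq_iff prod_eqI real_pt_nth)

lemma range_real_pt: "range real_pt = scaled_lattice 1"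
proof -
  have "x \<in> range real_pt" if x: "x \<in> scaled_lattice 1" for x
  proof -
    have "\<exists>k::int. x $ i = of_int k" for i using x unfolding scaled_lattice_def by simp
    then obtain k l :: int where "x $ 1 = of_int k" "x $ 2 = of_int l" by metis
    then have "x = real_pt (k, l)" by (simp add: vec_eq_iff forall_2)
    then show ?thesis by blast
  qed
  moreover have "real_pt v \<in> scaled_lattice 1" for v
    unfolding scaled_lattice_def by (auto simp: forall_2)
  ultimately show ?thesis by blast
qed

lemma real_pt_scaled: "real_pt (int n * p, int n * q) \<in> scaled_lattice n"
  unfolding scaled_lattice_def by (auto simp: forall_2)

lemma inner_2: "x \<bullet> y = x $ 1 * y $ 1 + x $ 2 * y $ 2" for x y :: "real^2"
  by (simp add: inner_vec_def sum_2)

lemma separating_functional: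
  fixes S :: "(real^2) set"
  assumes "convex S" "closed S" "z \<notin> S"
  obtains \<alpha> \<beta> where "\<And>x. x \<in> S \<Longrightarrow> 0 < \<alpha> * (x $ 1 - z $ 1) + \<beta> * (x $ 2 - z $ 2)"
proof -
  obtain a b where ab: "a \<bullet> z < b" "\<And>x. x \<in> S \<Longrightarrow> b < a \<bullet> x"
    using separating_hyperplane_closed_point[OF assms] by blast
  have "0 < a $ 1 * (x $ 1 - z $ 1) + a $ 2 * (x $ 2 - z $ 2)" if "x \<in> S" for x
    using ab(1) ab(2)[OF that] by (simp add: inner_2 algebra_simps)
  then show ?thesis by (rule that)
qed

lemma polygon_facts:
  assumes "convex_polygon P"
  shows "compact P" "convex P" "interior P \<noteq> {}" "finite (vertices P)" "P = convex hull (vertices P)"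
proof -
  obtain W where W: "finite W" "P = convex hull W" and int: "interior P \<noteq> {}"
    using assms unfolding convex_polygon_def by blast
  show c: "compact P" "convex P" using W by (simp_all add: finite_imp_compact_convex_hull)
  show "interior P \<noteq> {}" by (rule int)
  have "vertices P \<subseteq> W" unfolding vertices_def using extreme_point_of_convex_hull W(2) by blast
  then show "finite (vertices P)" using W(1) finite_subset by blast
  show "P = convex hull (vertices P)" unfolding vertices_def by (rule Krein_Milman_Minkowski[OF c])
qed

definition int_vertices :: "(real^2) set \<Rightarrow> (int \<times> int) set" where
  "int_vertices P = real_pt -` vertices P"

lemma int_vertices:
  assumes "integer_polygon P"
  shows "real_pt ` int_vertices P = vertices P" "card (int_vertices P) = card (vertices P)" "finite (int_vertices P)"
proof -
  have P: "convex_polygon P" "vertices P \<subseteq> range real_pt"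
    using assms range_real_pt unfolding integer_polygon_def by auto
  show 1: "real_pt ` int_vertices P = vertices P"
    unfolding int_vertices_def image_vimage_eq by (rule Int_absorb2[OF P(2)])
  have i: "inj_on real_pt (int_vertices P)" by (rule inj_on_subset[OF inj_real_pt]) simp
  show "card (int_vertices P) = card (vertices P)" using card_image[OF i] 1 by simp
  show "finite (int_vertices P)" by (rule finite_imageD[OF _ i]) (simp add: 1 polygon_facts(4)[OF P(1)])
qed

lemma int_vertices_subset:
  assumes "integer_polygon P" "v \<in> int_vertices P"
  shows "real_pt v \<in> P"
  using assms(2) unfolding int_vertices_def vertices_def extreme_point_of_def by auto

text \<open>If all vertices lay in the convex complement of C, so would the polygon.\<close>

lemma int_vertices_witness:
  assumes P: "integer_polygon P" and x: "x \<in> P" and C: "convex (- C)" "x \<in> C"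
  shows "\<exists>v\<in>int_vertices P. real_pt v \<in> C"
proof (rule ccontr)
  assume neg: "\<not> ?thesis"
  have "vertices P \<subseteq> - C"
  proof
    fix y assume "y \<in> vertices P"
    then obtain v where "v \<in> int_vertices P" "y = real_pt v" using int_vertices(1)[OF P] by blast
    then show "y \<in> - C" using neg by blast
  qed
  then have "convex hull (vertices P) \<subseteq> - C" by (rule hull_minimal) (rule C)
  moreover have "convex hull (vertices P) = P"
    using polygon_facts(5) P unfolding integer_polygon_def by metis
  ultimately show False using x C(2) by blast
qed

text \<open>Removing an extreme point leaves a convex set, which contains the hull of the other
  vertices; separation from this closed hull gives the functional.\<close>

lemma int_vertices_convex_position:
  assumes P: "integer_polygon P"
  shows "convex_position (int_vertices P)"
  unfolding convex_position_def
proof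
  fix v assume v: "v \<in> int_vertices P"
  note PP = polygon_facts[OF conjunct1[OF P[unfolded integer_polygon_def]]]
  have "real_pt v extreme_point_of P" using v unfolding int_vertices_def vertices_def by simp
  then have "convex (P - {real_pt v})" using extreme_point_of_stillconvex[OF PP(2)] by blast
  then have "convex hull (vertices P - {real_pt v}) \<subseteq> P - {real_pt v}"
    by (intro hull_minimal) (auto simp: vertices_def extreme_point_of_def)
  then have "real_pt v \<notin> convex hull (vertices P - {real_pt v})" by blast
  moreover have "closed (convex hull (vertices P - {real_pt v}))"
    using PP(4) by (simp add: compact_imp_closed finite_imp_compact_convex_hull)
  ultimately obtain \<alpha> \<beta> where ab: "\<And>x. x \<in> convex hull (vertices P - {real_pt v}) \<Longrightarrow>
      0 < \<alpha> * (x $ 1 - real_pt v $ 1) + \<beta> * (x $ 2 - real_pt v $ 2)"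
    using separating_functional[OF convex_convex_hull] by metis
  have "0 < \<alpha> * of_int (fst w - fst v) + \<beta> * of_int (snd w - snd v)" if "w \<in> int_vertices P - {v}" for w
  proof -
    have "real_pt w \<in> vertices P - {real_pt v}"
      using that inj_real_pt unfolding int_vertices_def by (auto dest: injD)
    from ab[OF hull_inc[OF this]] show ?thesis by simp
  qed
  then show "\<exists>\<alpha> \<beta>::real. \<forall>w\<in>int_vertices P - {v}. 0 < \<alpha> * of_int (fst w - fst v) + \<beta> * of_int (snd w - snd v)"
    by blast
qed

lemma int_vertices_free:
  assumes "free_integer_polygon n P"
  shows "free_config (int n) (int_vertices P)"
  unfolding free_config_def
proof (intro conjI allI)
  have P: "integer_polygon P" and free: "P \<inter> scaled_lattice n = {}"
    using assms unfolding free_integer_polygon_def by auto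
  note PP = polygon_facts[OF conjunct1[OF P[unfolded integer_polygon_def]]]
  show "finite (int_vertices P)" "convex_position (int_vertices P)"
    using int_vertices(3)[OF P] int_vertices_convex_position[OF P] by auto
  fix p q
  have "real_pt (int n * p, int n * q) \<notin> P" using free real_pt_scaled by blast
  then obtain \<alpha> \<beta> where "\<And>x. x \<in> P \<Longrightarrow> 0 < \<alpha> * (x $ 1 - real_pt (int n * p, int n * q) $ 1)
      + \<beta> * (x $ 2 - real_pt (int n * p, int n * q) $ 2)"
    using separating_functional[OF PP(2) compact_imp_closed[OF PP(1)]] by metis
  from this[OF int_vertices_subset[OF P]] have "0 < \<alpha> * of_int (fst v - int n * p) + \<beta> * of_int (snd v - int n * q)"
    if "v \<in> int_vertices P" for v
    using that by simp
  then show "\<exists>\<alpha> \<beta>::real. \<forall>v\<in>int_vertices P. 0 < \<alpha> * of_int (fst v - int n * p) + \<beta> * of_int (snd v - int n * q)"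
    by blast
qed

section \<open>Splitting expressed by functionals on the vertices\<close>

lemma splits_imp_disconnected: "splits_polygon S P \<Longrightarrow> \<not> connected (P - S)"
proof
  assume "splits_polygon S P" "connected (P - S)"
  then obtain A B where "components (P - S) = {A, B}" "A \<noteq> B" unfolding splits_polygon_def by blast
  moreover from calculation(1) have "P - S \<noteq> {}" by (metis components_eq_empty insert_not_empty)
  then have "components (P - S) = {P - S}"
    using \<open>connected (P - S)\<close> by (simp add: components_eq_sing_iff)
  ultimately have "{A, B} = {P - S}" "A \<noteq> B" by simp_all
  then show False by (metis insertI1 insertI2 singletonD)
qed

lemma convex_coordinate:
  "convex {x::real^2. x $ k \<le> r}" "convex {x::real^2. r \<le> x $ k}"
  "convex (- {x::real^2. x $ k < r})" "convex (- {x::real^2. r < x $ k})"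
  "convex {x::real^2. x $ k < r}" "convex {x::real^2. r < x $ k}"
proof -
  show 1: "convex {x::real^2. x $ k \<le> r}" "convex {x::real^2. r \<le> x $ k}"
    using convex_halfspace_le[of "axis k 1 :: real^2" r] convex_halfspace_ge[of r "axis k 1 :: real^2"]
    by (simp_all add: inner_axis')
  moreover have "- {x::real^2. x $ k < r} = {x. r \<le> x $ k}" "- {x::real^2. r < x $ k} = {x. x $ k \<le> r}" by auto
  ultimately show "convex (- {x::real^2. x $ k < r})" "convex (- {x::real^2. r < x $ k})" by simp_all
  show "convex {x::real^2. x $ k < r}" "convex {x::real^2. r < x $ k}"
    using convex_halfspace_lt[of "axis k 1 :: real^2" r] convex_halfspace_gt[of r "axis k 1 :: real^2"]
    by (simp_all add: inner_axis')
qed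

text \<open>Were the chord not covered by \<open>S\<close>, then \<open>P - S\<close> would be a union of stars, centred at
  the uncovered points of the chord, that share all points outside the line.\<close>

lemma split_chord:
  fixes P :: "(real^2) set"
  assumes P: "convex P" "interior P \<noteq> {}" and S: "S \<subseteq> {x. x $ k = r}" and spl: "\<not> connected (P - S)"
  shows "P \<inter> {x. x $ k = r} \<subseteq> S" "\<exists>x\<in>P. x $ k < r" "\<exists>x\<in>P. r < x $ k"
proof -
  let ?A = "P \<inter> {x. x $ k < r}" and ?B = "P \<inter> {x. r < x $ k}"
  have cA: "convex ?A" "convex ?B" by (intro convex_Int P(1) convex_coordinate)+
  show 1: "P \<inter> {x. x $ k = r} \<subseteq> S"
  proof (rule ccontr)
    assume "\<not> ?thesis"
    then obtain s where s: "s \<in> P" "s $ k = r" "s \<notin> S" by blast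
    let ?R = "{x \<in> P. x $ k = r \<and> x \<notin> S}"
    have "\<not> interior P \<subseteq> {x. x $ k = r}"
    proof
      assume "interior P \<subseteq> {x. x $ k = r}"
      then have "interior P \<subseteq> interior {x. x $ k = r}" by (rule interior_maximal[OF _ open_interior])
      moreover have "interior {x::real^2. x $ k = r} = {}"
        using interior_hyperplane[of "axis k 1 :: real^2" r] by (simp add: inner_axis' axis_eq_0_iff)
      ultimately show False using P(2) by blast
    qed
    then obtain m where m: "m \<in> P" "m $ k \<noteq> r" using interior_subset by blast
    define C where "C t = insert t {x \<in> P. x $ k \<noteq> r}" for t
    have "connected (C t)" if t: "t \<in> ?R" for t
    proof (rule starlike_imp_connected)
      have "closed_segment t x \<subseteq> C t" if x: "x \<in> C t" for x
      proof
        fix y assume y: "y \<in> closed_segment t x"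
        then obtain u where u: "y = (1 - u) *\<^sub>R t + u *\<^sub>R x" by (auto simp: in_segment)
        have "x \<in> P" using x t unfolding C_def by blast
        then have "y \<in> P" using y t closed_segment_subset[OF _ _ P(1)] by blast
        moreover have "y = t" if "y $ k = r"
        proof -
          have "u * (x $ k - r) = 0" using that t by (simp add: u algebra_simps)
          moreover have "x = t" if "x $ k = r" using that x unfolding C_def by blast
          ultimately have "u = 0 \<or> x = t" by auto
          then show ?thesis unfolding u by (auto simp: algebra_simps)
        qed
        ultimately show "y \<in> C t" unfolding C_def by blast
      qed
      then show "starlike (C t)" using t unfolding starlike_def C_def by blast
    qed
    moreover have "m \<in> \<Inter> (C ` ?R)" using m unfolding C_def by blast
    ultimately have "connected (\<Union> (C ` ?R))" by (intro connected_Union) blast+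
    moreover have "x \<in> \<Union> (C ` ?R) \<longleftrightarrow> x \<in> P - S" for x
    proof
      assume "x \<in> \<Union> (C ` ?R)"
      then obtain t where "t \<in> ?R" "x \<in> C t" by blast
      then show "x \<in> P - S" using S unfolding C_def by (cases "x = t") auto
    next
      assume "x \<in> P - S"
      then show "x \<in> \<Union> (C ` ?R)" using s unfolding C_def by (cases "x $ k = r") auto
    qed
    then have "\<Union> (C ` ?R) = P - S" by (rule set_eqI)
    ultimately show False using spl by metis
  qed
  have "P - S = ?A \<union> ?B" using 1 S by force
  then have "?A \<noteq> {}" "?B \<noteq> {}"
    using spl convex_connected[OF cA(1)] convex_connected[OF cA(2)] by (metis sup_bot_left, metis sup_bot_right)
  then show "\<exists>x\<in>P. x $ k < r" "\<exists>x\<in>P. r < x $ k" by blast+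
qed

text \<open>On the line through e in direction j the separating functional depends only on the j-th
  coordinate, so the point c of P on this line determines the sign of that coefficient, which is
  then normalised.\<close>

lemma side_functional:
  fixes P :: "(real^2) set"
  assumes P: "convex P" "closed P" and e: "e \<notin> P" and c: "c \<in> P" "c $ k = e $ k" "0 < \<sigma> * (c $ j - e $ j)"
    and kj: "k \<noteq> j" and \<sigma>: "\<sigma> = 1 \<or> \<sigma> = - 1"
  shows "\<exists>\<beta>. \<forall>x\<in>P. 0 < \<sigma> * (x $ j - e $ j) + \<beta> * (x $ k - e $ k)"
proof -
  obtain \<alpha>1 \<alpha>2 where a: "\<And>x. x \<in> P \<Longrightarrow> 0 < \<alpha>1 * (x $ 1 - e $ 1) + \<alpha>2 * (x $ 2 - e $ 2)"
    using separating_functional[OF P e] by blast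
  have "\<exists>\<alpha> \<beta>. \<forall>x\<in>P. 0 < \<alpha> * (x $ j - e $ j) + \<beta> * (x $ k - e $ k)"
  proof (cases "k = 1")
    case True
    then have "j = 2" using kj exhaust_2 by metis
    show ?thesis by (rule exI[of _ \<alpha>2], rule exI[of _ \<alpha>1]) (use a True \<open>j = 2\<close> in \<open>simp add: add.commute\<close>)
  next
    case False
    then have "k = 2" "j = 1" using kj exhaust_2 by metis+
    show ?thesis by (rule exI[of _ \<alpha>1], rule exI[of _ \<alpha>2]) (use a \<open>k = 2\<close> \<open>j = 1\<close> in simp)
  qed
  then obtain \<alpha> \<beta> where ab: "\<And>x. x \<in> P \<Longrightarrow> 0 < \<alpha> * (x $ j - e $ j) + \<beta> * (x $ k - e $ k)" by blast
  have "(\<sigma> * \<alpha>) * (\<sigma> * (c $ j - e $ j)) = \<alpha> * (c $ j - e $ j)" using \<sigma> by (elim disjE) (simp_all add: algebra_simps)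
  moreover have "0 < \<alpha> * (c $ j - e $ j)" using ab[OF c(1)] c(2) by simp
  ultimately have "0 < (\<sigma> * \<alpha>) * (\<sigma> * (c $ j - e $ j))" by metis
  then have pos: "0 < \<sigma> * \<alpha>" using c(3) by (rule zero_less_mult_pos2)
  have "0 < \<sigma> * (x $ j - e $ j) + \<beta> / (\<sigma> * \<alpha>) * (x $ k - e $ k)" if "x \<in> P" for x
  proof -
    have "0 < (\<alpha> * (x $ j - e $ j) + \<beta> * (x $ k - e $ k)) / (\<sigma> * \<alpha>)"
      by (rule divide_pos_pos[OF ab[OF that] pos])
    also have "\<dots> = \<sigma> * (x $ j - e $ j) + \<beta> / (\<sigma> * \<alpha>) * (x $ k - e $ k)"
      using \<sigma> pos by (auto simp: field_simps)
    finally show ?thesis .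
  qed
  then show ?thesis by blast
qed

text \<open>The chord of P on the line of the segment is nonempty and lies in the segment, whose
  ends are outside P. A point of the chord is therefore strictly between p and q and serves as c in
  \<open>side_functional\<close> for both ends.\<close>

lemma split_sides:
  assumes P: "convex_polygon P" and pq: "p \<notin> P" "q \<notin> P" "p $ k = r" "q $ k = r" "p $ j < q $ j" and kj: "k \<noteq> j"
    and spl: "splits_polygon (closed_segment p q) P"
  shows "\<exists>x\<in>P. x $ k < r" "\<exists>x\<in>P. r < x $ k"
    "\<exists>\<beta>. \<forall>x\<in>P. 0 < (x $ j - p $ j) + \<beta> * (x $ k - r)"
    "\<exists>\<beta>. \<forall>x\<in>P. 0 < (q $ j - x $ j) + \<beta> * (x $ k - r)"
proof -
  note PP = polygon_facts[OF P]
  have S: "closed_segment p q \<subseteq> {x. x $ k = r}"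
  proof
    fix x assume "x \<in> closed_segment p q"
    then obtain u where "x = (1 - u) *\<^sub>R p + u *\<^sub>R q" by (auto simp: in_segment)
    then have "x $ k = (1 - u) * r + u * r" using pq(3,4) by simp
    then show "x \<in> {x. x $ k = r}" by (simp add: algebra_simps)
  qed
  note ch = split_chord[OF PP(2,3) S splits_imp_disconnected[OF spl]]
  show "\<exists>x\<in>P. x $ k < r" "\<exists>x\<in>P. r < x $ k" by (fact ch)+
  obtain x y where xy: "x \<in> P" "x $ k \<le> r" "y \<in> P" "r \<le> y $ k" using ch(2,3) by (meson less_imp_le)
  obtain c where c: "c \<in> P" "c $ k = r"
    using connected_ivt_component_cart[OF convex_connected[OF PP(2)] xy(1,3,2,4)] by blast
  then have "c \<in> closed_segment p q" using ch(1) by blast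
  then obtain u where u: "c = (1 - u) *\<^sub>R p + u *\<^sub>R q" "0 \<le> u" "u \<le> 1" by (auto simp: in_segment)
  have "u \<noteq> 0" "u \<noteq> 1" using u(1) c(1) pq(1,2) by auto
  then have u01: "0 < u" "0 < 1 - u" using u by auto
  have "c $ j - p $ j = u * (q $ j - p $ j)" "q $ j - c $ j = (1 - u) * (q $ j - p $ j)"
    unfolding u(1) by (simp_all add: algebra_simps)
  then have cj: "0 < c $ j - p $ j" "0 < q $ j - c $ j" using u01 pq(5) by simp_all
  show "\<exists>\<beta>. \<forall>x\<in>P. 0 < (x $ j - p $ j) + \<beta> * (x $ k - r)"
    using side_functional[OF PP(2) compact_imp_closed[OF PP(1)] pq(1) c(1), of k 1 j] c(2) pq(3) cj(1) kj by simp
  show "\<exists>\<beta>. \<forall>x\<in>P. 0 < (q $ j - x $ j) + \<beta> * (x $ k - r)"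
    using side_functional[OF PP(2) compact_imp_closed[OF PP(1)] pq(2) c(1), of k "-1" j] c(2) pq(4) cj(2) kj by simp
qed

text \<open>The point X = Y = 0 is separated from V with positive coefficient of X, normalised to
  one. The sign of \<beta>, still open here, is what \<open>corner_at\<close> settles.\<close>

definition beside :: "(int \<times> int) set \<Rightarrow> (int \<times> int \<Rightarrow> int) \<Rightarrow> (int \<times> int \<Rightarrow> int) \<Rightarrow> bool" where
  "beside V X Y \<longleftrightarrow> (\<exists>\<beta>::real. \<forall>v\<in>V. 0 < of_int (X v) + \<beta> * of_int (Y v))"

text \<open>What is kept of a splitting segment that runs along Y = 0 from X = 0 to X = n.\<close>

definition side_split :: "int \<Rightarrow> (int \<times> int) set \<Rightarrow> (int \<times> int \<Rightarrow> int) \<Rightarrow> (int \<times> int \<Rightarrow> int) \<Rightarrow> bool" where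
  "side_split n V X Y \<longleftrightarrow> (\<exists>v\<in>V. Y v < 0) \<and> (\<exists>v\<in>V. 0 < Y v) \<and> beside V X Y \<and> beside V (\<lambda>v. n - X v) Y"

definition coord :: "2 \<Rightarrow> int \<times> int \<Rightarrow> int" where
  "coord k v = (if k = 1 then fst v else snd v)"

lemma real_pt_coord: "real_pt v $ k = of_int (coord k v)"
  using exhaust_2[of k] unfolding coord_def by auto

lemma splits_imp_side_split:
  assumes P: "integer_polygon P" and out: "real_pt p \<notin> P" "real_pt q \<notin> P" and n: "0 < n" and kj: "k \<noteq> j"
    and pq: "coord k q = coord k p" "coord j q = coord j p + n"
    and spl: "splits_polygon (closed_segment (real_pt p) (real_pt q)) P"
  shows "side_split n (int_vertices P) (\<lambda>v. coord j v - coord j p) (\<lambda>v. coord k v - coord k p)"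
proof -
  have cP: "convex_polygon P" using P unfolding integer_polygon_def by auto
  let ?r = "of_int (coord k p) :: real"
  have lt: "real_pt p $ j < real_pt q $ j" using pq(2) n by (simp add: real_pt_coord)
  have k: "real_pt p $ k = ?r" "real_pt q $ k = ?r" using pq(1) by (simp_all add: real_pt_coord)
  note ss = split_sides[OF cP out k lt kj spl]
  have "\<exists>v\<in>int_vertices P. real_pt v \<in> {x. x $ k < ?r}" "\<exists>v\<in>int_vertices P. real_pt v \<in> {x. ?r < x $ k}"
    using ss(1,2) int_vertices_witness[OF P _ convex_coordinate(3)] int_vertices_witness[OF P _ convex_coordinate(4)]
    by blast+
  then have 1: "\<exists>v\<in>int_vertices P. coord k v - coord k p < 0" "\<exists>v\<in>int_vertices P. 0 < coord k v - coord k p"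
    by (simp_all add: real_pt_coord)
  obtain \<beta> \<gamma> where b: "\<And>x. x \<in> P \<Longrightarrow> 0 < (x $ j - real_pt p $ j) + \<beta> * (x $ k - ?r)"
    and c: "\<And>x. x \<in> P \<Longrightarrow> 0 < (real_pt q $ j - x $ j) + \<gamma> * (x $ k - ?r)"
    using ss(3,4) by blast
  have "0 < of_int (coord j v - coord j p) + \<beta> * of_int (coord k v - coord k p)" if "v \<in> int_vertices P" for v
    using b[OF int_vertices_subset[OF P that]] by (simp add: real_pt_coord)
  moreover have "0 < of_int (n - (coord j v - coord j p)) + \<gamma> * of_int (coord k v - coord k p)"
    if "v \<in> int_vertices P" for v
    using c[OF int_vertices_subset[OF P that]] pq(2) by (simp add: real_pt_coord algebra_simps)
  ultimately show ?thesis using 1 unfolding side_split_def beside_def by blast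
qed

lemma seg_real_pt: "seg n a b c d = closed_segment (real_pt (int n * a, int n * b)) (real_pt (int n * c, int n * d))"
  unfolding seg_def real_pt_def by (simp add: mult.commute)

lemma seg_imp_side_split:
  assumes P: "free_integer_polygon n P" and n: "0 < n"
  shows "splits_polygon (seg n a b (a + 1) b) P \<Longrightarrow>
      side_split (int n) (int_vertices P) (\<lambda>v. fst v - int n * a) (\<lambda>v. snd v - int n * b)"
    "splits_polygon (seg n a b a (b + 1)) P \<Longrightarrow>
      side_split (int n) (int_vertices P) (\<lambda>v. snd v - int n * b) (\<lambda>v. fst v - int n * a)"
proof -
  have iP: "integer_polygon P" and free: "P \<inter> scaled_lattice n = {}"
    using P unfolding free_integer_polygon_def by auto
  have out: "real_pt (int n * a, int n * b) \<notin> P" for a b using free real_pt_scaled by blast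
  show "splits_polygon (seg n a b (a + 1) b) P \<Longrightarrow>
      side_split (int n) (int_vertices P) (\<lambda>v. fst v - int n * a) (\<lambda>v. snd v - int n * b)"
    using splits_imp_side_split[OF iP out[of a b] out[of "a + 1" b], of "int n" 2 1] n
    by (simp add: seg_real_pt coord_def distrib_left)
  show "splits_polygon (seg n a b a (b + 1)) P \<Longrightarrow>
      side_split (int n) (int_vertices P) (\<lambda>v. snd v - int n * b) (\<lambda>v. fst v - int n * a)"
    using splits_imp_side_split[OF iP out[of a b] out[of a "b + 1"], of "int n" 1 2] n
    by (simp add: seg_real_pt coord_def distrib_left)
qed

text \<open>If P had points strictly on both sides, its two open halves would be nonempty and
  convex, hence the two components of the complement of the line in P. Each meets the interior of P,
  because this interior is dense in P.\<close>

lemma not_splits_line: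
  fixes P :: "(real^2) set"
  assumes P: "convex P" "interior P \<noteq> {}" and spl: "\<not> splits_polygon {x. x $ k = r} P"
  shows "(\<forall>x\<in>P. x $ k \<le> r) \<or> (\<forall>x\<in>P. r \<le> x $ k)"
proof (rule ccontr)
  assume "\<not> ?thesis"
  then obtain x y where xy: "x \<in> P" "r < x $ k" "y \<in> P" "y $ k < r" by (meson not_less)
  let ?L = "{x::real^2. x $ k < r}" and ?R = "{x::real^2. r < x $ k}"
  let ?A = "P \<inter> ?L" and ?B = "P \<inter> ?R"
  have op: "open ?L" "open ?R" by (simp_all add: open_halfspace_component_lt_cart open_halfspace_component_gt_cart)
  have disj: "?L \<inter> ?R = {}" by auto
  have conn: "connected ?A" "connected ?B"
    by (intro convex_connected convex_Int P(1) convex_coordinate)+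
  have un: "P - {x. x $ k = r} = ?A \<union> ?B" by force
  have int: "interior (P \<inter> H) \<noteq> {}" if "open H" "z \<in> P" "z \<in> H" for H z
  proof -
    have "z \<in> closure (interior P)" using convex_closure_interior[OF P] that(2) closure_subset by blast
    then have "H \<inter> interior P \<noteq> {}" using that(1,3) by (auto simp: closure_iff_nhds_not_empty)
    then show ?thesis using that(1) by (simp add: interior_Int interior_open Int_commute)
  qed
  have comp: "C \<in> components (C \<union> D)" if "connected C" "C \<subseteq> H" "D \<subseteq> K" "open H" "open K" "H \<inter> K = {}" "C \<noteq> {}"
    for C D H K :: "(real^2) set"
    unfolding in_components_maximal
  proof (intro conjI allI impI)
    fix E assume E: "E \<noteq> {} \<and> C \<subseteq> E \<and> E \<subseteq> C \<union> D \<and> connected E"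
    have "K \<inter> E = {}"
    proof (rule ccontr)
      assume "K \<inter> E \<noteq> {}"
      moreover have "H \<inter> E \<noteq> {}" using E that by blast
      moreover have "E \<subseteq> H \<union> K" using E that by blast
      ultimately show False using connectedD[of E H K] E that by blast
    qed
    then show "E = C" using E that by blast
  qed (use that in auto)
  have A: "?A \<in> components (?A \<union> ?B)" using xy by (intro comp[OF conn(1) _ _ op disj]) auto
  have "?B \<in> components (?B \<union> ?A)" using xy disj by (intro comp[OF conn(2) _ _ op(2,1)]) auto
  then have B: "?B \<in> components (?A \<union> ?B)" by (simp only: Un_commute)
  have "C = ?A \<or> C = ?B" if "C \<in> components (?A \<union> ?B)" for C
  proof -
    have "C \<noteq> {}" "C \<subseteq> ?A \<union> ?B" using that in_components_nonempty in_components_subset by blast+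
    then have "C \<inter> ?A \<noteq> {} \<or> C \<inter> ?B \<noteq> {}" by blast
    then show ?thesis using components_eq[OF that A] components_eq[OF that B] by blast
  qed
  then have "components (P - {x. x $ k = r}) = {?A, ?B}" unfolding un using A B by blast
  moreover have "?A \<noteq> ?B" using xy(3,4) disj by blast
  moreover have "interior ?A \<noteq> {}" "interior ?B \<noteq> {}" using int op xy by blast+
  ultimately show False using spl unfolding splits_polygon_def by blast
qed

text \<open>For first invariant factor 1, m is the absolute value of the determinant. Determinants
  of lattice vectors are multiples of it, and the adjugate matrix shows that all multiples of m are
  in the lattice.\<close>

lemma has_invariant_factors_sublattice:
  assumes "has_invariant_factors L 1 m"
  shows "sublattice m {v. real_pt v \<in> L}"
proof -
  obtain A :: "int^2^2" where det: "det A \<noteq> 0" and L: "L = range (\<lambda>z::int^2. \<chi> i. real_of_int ((A *v z) $ i))"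
    and m: "m = \<bar>det A\<bar>"
    using assms unfolding has_invariant_factors_def by auto
  let ?a = "A $ 1 $ 1" and ?b = "A $ 1 $ 2" and ?c = "A $ 2 $ 1" and ?d = "A $ 2 $ 2"
  have mem: "real_pt v \<in> L \<longleftrightarrow> (\<exists>x y. v = (?a * x + ?b * y, ?c * x + ?d * y))" for v
  proof
    assume "real_pt v \<in> L"
    then obtain z where z: "real_pt v = (\<chi> i. real_of_int ((A *v z) $ i))" unfolding L by blast
    have "real_pt v $ i = real_of_int ((A *v z) $ i)" for i unfolding z by simp
    from this[of 1] this[of 2] have "fst v = (A *v z) $ 1" "snd v = (A *v z) $ 2" by simp_all
    then have "v = (?a * z $ 1 + ?b * z $ 2, ?c * z $ 1 + ?d * z $ 2)"
      by (simp add: prod_eq_iff matrix_vector_mult_def sum_2)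
    then show "\<exists>x y. v = (?a * x + ?b * y, ?c * x + ?d * y)" by blast
  next
    assume "\<exists>x y. v = (?a * x + ?b * y, ?c * x + ?d * y)"
    then obtain x y where v: "v = (?a * x + ?b * y, ?c * x + ?d * y)" by blast
    have "real_pt v = (\<chi> i. real_of_int ((A *v vector [x, y]) $ i))"
      by (simp add: v vec_eq_iff forall_2 matrix_vector_mult_def sum_2)
    then show "real_pt v \<in> L" unfolding L by blast
  qed
  have m': "m = \<bar>?a * ?d - ?b * ?c\<bar>" unfolding m det_2 by simp
  show ?thesis
    unfolding sublattice_def
  proof (intro conjI ballI allI)
    fix e f assume "e \<in> {v. real_pt v \<in> L}" "f \<in> {v. real_pt v \<in> L}"
    then obtain x y z w where e: "e = (?a * x + ?b * y, ?c * x + ?d * y)" and f: "f = (?a * z + ?b * w, ?c * z + ?d * w)"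
      unfolding mem mem_Collect_eq by blast
    have "e - f = (?a * (x - z) + ?b * (y - w), ?c * (x - z) + ?d * (y - w))"
      unfolding e f by (simp add: algebra_simps)
    then show "e - f \<in> {v. real_pt v \<in> L}" unfolding mem mem_Collect_eq by blast
    have "det2 e f = (?a * ?d - ?b * ?c) * (x * w - y * z)"
      unfolding e f det2_def by (simp add: algebra_simps)
    then show "m dvd det2 e f" unfolding m' by simp
  next
    fix p q
    define s where "s = sgn (?a * ?d - ?b * ?c)"
    have s: "m = s * (?a * ?d - ?b * ?c)" unfolding m' s_def by (simp add: abs_sgn mult.commute)
    \<comment> \<open>The coefficients are the adjugate matrix applied to (p, q), with s correcting
      the sign of the determinant.\<close>
    have "(m * p, m * q) = (?a * (s * (?d * p - ?b * q)) + ?b * (s * (?a * q - ?c * p)),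
        ?c * (s * (?d * p - ?b * q)) + ?d * (s * (?a * q - ?c * p)))"
      unfolding s by (simp add: algebra_simps)
    then show "(m * p, m * q) \<in> {v. real_pt v \<in> L}" unfolding mem mem_Collect_eq by blast
  qed
qed

lemma not_splits_line_vertices:
  assumes P: "integer_polygon P" and spl: "\<not> splits_polygon {x. x $ k = of_int r} P"
  shows "(\<forall>v\<in>int_vertices P. coord k v \<le> r) \<or> (\<forall>v\<in>int_vertices P. r \<le> coord k v)"
proof -
  note PP = polygon_facts[OF conjunct1[OF P[unfolded integer_polygon_def]]]
  have "(\<forall>v\<in>int_vertices P. real_pt v $ k \<le> of_int r) \<or> (\<forall>v\<in>int_vertices P. of_int r \<le> real_pt v $ k)"
    using not_splits_line[OF PP(2,3) spl] int_vertices_subset[OF P] by blast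
  then show ?thesis by (simp add: real_pt_coord)
qed

lemma disjoint_line_vertices:
  assumes P: "integer_polygon P" and L: "P \<inter> {x. x $ k = of_int r} = {}"
  shows "(\<forall>v\<in>int_vertices P. coord k v < r) \<or> (\<forall>v\<in>int_vertices P. r < coord k v)"
proof (rule ccontr)
  note PP = polygon_facts[OF conjunct1[OF P[unfolded integer_polygon_def]]]
  assume "\<not> ?thesis"
  then obtain v w where vw: "v \<in> int_vertices P" "r \<le> coord k v" "w \<in> int_vertices P" "coord k w \<le> r"
    by (meson not_less)
  have "\<exists>x\<in>P. x $ k = of_int r"
    by (rule connected_ivt_component_cart[OF convex_connected[OF PP(2)]
          int_vertices_subset[OF P vw(3)] int_vertices_subset[OF P vw(1)]])
      (use vw in \<open>simp_all add: real_pt_coord\<close>)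
  then show False using L by blast
qed

lemma besideD:
  assumes "beside V X Y" "\<And>v. Y' v = - Y v"
  shows "beside V X Y'"
proof -
  obtain \<beta> :: real where b: "\<And>v. v \<in> V \<Longrightarrow> 0 < of_int (X v) + \<beta> * of_int (Y v)" using assms(1) unfolding beside_def by blast
  then have "0 < of_int (X v) + (- \<beta>) * of_int (Y' v)" if "v \<in> V" for v using that by (simp add: assms(2))
  then show ?thesis unfolding beside_def by blast
qed

lemma corner_at_beside:
  assumes "beside V X Y" "beside V Y X" "\<exists>v\<in>V. X v < 0" "\<exists>v\<in>V. 0 < X v"
  shows "corner_at V X Y"
proof -
  obtain \<beta> \<delta> :: real where b: "\<And>v. v \<in> V \<Longrightarrow> 0 < of_int (X v) + \<beta> * of_int (Y v)"
    and d: "\<And>v. v \<in> V \<Longrightarrow> 0 < of_int (Y v) + \<delta> * of_int (X v)"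
    using assms(1,2) unfolding beside_def by blast
  show ?thesis using assms(3,4) corner_at_of_sides[of V X \<beta> Y \<delta>] b d by blast
qed

lemma side_splitD:
  assumes "side_split n V X Y"
  shows "\<exists>v\<in>V. Y v < 0" "\<exists>v\<in>V. 0 < Y v" "beside V X Y" "beside V (\<lambda>v. n - X v) Y"
  using assms unfolding side_split_def by blast+

lemma corner_sides:
  assumes bottom: "side_split n V fst snd" and left: "side_split n V snd fst"
  shows "corner_at V fst snd"
  by (rule corner_at_beside[OF side_splitD(3)[OF bottom] side_splitD(3)[OF left] side_splitD(1,2)[OF left]])

lemma corner_sides_bottom_right:
  assumes bottom: "side_split n V fst snd" and right: "side_split n V snd (\<lambda>v. fst v - n)"
  shows "corner_at V (\<lambda>v. n - fst v) snd"
proof (rule corner_at_beside[OF side_splitD(4)[OF bottom]])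
  show "beside V snd (\<lambda>v. n - fst v)" by (rule besideD[OF side_splitD(3)[OF right]]) simp
qed (use side_splitD(1,2)[OF right] in auto)

lemma corner_sides_top_left:
  assumes top: "side_split n V fst (\<lambda>v. snd v - n)" and left: "side_split n V snd fst"
  shows "corner_at V fst (\<lambda>v. n - snd v)"
proof (rule corner_at_beside[OF _ side_splitD(4)[OF left] side_splitD(1,2)[OF left]])
  show "beside V fst (\<lambda>v. n - snd v)" by (rule besideD[OF side_splitD(3)[OF top]]) simp
qed

lemma corner_sides_top_right:
  assumes top: "side_split n V fst (\<lambda>v. snd v - n)" and right: "side_split n V snd (\<lambda>v. fst v - n)"
  shows "corner_at V (\<lambda>v. n - fst v) (\<lambda>v. n - snd v)"
proof (rule corner_at_beside)
  show "beside V (\<lambda>v. n - fst v) (\<lambda>v. n - snd v)" by (rule besideD[OF side_splitD(4)[OF top]]) simp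
  show "beside V (\<lambda>v. n - snd v) (\<lambda>v. n - fst v)" by (rule besideD[OF side_splitD(4)[OF right]]) simp
qed (use side_splitD(1,2)[OF right] in auto)

lemma seg_commute: "seg n a b c d = seg n c d a b"
  unfolding seg_def by (rule closed_segment_commute)

section \<open>The six types\<close>

lemma type_I_imp_bounds:
  assumes n: "3 \<le> n" and P: "type_I n P"
  shows "vertex_bounds (int n) (int_vertices P)"
proof -
  have F: "free_integer_polygon n P" using P unfolding type_I_def by blast
  then have iP: "integer_polygon P" unfolding free_integer_polygon_def by blast
  have n': "3 \<le> int n" using n by simp
  obtain j where "P \<subseteq> {x. of_int j * real n \<le> x $ 1 \<and> x $ 1 \<le> (of_int j + 1) * real n} \<or>
               P \<subseteq> {x. of_int j * real n \<le> x $ 2 \<and> x $ 2 \<le> (of_int j + 1) * real n}"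
    using P unfolding type_I_def by blast
  then consider (x) "P \<subseteq> {x. of_int j * real n \<le> x $ 1 \<and> x $ 1 \<le> (of_int j + 1) * real n}"
    | (y) "P \<subseteq> {x. of_int j * real n \<le> x $ 2 \<and> x $ 2 \<le> (of_int j + 1) * real n}" by blast
  then show ?thesis
  proof cases
    case x
    have bd: "0 \<le> fst v + int n * (- j) \<and> fst v + int n * (- j) \<le> int n" if v: "v \<in> int_vertices P" for v
    proof -
      have "of_int j * real n \<le> of_int (fst v) \<and> of_int (fst v) \<le> (of_int j + 1) * real n"
        using int_vertices_subset[OF iP v] x by auto
      then have "real_of_int (j * int n) \<le> of_int (fst v) \<and> real_of_int (fst v) \<le> of_int ((j + 1) * int n)" by simp
      then show ?thesis unfolding of_int_le_iff by (simp add: algebra_simps)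
    qed
    show ?thesis
      by (rule strip_bounds[OF n' int_vertices_free[OF F], of 1 1 0 0 "\<lambda>v. fst v + int n * (- j)" "- j" snd 0])
        (rule bd | simp)+
  next
    case y
    have bd: "0 \<le> snd v + int n * (- j) \<and> snd v + int n * (- j) \<le> int n" if v: "v \<in> int_vertices P" for v
    proof -
      have "of_int j * real n \<le> of_int (snd v) \<and> of_int (snd v) \<le> (of_int j + 1) * real n"
        using int_vertices_subset[OF iP v] y by auto
      then have "real_of_int (j * int n) \<le> of_int (snd v) \<and> real_of_int (snd v) \<le> of_int ((j + 1) * int n)" by simp
      then show ?thesis unfolding of_int_le_iff by (simp add: algebra_simps)
    qed
    show ?thesis
      by (rule strip_bounds[OF n' int_vertices_free[OF F], of 0 0 1 1 "\<lambda>v. snd v + int n * (- j)" "- j" fst 0])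
        (rule bd | simp)+
  qed
qed

lemma type_II_imp_bounds:
  assumes n: "3 \<le> n" and P: "type_II n P"
  shows "vertex_bounds (int n) (int_vertices P)"
proof -
  have F: "free_integer_polygon n P" using P unfolding type_II_def by blast
  have n': "3 \<le> int n" "0 < n" using n by simp_all
  let ?V = "int_vertices P"
  have b: "side_split (int n) ?V fst snd" and t: "side_split (int n) ?V fst (\<lambda>v. snd v - int n)"
    using seg_imp_side_split(1)[OF F n'(2), of 0 0] seg_imp_side_split(1)[OF F n'(2), of 0 1] P unfolding type_II_def by simp_all
  have l: "side_split (int n) ?V snd fst" and r: "side_split (int n) ?V snd (\<lambda>v. fst v - int n)"
    using seg_imp_side_split(2)[OF F n'(2), of 0 0] seg_imp_side_split(2)[OF F n'(2), of 1 0] P unfolding type_II_def by simp_all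
  show ?thesis
    by (rule square_bounds[OF n'(1) int_vertices_free[OF F], of 1 1 0 0 fst 0 snd 0])
      (use corner_sides[OF b l] corner_sides_bottom_right[OF b r] corner_sides_top_left[OF t l]
          corner_sides_top_right[OF t r] side_splitD(1)[OF l] side_splitD(2)[OF r] side_splitD(1)[OF b]
          side_splitD(2)[OF t] in simp_all)
qed

lemma type_III_imp_bounds:
  assumes n: "3 \<le> n" and P: "type_III n P"
  shows "vertex_bounds (int n) (int_vertices P)"
proof -
  have F: "free_integer_polygon n P" using P unfolding type_III_def by blast
  then have iP: "integer_polygon P" unfolding free_integer_polygon_def by blast
  have n': "3 \<le> int n" "0 < n" using n by simp_all
  let ?V = "int_vertices P"
  have b: "side_split (int n) ?V fst snd" and t: "side_split (int n) ?V fst (\<lambda>v. snd v - int n)"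
    using seg_imp_side_split(1)[OF F n'(2), of 0 0] seg_imp_side_split(1)[OF F n'(2), of 0 1] P seg_commute[of n 1 1 0 1]
    unfolding type_III_def by simp_all
  have r: "side_split (int n) ?V snd (\<lambda>v. fst v - int n)"
    using seg_imp_side_split(2)[OF F n'(2), of 1 0] P unfolding type_III_def by simp
  have "(\<forall>v\<in>?V. fst v \<le> 0) \<or> (\<forall>v\<in>?V. 0 \<le> fst v)"
    using not_splits_line_vertices[OF iP, of 1 0] P unfolding type_III_def vline_def coord_def by simp
  \<comment> \<open>A vertex beyond x = n tells on which side of the wall the polygon lies.\<close>
  then have "\<forall>v\<in>?V. 0 \<le> fst v" using side_splitD(2)[OF r] n' by force
  then show ?thesis
    by (intro half_strip_bounds[OF n'(1) int_vertices_free[OF F], of 1 1 0 0 fst 0 snd 0])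
      (use corner_sides_bottom_right[OF b r] corner_sides_top_right[OF t r] side_splitD(2)[OF r]
          side_splitD(1)[OF b] side_splitD(2)[OF t] in simp_all)
qed

lemma type_IV_imp_bounds:
  assumes n: "3 \<le> n" and P: "type_IV n P"
  shows "vertex_bounds (int n) (int_vertices P)"
proof -
  have F: "free_integer_polygon n P" using P unfolding type_IV_def by blast
  then have iP: "integer_polygon P" unfolding free_integer_polygon_def by blast
  have n': "3 \<le> int n" "0 < n" using n by simp_all
  let ?V = "int_vertices P"
  have b: "side_split (int n) ?V fst snd" and t: "side_split (int n) ?V (\<lambda>v. fst v - int n) (\<lambda>v. snd v - int n)"
    using seg_imp_side_split(1)[OF F n'(2), of 0 0] seg_imp_side_split(1)[OF F n'(2), of 1 1] P unfolding type_IV_def by simp_all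
  have l: "side_split (int n) ?V snd fst" and r: "side_split (int n) ?V snd (\<lambda>v. fst v - int n)"
    using seg_imp_side_split(2)[OF F n'(2), of 0 0] seg_imp_side_split(2)[OF F n'(2), of 1 0] P unfolding type_IV_def by simp_all
  have "beside ?V (\<lambda>v. fst v - int n) (\<lambda>v. int n - snd v)" by (rule besideD[OF side_splitD(3)[OF t]]) simp
  then have c3: "corner_at ?V (\<lambda>v. fst v - int n) (\<lambda>v. int n - snd v)"
    by (rule corner_at_beside[OF _ side_splitD(4)[OF r] side_splitD(1,2)[OF r]])
  obtain \<beta> :: real where c4: "\<And>v. v \<in> ?V \<Longrightarrow> 0 < of_int (int n - (fst v - int n)) + \<beta> * of_int (snd v - int n)"
    using side_splitD(4)[OF t] unfolding beside_def by blast
  have "P \<inter> {x. x $ 1 = of_int (2 * int n)} = {}" using P unfolding type_IV_def vline_def by simp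
  from disjoint_line_vertices[OF iP this]
  have "(\<forall>v\<in>?V. fst v < 2 * int n) \<or> (\<forall>v\<in>?V. 2 * int n < fst v)" unfolding coord_def by simp
  then have wall: "fst v < 2 * int n" if "v \<in> ?V" for v using side_splitD(1)[OF l] n' that by force
  show ?thesis
  proof (rule corner_IV_bounds[OF n'(1) int_vertices_free[OF F] corner_sides[OF b l] corner_sides_bottom_right[OF b r] c3 _ wall])
    show "0 < of_int (2 * int n - fst v) + \<beta> * of_int (snd v - int n)" if "v \<in> ?V" for v
      using c4[OF that] by simp
  qed (use side_splitD(1)[OF l] side_splitD(1)[OF b] side_splitD(2)[OF t] in simp_all)
qed

lemma type_V_imp_bounds:
  assumes n: "3 \<le> n" and P: "type_V n P"
  shows "vertex_bounds (int n) (int_vertices P)"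
proof -
  have F: "free_integer_polygon n P" using P unfolding type_V_def by blast
  then have iP: "integer_polygon P" unfolding free_integer_polygon_def by blast
  have n': "3 \<le> int n" "0 < n" using n by simp_all
  let ?V = "int_vertices P"
  have b: "side_split (int n) ?V (\<lambda>v. fst v + int n) snd"
    using seg_imp_side_split(1)[OF F n'(2), of "-1" 0] P seg_commute[of n 0 0 "-1" 0] unfolding type_V_def by simp
  have l: "side_split (int n) ?V snd fst"
    using seg_imp_side_split(2)[OF F n'(2), of 0 0] P unfolding type_V_def by simp
  have c: "corner_at ?V (\<lambda>v. - fst v) snd"
  proof (rule corner_at_beside)
    show "beside ?V (\<lambda>v. - fst v) snd" using side_splitD(4)[OF b] by simp
    show "beside ?V snd (\<lambda>v. - fst v)" by (rule besideD[OF side_splitD(3)[OF l]]) simp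
  qed (use side_splitD(1,2)[OF l] in auto)
  have "(\<forall>v\<in>?V. fst v \<le> - int n) \<or> (\<forall>v\<in>?V. - int n \<le> fst v)"
    using not_splits_line_vertices[OF iP, of 1 "- int n"] P unfolding type_V_def vline_def coord_def by simp
  then have "\<forall>v\<in>?V. - int n \<le> fst v" using side_splitD(2)[OF l] n' by force
  moreover have "(\<forall>v\<in>?V. snd v \<le> int n) \<or> (\<forall>v\<in>?V. int n \<le> snd v)"
    using not_splits_line_vertices[OF iP, of 2 "int n"] P unfolding type_V_def hline_def coord_def by simp
  then have "\<forall>v\<in>?V. snd v \<le> int n" using side_splitD(1)[OF b] n' by force
  ultimately have "corner_V (int n) ?V" unfolding corner_V_def
    using int_vertices_free[OF F] c side_splitD(1)[OF b] side_splitD(2)[OF l] by blast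
  then show ?thesis by (rule corner_V_bounds[OF n'(1)])
qed

lemma type_VI_imp_bounds:
  assumes n: "3 \<le> n" and P: "type_VI n P"
  shows "vertex_bounds (int n) (int_vertices P)"
proof -
  have F: "free_integer_polygon n P" using P unfolding type_VI_def by blast
  then have iP: "integer_polygon P" unfolding free_integer_polygon_def by blast
  have n': "3 \<le> int n" "0 < n" using n by simp_all
  let ?V = "int_vertices P"
  have b: "side_split (int n) ?V (\<lambda>v. fst v + int n) snd"
    using seg_imp_side_split(1)[OF F n'(2), of "-1" 0] P seg_commute[of n 0 0 "-1" 0] unfolding type_VI_def by simp
  have t: "side_split (int n) ?V fst (\<lambda>v. snd v - int n)"
    using seg_imp_side_split(1)[OF F n'(2), of 0 1] P unfolding type_VI_def by simp
  have l: "side_split (int n) ?V snd fst"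
    using seg_imp_side_split(2)[OF F n'(2), of 0 0] P unfolding type_VI_def by simp
  have c: "corner_at ?V (\<lambda>v. - fst v) snd"
  proof (rule corner_at_beside)
    show "beside ?V (\<lambda>v. - fst v) snd" using side_splitD(4)[OF b] by simp
    show "beside ?V snd (\<lambda>v. - fst v)" by (rule besideD[OF side_splitD(3)[OF l]]) simp
  qed (use side_splitD(1,2)[OF l] in auto)
  have "(\<forall>v\<in>?V. fst v \<le> - int n) \<or> (\<forall>v\<in>?V. - int n \<le> fst v)"
    using not_splits_line_vertices[OF iP, of 1 "- int n"] P unfolding type_VI_def vline_def coord_def by simp
  then have "\<forall>v\<in>?V. - int n \<le> fst v" using side_splitD(2)[OF l] n' by force
  moreover have "(\<forall>v\<in>?V. fst v \<le> int n) \<or> (\<forall>v\<in>?V. int n \<le> fst v)"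
    using not_splits_line_vertices[OF iP, of 1 "int n"] P unfolding type_VI_def vline_def coord_def by simp
  then have "\<forall>v\<in>?V. fst v \<le> int n" using side_splitD(1)[OF l] n' by force
  moreover have "\<exists>v\<in>?V. int n < snd v" using side_splitD(2)[OF t] by simp
  ultimately have "corner_VI (int n) ?V" unfolding corner_VI_def
    using int_vertices_free[OF F] c corner_sides_top_left[OF t l] side_splitD(1)[OF b] by blast
  then show ?thesis by (rule corner_VI_bounds[OF n'(1)])
qed

theorem theorem1p4:
  fixes n N :: nat and P :: "(real^2) set"
  assumes "n \<ge> 3"
    and "ngon N P"
    and "integer_polygon P"
    and "type_I n P \<or> type_II n P \<or> type_III n P \<or> type_IV n P \<or> type_V n P \<or> type_VI n P"
  shows "N \<le> 2 * n + 2 \<and>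
    (even n \<longrightarrow>
       (\<forall>L. has_invariant_factors L 1 (int n div 2) \<and> vertices P \<subseteq> L \<longrightarrow> N \<le> 2 * n)) \<and>
    (\<forall>L. has_invariant_factors L 1 (int n) \<and> vertices P \<subseteq> L \<longrightarrow> N \<le> 2 * n - 2)"
proof -
  let ?V = "int_vertices P"
  have bounds: "vertex_bounds (int n) ?V"
    using assms(1,4) type_I_imp_bounds type_II_imp_bounds type_III_imp_bounds type_IV_imp_bounds type_V_imp_bounds
      type_VI_imp_bounds by blast
  have N: "N = card ?V" using assms(2,3) int_vertices(2) unfolding ngon_def by metis
  have sub: "sublattice m {v. real_pt v \<in> L} \<and> ?V \<subseteq> {v. real_pt v \<in> L}"
    if "has_invariant_factors L 1 m" "vertices P \<subseteq> L" for L m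
    using has_invariant_factors_sublattice[OF that(1)] that(2) unfolding int_vertices_def by blast
  show ?thesis
  proof (intro conjI impI allI; (elim conjE)?)
    show "N \<le> 2 * n + 2" using bounds N unfolding vertex_bounds_def by simp
  next
    fix L assume "even n" "has_invariant_factors L 1 (int n div 2)" "vertices P \<subseteq> L"
    moreover have "int n = 2 * (int n div 2)" using \<open>even n\<close> by simp
    ultimately have "int (card ?V) \<le> 2 * int n" using bounds sub[of L "int n div 2"] unfolding vertex_bounds_def by blast
    then show "N \<le> 2 * n" using N by simp
  next
    fix L assume "has_invariant_factors L 1 (int n)" "vertices P \<subseteq> L"
    then have "int (card ?V) \<le> 2 * int n - 2" using bounds sub[of L "int n"] unfolding vertex_bounds_def by blast
    then show "N \<le> 2 * n - 2" using N by linarith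
  qed
qed

end
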